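(* Let $N_T\ge 2$, $N_R\ge N_T$ be integers, $N=N_R-N_T+1$, and let $H=H_d+H_r$ be the random $N_R\times N_T$ complex matrix of the full-Rician fading model with rank-one deterministic part $H_d=ab^{\mathsf H}$ and column covariance matrix $R$ described in the context. Let $\Gamma_s>0$, let $\gamma_1=\Gamma_s/[(H^{\mathsf H}H)^{-1}]_{1,1}$ be the zero-forcing SNR of stream 1, and let $\Gamma_1,x_1,x_2$ be as in the context. Then the moment generating function $M_{\gamma_1}(s;x_1,x_2)=\mathbb E\{e^{s\gamma_1}\}$ is, for all complex $s$ with $\operatorname{Re}s<1/\Gamma_1$, $$M_{\gamma_1}(s;x_1,x_2)=\frac{1}{(1-\Gamma_1 s)^N}\sum_{n_2=0}^\infty \frac{e^{-x_2}x_2^{n_2}}{n_2!}\;{}_1F_1\!\left(N;\,n_2+N_R;\,\frac{\Gamma_1 s}{1-\Gamma_1 s}\,x_1\right).$$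
   Context: Notation: $\cdot^{\mathsf H}$ is conjugate transpose, $\cdot^*$ complex conjugation, $\|\cdot\|$ the Euclidean/Frobenius norm. ${}_1F_1(\alpha;\beta;\sigma)=\sum_{n\ge0}\frac{(\alpha)_n}{(\beta)_n}\frac{\sigma^n}{n!}$ is the confluent hypergeometric function, with $(\alpha)_0=1$, $(\alpha)_n=\alpha(\alpha+1)\cdots(\alpha+n-1)$. Model (full-Rician fading with rank-one mean). $K>0$ is a real number (Rician $K$-factor). $R_T$ is an $N_T\times N_T$ Hermitian positive definite matrix with trace $N_T$, and $R=\frac{1}{K+1}R_T$. $H_d=ab^{\mathsf H}$ where $a\in\mathbb C^{N_R}$, $\|a\|=1$, $b=(b_1,\dots,b_{N_T})^{\mathsf T}\in\mathbb C^{N_T}$ has all entries nonzero and $\|b\|^2=\frac{K}{K+1}N_RN_T$. $H_r=H_wR^{1/2}$, where $R^{1/2}$ is the Hermitian square root of $R$ and $H_w$ is $N_R\times N_T$ with i.i.d. standard circularly-symmetric complex Gaussian entries (mean $0$, $\mathbb E|\cdot|^2=1$). Thus the rows of $H_r$ are independent and $\mathbb E\{H_r^{\mathsf H}H_r\}=N_R R$. $H=H_d+H_r$ has rank $N_T$ almost surely. Partition $R=\begin{pmatrix} r_{11}& \rho^{\mathsf H}\\ \rho & R_{22}\end{pmatrix}$ with $r_{11}$ scalar, $\rho\in\mathbb C^{N_T-1}$, and $R_{22}$ of size $(N_T-1)\times(N_T-1)$. Put $r_{2,1}=R_{22}^{-1}\rho$, $\tilde b=(b_2,\dots,b_{N_T})^{\mathsf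 T}$, $\mu_1=b_1^*-\tilde b^{\mathsf H}r_{2,1}$, and $$\Gamma_1=\frac{\Gamma_s}{[R^{-1}]_{1,1}},\qquad x_1=[R^{-1}]_{1,1}\,|\mu_1|^2,\qquad x_2=\tilde b^{\mathsf H}R_{22}^{-1}\tilde b .$$ *)

theory Defs
  imports
    "HOL-Probability.Probability"
    "Jordan_Normal_Form.Gauss_Jordan_Elimination"
    "Jordan_Normal_Form.Schur_Decomposition"
begin

(* Both HOL-Analysis and Jordan_Normal_Form use "$"; here it is always indexing of dynamically
   sized vectors. All indices are 0-based, so entry 1 of the mathematical text is index 0. *)
unbundle no vec_syntax
hide_const (open) Finite_Cartesian_Product.vec Finite_Cartesian_Product.row
  Finite_Cartesian_Product.column Finite_Cartesian_Product.mat Determinants.det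

definition euclid_norm :: "complex vec \<Rightarrow> real" where
  "euclid_norm v = L2_set (\<lambda>i. cmod (v $ i)) {..<dim_vec v}"

definition hermitian_mat :: "nat \<Rightarrow> complex mat \<Rightarrow> bool" where
  "hermitian_mat n A \<longleftrightarrow> A \<in> carrier_mat n n \<and> mat_adjoint A = A"

(* (A *v v) \<bullet>c v is v^H A v, because \<bullet>c conjugates its second argument. For Hermitian A it is
   a real number, so taking the real part loses nothing. *)
definition hermitian_pos_def :: "nat \<Rightarrow> complex mat \<Rightarrow> bool" where
  "hermitian_pos_def n A \<longleftrightarrow> hermitian_mat n A \<and>
     (\<forall>v \<in> carrier_vec n. v \<noteq> 0\<^sub>v n \<longrightarrow> Re ((A *\<^sub>v v) \<bullet>c v) > 0)"

definition hermitian_pos_semidef :: "nat \<Rightarrow> complex mat \<Rightarrow> bool" where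
  "hermitian_pos_semidef n A \<longleftrightarrow> hermitian_mat n A \<and>
     (\<forall>v \<in> carrier_vec n. Re ((A *\<^sub>v v) \<bullet>c v) \<ge> 0)"

(* S is the (unique) positive semidefinite Hermitian square root of R. *)
definition is_hermitian_sqrt :: "nat \<Rightarrow> complex mat \<Rightarrow> complex mat \<Rightarrow> bool" where
  "is_hermitian_sqrt n S R \<longleftrightarrow> hermitian_pos_semidef n S \<and> S * S = R"

(* The matrix inverse made total; singular matrices get the junk value 0. *)
definition minv :: "complex mat \<Rightarrow> complex mat" where
  "minv A = (case mat_inverse A of Some B \<Rightarrow> B | None \<Rightarrow> 0\<^sub>m (dim_row A) (dim_col A))"

(* a b^H *)
definition outer_prod :: "complex vec \<Rightarrow> complex vec \<Rightarrow> complex mat" where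
  "outer_prod a b = mat (dim_vec a) (dim_vec b) (\<lambda>(i, j). a $ i * cnj (b $ j))"

(* Density, with respect to Lebesgue measure on the complex plane, of the circularly-symmetric
   complex Gaussian distribution with mean 0 and E|z|^2 = 1. *)
definition std_cgauss_density :: "complex \<Rightarrow> real" where
  "std_cgauss_density z = exp (- (cmod z)\<^sup>2) / pi"

definition iid_std_cgauss_mat ::
    "'w measure \<Rightarrow> nat \<Rightarrow> nat \<Rightarrow> ('w \<Rightarrow> complex mat) \<Rightarrow> bool" where
  "iid_std_cgauss_mat M m n W \<longleftrightarrow>
     (\<forall>\<omega> \<in> space M. W \<omega> \<in> carrier_mat m n) \<and>
     prob_space.indep_vars M (\<lambda>_. borel) (\<lambda>(i, j) \<omega>. W \<omega> $$ (i, j)) ({..<m} \<times> {..<n}) \<and>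
     (\<forall>i<m. \<forall>j<n. distributed M lborel (\<lambda>\<omega>. W \<omega> $$ (i, j))
        (\<lambda>z. ennreal (std_cgauss_density z)))"

definition hyp1F1 :: "complex \<Rightarrow> complex \<Rightarrow> complex \<Rightarrow> complex" where
  "hyp1F1 \<alpha> \<beta> \<sigma> = (\<Sum>n. pochhammer \<alpha> n / pochhammer \<beta> n * (\<sigma> ^ n / fact n))"

definition mgf :: "'w measure \<Rightarrow> ('w \<Rightarrow> real) \<Rightarrow> complex \<Rightarrow> complex" where
  "mgf M X s = (LINT \<omega>|M. exp (s * complex_of_real (X \<omega>)))"

(* In the following definitions Re is applied only to quantities that are real whenever the
   matrices involved are Hermitian: diagonal entries of inverses and quadratic forms. *)

definition zf_snr :: "real \<Rightarrow> complex mat \<Rightarrow> real" where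
  "zf_snr \<Gamma>\<^sub>s H = \<Gamma>\<^sub>s / Re (minv (mat_adjoint H * H) $$ (0, 0))"

(* Blocks of the partition R = [r11, rho^H; rho, R22] with scalar r11, and the tail of b. *)
definition block22 :: "complex mat \<Rightarrow> complex mat" where
  "block22 R = mat_delete R 0 0"

definition block21 :: "complex mat \<Rightarrow> complex vec" where
  "block21 R = vec_last (col R 0) (dim_row R - 1)"

definition tail_vec :: "complex vec \<Rightarrow> complex vec" where
  "tail_vec b = vec_last b (dim_vec b - 1)"

definition r21 :: "complex mat \<Rightarrow> complex vec" where
  "r21 R = minv (block22 R) *\<^sub>v block21 R"

definition mu1 :: "complex mat \<Rightarrow> complex vec \<Rightarrow> complex" where
  "mu1 R b = cnj (b $ 0) - r21 R \<bullet>c tail_vec b"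

definition Gamma1 :: "real \<Rightarrow> complex mat \<Rightarrow> real" where
  "Gamma1 \<Gamma>\<^sub>s R = \<Gamma>\<^sub>s / Re (minv R $$ (0, 0))"

definition x1_param :: "complex mat \<Rightarrow> complex vec \<Rightarrow> real" where
  "x1_param R b = Re (minv R $$ (0, 0)) * (cmod (mu1 R b))\<^sup>2"

definition x2_param :: "complex mat \<Rightarrow> complex vec \<Rightarrow> real" where
  "x2_param R b = Re ((minv (block22 R) *\<^sub>v tail_vec b) \<bullet>c tail_vec b)"

end

theory Submission
  imports Defs "HOL-Real_Asymp.Real_Asymp"
begin

text \<open>
  The zero-forcing SNR is, up to scaling, the squared distance of the first column of \<open>H\<close> to the span of the
  other columns. Multiplying the Gaussian matrix on the right by a unitary matrix preserves its law, and a suitable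
  choice makes the first column independent of the span of the others. Given the span, a unitary transformation of
  the rows turns the distance into the squared norm of a noncentral Gaussian vector in dimension \<open>N\<close>, whose
  noncentrality is \<open>x1\<close> times the squared distance \<open>B\<close> of \<open>a\<close> to the span. Averaging
  \<open>exp (\<theta> B)\<close> remains: splitting off the row along \<open>a\<close> shows that \<open>B\<close> has the law of \<open>t / (t + v)\<close>, where
  \<open>t\<close> and \<open>v\<close> are independent, \<open>t\<close> is an Erlang variable and \<open>v\<close> is a Poisson mixture of Erlang variables
  with parameter \<open>x2\<close>. The moments of this ratio are the coefficients of the confluent hypergeometric function.
\<close>

section \<open>Standard complex Gaussian measure\<close>

text \<open>Unitary invariance is established only for maps generated by plane rotations. It thereby
  reduces to two complex coordinates, where shears and Tonelli suffice, and such maps can still move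
  any given vector onto a coordinate axis, which is how the rotations below are chosen. The distance
  to a span is given by a recursion with division, measurable by inspection and total even for
  dependent columns; its geometry is read off from residuals. With \<open>S\<close> the square root
  of \<open>R\<close>, the rows are rotated so that the conjugate of \<open>S u\<close> falls on the
  first axis: \<open>S u\<close> is orthogonal to the images under \<open>S\<close> of all vectors
  with vanishing first entry. The mean row is rotated along; its first entry carries
  \<open>x1\<close>, the others carry \<open>x2\<close>. Given the other columns, the transform of
  the noncentral law contributes \<open>exp (\<theta> * B)\<close>, where \<theta> is
  \<open>x1\<close> times \<open>\<tau> / (1 - \<tau>)\<close> and \<tau> is Gamma1 times s; hence
  the argument of the hypergeometric function. In \<open>B\<close> the Erlang shapes are N for
  \<open>t\<close> and n + N_T - 1 for the mixture component n of \<open>v\<close>; their sum n +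
  N_R is the second parameter.\<close>

definition cgauss :: "complex measure" where
  "cgauss = density lborel (\<lambda>z. ennreal (std_cgauss_density z))"

lemma std_cgauss_density_nonneg [simp]: "0 \<le> std_cgauss_density z"
  by (simp add: std_cgauss_density_def)

lemma borel_measurable_std_cgauss_density [measurable]: "std_cgauss_density \<in> borel_measurable borel"
  unfolding std_cgauss_density_def[abs_def] by measurable

lemma sets_cgauss [simp, measurable_cong]: "sets cgauss = sets borel"
  by (simp add: cgauss_def)

lemma space_cgauss [simp]: "space cgauss = UNIV"
  by (simp add: cgauss_def)

lemma emeasure_complex_disc:
  assumes "0 \<le> t"
  shows "emeasure lborel {z::complex. (cmod z)\<^sup>2 \<le> t} = ennreal (pi * t)"
proof -
  have "{z::complex. (cmod z)\<^sup>2 \<le> t} = cball 0 (sqrt t)"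
    using assms by (auto simp: dist_norm) (metis real_le_rsqrt, metis norm_ge_zero real_sqrt_le_iff real_sqrt_unique sqrt_le_D)
  then show ?thesis
    using assms by (simp add: emeasure_cball unit_ball_vol_2)
qed

lemma emeasure_complex_annulus:
  assumes "0 \<le> u" "u \<le> t"
  shows "emeasure lborel {z::complex. u < (cmod z)\<^sup>2 \<and> (cmod z)\<^sup>2 \<le> t} = ennreal (pi * (t - u))"
proof -
  have "{z::complex. u < (cmod z)\<^sup>2 \<and> (cmod z)\<^sup>2 \<le> t} = {z. (cmod z)\<^sup>2 \<le> t} - {z. (cmod z)\<^sup>2 \<le> u}"
    by auto
  also have "emeasure lborel \<dots> = emeasure lborel {z::complex. (cmod z)\<^sup>2 \<le> t} - emeasure lborel {z::complex. (cmod z)\<^sup>2 \<le> u}"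
    using assms by (intro emeasure_Diff) (auto simp: emeasure_complex_disc)
  also have "\<dots> = ennreal (pi * (t - u))"
    using assms by (simp add: emeasure_complex_disc ennreal_minus[symmetric] algebra_simps)
  finally show ?thesis .
qed

text \<open>Layer cake: \<open>exp (- r)\<close> is the integral of \<open>exp (- t)\<close> over \<open>t \<ge> r\<close>, so only areas of annuli enter.\<close>
lemma emeasure_cgauss_tail:
  assumes u: "0 \<le> u"
  shows "emeasure cgauss {z. u < (cmod z)\<^sup>2} = ennreal (exp (- u))"
proof -
  have tail: "(\<integral>\<^sup>+t. ennreal (exp (- t)) * indicator {a..} t \<partial>lborel) = ennreal (exp (- a))" for a :: real
  proof -
    have "(\<integral>\<^sup>+t. ennreal (exp (- t)) * indicator {a..} t \<partial>lborel) = ennreal (0 - (- exp (- a)))"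
    proof (rule nn_integral_FTC_atLeast)
      show "((\<lambda>t. - exp (- t)) \<longlongrightarrow> (0::real)) at_top" by real_asymp
    qed (auto intro!: derivative_eq_intros)
    then show ?thesis by simp
  qed
  have "emeasure cgauss {z. u < (cmod z)\<^sup>2} =
      (\<integral>\<^sup>+z. ennreal (std_cgauss_density z) * indicator {z. u < (cmod z)\<^sup>2} z \<partial>lborel)"
    unfolding cgauss_def by (subst emeasure_density) auto
  also have "\<dots> = (\<integral>\<^sup>+z. (\<integral>\<^sup>+t. ennreal (exp (- t) / pi) * indicator {z. u < (cmod z)\<^sup>2 \<and> (cmod z)\<^sup>2 \<le> t} z \<partial>lborel) \<partial>lborel)"
  proof (intro nn_integral_cong)
    fix z :: complex
    have "(\<integral>\<^sup>+t. ennreal (exp (- t) / pi) * indicator {z. u < (cmod z)\<^sup>2 \<and> (cmod z)\<^sup>2 \<le> t} z \<partial>lborel)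
      = (\<integral>\<^sup>+t. (ennreal (exp (- t)) * indicator {(cmod z)\<^sup>2..} t) * (ennreal (1 / pi) * indicator {z. u < (cmod z)\<^sup>2} z) \<partial>lborel)"
      by (intro nn_integral_cong) (auto simp: indicator_def ennreal_mult[symmetric])
    also have "\<dots> = ennreal (exp (- (cmod z)\<^sup>2)) * (ennreal (1 / pi) * indicator {z. u < (cmod z)\<^sup>2} z)"
      by (subst nn_integral_multc) (auto simp: tail)
    finally show "ennreal (std_cgauss_density z) * indicator {z. u < (cmod z)\<^sup>2} z =
        (\<integral>\<^sup>+t. ennreal (exp (- t) / pi) * indicator {z. u < (cmod z)\<^sup>2 \<and> (cmod z)\<^sup>2 \<le> t} z \<partial>lborel)"
      by (auto simp: std_cgauss_density_def indicator_def ennreal_mult[symmetric])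
  qed
  also have "\<dots> = (\<integral>\<^sup>+t. (\<integral>\<^sup>+z. ennreal (exp (- t) / pi) * indicator {z::complex. u < (cmod z)\<^sup>2 \<and> (cmod z)\<^sup>2 \<le> t} z \<partial>lborel) \<partial>lborel)"
    by (intro lborel_pair.Fubini') (simp add: split_beta' indicator_def)
  also have "\<dots> = (\<integral>\<^sup>+t. ennreal ((t - u) * exp (- t)) * indicator {u..} t \<partial>lborel)"
  proof (intro nn_integral_cong)
    fix t :: real
    have "(\<integral>\<^sup>+z. ennreal (exp (- t) / pi) * indicator {z::complex. u < (cmod z)\<^sup>2 \<and> (cmod z)\<^sup>2 \<le> t} z \<partial>lborel)
      = ennreal (exp (- t) / pi) * emeasure lborel {z::complex. u < (cmod z)\<^sup>2 \<and> (cmod z)\<^sup>2 \<le> t}"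
      by (subst nn_integral_cmult_indicator) auto
    also have "\<dots> = ennreal ((t - u) * exp (- t)) * indicator {u..} t"
    proof (cases "u \<le> t")
      case True
      then show ?thesis using u by (simp add: emeasure_complex_annulus ennreal_mult[symmetric])
    next
      case False
      then have *: "{z::complex. u < (cmod z)\<^sup>2 \<and> (cmod z)\<^sup>2 \<le> t} = {}" by auto
      show ?thesis unfolding * using False by simp
    qed
    finally show "(\<integral>\<^sup>+z. ennreal (exp (- t) / pi) * indicator {z::complex. u < (cmod z)\<^sup>2 \<and> (cmod z)\<^sup>2 \<le> t} z \<partial>lborel)
      = ennreal ((t - u) * exp (- t)) * indicator {u..} t" .
  qed
  also have "\<dots> = ennreal (0 - (- (u - u + 1) * exp (- u)))"
  proof (rule nn_integral_FTC_atLeast[where F = "\<lambda>t. - (t - u + 1) * exp (- t)"])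
    show "((\<lambda>t. - (t - u + 1) * exp (- t)) \<longlongrightarrow> 0) at_top"
      by real_asymp
  qed (auto intro!: derivative_eq_intros simp: algebra_simps)
  finally show ?thesis by simp
qed

text \<open>The tail at \<open>u = 0\<close> gives the punctured plane mass one, and the origin is a
  null set.\<close>

lemma prob_space_cgauss: "prob_space cgauss"
proof
  have "emeasure cgauss (space cgauss) = emeasure cgauss {z. 0 < (cmod z)\<^sup>2} + emeasure cgauss {0}"
    by (subst plus_emeasure) (auto intro!: arg_cong[where f="emeasure cgauss"])
  also have "emeasure cgauss {0} = 0"
    unfolding cgauss_def by (subst emeasure_density) auto
  finally show "emeasure cgauss (space cgauss) = 1"
    using emeasure_cgauss_tail[of 0] by simp
qed

interpretation cgauss: prob_space cgauss by (rule prob_space_cgauss)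
interpretation cgauss_prod: product_prob_space "\<lambda>_. cgauss" UNIV ..

text \<open>The index is one less than the shape: \<open>erl k\<close> is the Gamma law of shape
  \<open>k + 1\<close> and rate one, so a central complex Gaussian vector in dimension
  \<open>d\<close> has a squared norm of law \<open>erl (d - 1)\<close>.\<close>

definition erl :: "nat \<Rightarrow> real measure" where
  "erl k = density lborel (\<lambda>t. ennreal (erlang_density k 1 t))"

lemma sets_erl [simp, measurable_cong]: "sets (erl k) = sets borel"
  by (simp add: erl_def)

lemma space_erl [simp]: "space (erl k) = UNIV"
  by (simp add: erl_def)

lemma prob_space_erl: "prob_space (erl k)"
  unfolding erl_def by (rule prob_space_erlang_density) simp

lemma distr_cgauss_cmod_square: "distr cgauss borel (\<lambda>z. (cmod z)\<^sup>2) = erl 0"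
proof -
  have "distributed cgauss lborel (\<lambda>z. (cmod z)\<^sup>2) (exponential_density 1)"
  proof (rule erlang_distributedI)
    fix a :: real assume "0 \<le> a"
    have "{z \<in> space cgauss. (cmod z)\<^sup>2 \<le> a} = UNIV - {z. a < (cmod z)\<^sup>2}" by auto
    also have "emeasure cgauss \<dots> = ennreal (1 - exp (- a))"
      using \<open>0 \<le> a\<close>
      using cgauss.emeasure_space_1
      by (subst emeasure_Diff) (auto simp: emeasure_cgauss_tail ennreal_minus simp flip: ennreal_1)
    finally show "emeasure cgauss {z \<in> space cgauss. (cmod z)\<^sup>2 \<le> a} = erlang_CDF 0 1 a"
      using \<open>0 \<le> a\<close> by (simp add: erlang_CDF_0)
  qed auto
  from distributed_distr_eq_density[OF this]
  have "distr cgauss lborel (\<lambda>z. (cmod z)\<^sup>2) = erl 0"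
    by (simp only: erl_def)
  moreover have "distr cgauss lborel (\<lambda>z. (cmod z)\<^sup>2) = distr cgauss borel (\<lambda>z. (cmod z)\<^sup>2)"
    by (intro distr_cong) simp_all
  ultimately show ?thesis by simp
qed

section \<open>Invariance of Gaussian pairs under SU(2)\<close>

lemma nn_integral_lborel_translate:
  fixes c :: "'a::euclidean_space"
  assumes [measurable]: "f \<in> borel_measurable borel"
  shows "(\<integral>\<^sup>+x. f (x + c) \<partial>lborel) = (\<integral>\<^sup>+x. f x \<partial>lborel)"
proof -
  have "(\<integral>\<^sup>+x. f x \<partial>lborel) = (\<integral>\<^sup>+x. f x \<partial>distr lborel borel ((+) c))"
    by (simp add: lborel_distr_plus)
  also have "\<dots> = (\<integral>\<^sup>+x. f (c + x) \<partial>lborel)"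
    by (subst nn_integral_distr) auto
  finally show ?thesis by (simp add: add.commute)
qed

text \<open>For a fixed second coordinate the shear is a translation of the first one, so Tonelli
  and translation invariance replace a Jacobian.\<close>

lemma nn_integral_lborel_shear1:
  fixes c :: complex
  assumes [measurable]: "f \<in> borel_measurable (lborel \<Otimes>\<^sub>M lborel)"
  shows "(\<integral>\<^sup>+p. f (fst p + c * snd p, snd p) \<partial>(lborel \<Otimes>\<^sub>M lborel)) = (\<integral>\<^sup>+p. f p \<partial>(lborel \<Otimes>\<^sub>M lborel))"
proof -
  have "(\<integral>\<^sup>+p. f (fst p + c * snd p, snd p) \<partial>(lborel \<Otimes>\<^sub>M lborel))
      = (\<integral>\<^sup>+y. (\<integral>\<^sup>+x. f (x + c * y, y) \<partial>lborel) \<partial>lborel)"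
    by (subst lborel_pair.nn_integral_snd[symmetric]) auto
  also have "\<dots> = (\<integral>\<^sup>+y. (\<integral>\<^sup>+x. f (x, y) \<partial>lborel) \<partial>lborel)"
    by (intro nn_integral_cong nn_integral_lborel_translate) measurable
  also have "\<dots> = (\<integral>\<^sup>+p. f p \<partial>(lborel \<Otimes>\<^sub>M lborel))"
    by (subst lborel_pair.nn_integral_snd) auto
  finally show ?thesis .
qed

lemma nn_integral_lborel_shear2:
  fixes c :: complex
  assumes [measurable]: "f \<in> borel_measurable (lborel \<Otimes>\<^sub>M lborel)"
  shows "(\<integral>\<^sup>+p. f (fst p, snd p + c * fst p) \<partial>(lborel \<Otimes>\<^sub>M lborel)) = (\<integral>\<^sup>+p. f p \<partial>(lborel \<Otimes>\<^sub>M lborel))"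
proof -
  have "(\<integral>\<^sup>+p. f (fst p, snd p + c * fst p) \<partial>(lborel \<Otimes>\<^sub>M lborel))
      = (\<integral>\<^sup>+x. (\<integral>\<^sup>+y. f (x, y + c * x) \<partial>lborel) \<partial>lborel)"
    by (subst lborel.nn_integral_fst[symmetric]) auto
  also have "\<dots> = (\<integral>\<^sup>+x. (\<integral>\<^sup>+y. f (x, y) \<partial>lborel) \<partial>lborel)"
    by (intro nn_integral_cong nn_integral_lborel_translate) measurable
  also have "\<dots> = (\<integral>\<^sup>+p. f p \<partial>(lborel \<Otimes>\<^sub>M lborel))"
    by (subst lborel.nn_integral_fst) auto
  finally show ?thesis .
qed

text \<open>The matrix with rows \<open>(c, - cnj s)\<close> and \<open>(s, cnj c)\<close>; when the
  squared moduli of \<open>c\<close> and \<open>s\<close> add up to one, it is the general element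
  of SU(2).\<close>

definition su2 :: "complex \<Rightarrow> complex \<Rightarrow> complex \<times> complex \<Rightarrow> complex \<times> complex" where
  "su2 c s p = (c * fst p - cnj s * snd p, s * fst p + cnj c * snd p)"

lemma measurable_su2 [measurable]: "su2 c s \<in> borel \<Otimes>\<^sub>M borel \<rightarrow>\<^sub>M borel \<Otimes>\<^sub>M borel"
  unfolding su2_def[abs_def] by measurable

lemma unit_pair_cnj:
  assumes "(cmod c)\<^sup>2 + (cmod s)\<^sup>2 = 1"
  shows "c * cnj c + s * cnj s = 1"
  by (metis assms complex_norm_square of_real_1 of_real_add)

lemma su2_norm:
  assumes "(cmod c)\<^sup>2 + (cmod s)\<^sup>2 = 1"
  shows "(cmod (fst (su2 c s p)))\<^sup>2 + (cmod (snd (su2 c s p)))\<^sup>2 = (cmod (fst p))\<^sup>2 + (cmod (snd p))\<^sup>2"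
proof -
  have "complex_of_real ((cmod (fst (su2 c s p)))\<^sup>2 + (cmod (snd (su2 c s p)))\<^sup>2) =
     (c * cnj c + s * cnj s) * complex_of_real ((cmod (fst p))\<^sup>2 + (cmod (snd p))\<^sup>2)"
    unfolding of_real_add complex_norm_square by (simp add: su2_def algebra_simps)
  then show ?thesis unfolding unit_pair_cnj[OF assms] by (simp only: mult_1 of_real_eq_iff)
qed

text \<open>A matrix of determinant one whose lower left entry does not vanish is a product of three shears.\<close>
lemma nn_integral_lborel_su2:
  assumes [measurable]: "f \<in> borel_measurable (lborel \<Otimes>\<^sub>M lborel)"
    and cs: "(cmod c)\<^sup>2 + (cmod s)\<^sup>2 = 1" and s: "s \<noteq> 0"
  shows "(\<integral>\<^sup>+p. f (su2 c s p) \<partial>(lborel \<Otimes>\<^sub>M lborel)) = (\<integral>\<^sup>+p. f p \<partial>(lborel \<Otimes>\<^sub>M lborel))"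
proof -
  \<comment> \<open>The product of the three shears has diagonal entries \<open>1 + t1 * s\<close>
    and \<open>1 + t2 * s\<close>. Matching them with \<open>c\<close> and \<open>cnj c\<close>
    fixes \<open>t1\<close> and \<open>t2\<close>; determinant one then forces the upper right
    entry.\<close>
  define t1 where "t1 = (c - 1) / s"
  define t2 where "t2 = (cnj c - 1) / s"
  let ?A = "\<lambda>t p. (fst p + t * snd p, snd p) :: complex \<times> complex"
  let ?B = "\<lambda>t p. (fst p, snd p + t * fst p) :: complex \<times> complex"
  have t: "t1 * s = c - 1" "t2 * s = cnj c - 1"
    using s by (simp_all add: t1_def t2_def)
  have "(t1 + t2 + t1 * t2 * s) * s = (t1 * s) + (t2 * s) + (t1 * s) * (t2 * s)"
    by (simp add: algebra_simps)
  also have "\<dots> = c * cnj c - 1"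
    unfolding t by (simp add: algebra_simps)
  also have "\<dots> = - cnj s * s"
    using unit_pair_cnj[OF cs] by (simp add: algebra_simps)
  finally have t3: "t1 + t2 + t1 * t2 * s = - cnj s" using s by (simp only: mult_cancel_right) simp
  have su2_eq: "su2 c s p = ?A t1 (?B s (?A t2 p))" for p
  proof -
    have "c * fst p - cnj s * snd p = (1 + t1 * s) * fst p + (t1 + t2 + t1 * t2 * s) * snd p"
      unfolding t3 t by (simp add: algebra_simps)
    moreover have "s * fst p + cnj c * snd p = s * fst p + (1 + t2 * s) * snd p"
      unfolding t by simp
    ultimately show ?thesis
      by (simp add: su2_def algebra_simps)
  qed
  have "(\<integral>\<^sup>+p. f (su2 c s p) \<partial>(lborel \<Otimes>\<^sub>M lborel)) = (\<integral>\<^sup>+p. f (?A t1 (?B s (?A t2 p))) \<partial>(lborel \<Otimes>\<^sub>M lborel))"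
    by (simp only: su2_eq)
  also have "\<dots> = (\<integral>\<^sup>+p. f (?A t1 (?B s p)) \<partial>(lborel \<Otimes>\<^sub>M lborel))"
    by (rule nn_integral_lborel_shear1[where f = "\<lambda>p. f (?A t1 (?B s p))"]) measurable
  also have "\<dots> = (\<integral>\<^sup>+p. f (?A t1 p) \<partial>(lborel \<Otimes>\<^sub>M lborel))"
    by (rule nn_integral_lborel_shear2[where f = "\<lambda>p. f (?A t1 p)"]) measurable
  also have "\<dots> = (\<integral>\<^sup>+p. f p \<partial>(lborel \<Otimes>\<^sub>M lborel))"
    by (rule nn_integral_lborel_shear1) measurable
  finally show ?thesis .
qed

text \<open>The product density depends on the pair through its squared norm alone, hence is fixed
  by \<open>su2\<close>; only Lebesgue measure remains to be transformed.\<close>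

lemma pair_cgauss: "cgauss \<Otimes>\<^sub>M cgauss =
    density (lborel \<Otimes>\<^sub>M lborel) (\<lambda>p. ennreal (exp (- ((cmod (fst p))\<^sup>2 + (cmod (snd p))\<^sup>2)) / pi\<^sup>2))"
proof -
  have "cgauss \<Otimes>\<^sub>M cgauss = density (lborel \<Otimes>\<^sub>M lborel)
      (\<lambda>(x, y). ennreal (std_cgauss_density x) * ennreal (std_cgauss_density y))"
    using cgauss.sigma_finite_measure_axioms unfolding cgauss_def
    by (intro pair_measure_density) (auto intro: lborel.sigma_finite_measure_axioms)
  also have "\<dots> = density (lborel \<Otimes>\<^sub>M lborel) (\<lambda>p. ennreal (exp (- ((cmod (fst p))\<^sup>2 + (cmod (snd p))\<^sup>2)) / pi\<^sup>2))"
    by (intro arg_cong[where f = "density _"] ext)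
       (auto simp: std_cgauss_density_def ennreal_mult[symmetric] exp_add[symmetric] power2_eq_square)
  finally show ?thesis .
qed

lemma nn_integral_cgauss_su2_aux:
  assumes [measurable]: "f \<in> borel_measurable (borel \<Otimes>\<^sub>M borel)"
    and cs: "(cmod c)\<^sup>2 + (cmod s)\<^sup>2 = 1" and s: "s \<noteq> 0"
  shows "(\<integral>\<^sup>+p. f (su2 c s p) \<partial>(cgauss \<Otimes>\<^sub>M cgauss)) = (\<integral>\<^sup>+p. f p \<partial>(cgauss \<Otimes>\<^sub>M cgauss))"
proof -
  let ?g = "\<lambda>p. ennreal (exp (- ((cmod (fst p))\<^sup>2 + (cmod (snd p))\<^sup>2)) / pi\<^sup>2)"
  have "(\<integral>\<^sup>+p. f (su2 c s p) \<partial>(cgauss \<Otimes>\<^sub>M cgauss)) = (\<integral>\<^sup>+p. ?g (su2 c s p) * f (su2 c s p) \<partial>(lborel \<Otimes>\<^sub>M lborel))"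
    unfolding pair_cgauss by (subst nn_integral_density) (simp_all only: su2_norm[OF cs], measurable)
  also have "\<dots> = (\<integral>\<^sup>+p. ?g p * f p \<partial>(lborel \<Otimes>\<^sub>M lborel))"
    by (rule nn_integral_lborel_su2[where f = "\<lambda>p. ?g p * f p", OF _ cs s]) measurable
  also have "\<dots> = (\<integral>\<^sup>+p. f p \<partial>(cgauss \<Otimes>\<^sub>M cgauss))"
    unfolding pair_cgauss by (subst nn_integral_density) measurable
  finally show ?thesis .
qed

lemma nn_integral_cgauss_su2:
  assumes f [measurable]: "f \<in> borel_measurable (borel \<Otimes>\<^sub>M borel)"
    and cs: "(cmod c)\<^sup>2 + (cmod s)\<^sup>2 = 1"
  shows "(\<integral>\<^sup>+p. f (su2 c s p) \<partial>(cgauss \<Otimes>\<^sub>M cgauss)) = (\<integral>\<^sup>+p. f p \<partial>(cgauss \<Otimes>\<^sub>M cgauss))"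
proof (cases "s = 0")
  case False
  then show ?thesis by (rule nn_integral_cgauss_su2_aux[OF f cs])
next
  case True
  then have c: "cmod c = 1" using cs power2_eq_iff_nonneg[of "cmod c" 1] by simp
  \<comment> \<open>The three shears require a nonzero lower left entry. A diagonal matrix is the
    product of two antidiagonal ones, which have it.\<close>
  have eq: "su2 c s p = su2 0 (cnj c) (su2 0 (-1) p)" for p
    using True by (simp add: su2_def)
  have "(\<integral>\<^sup>+p. f (su2 c s p) \<partial>(cgauss \<Otimes>\<^sub>M cgauss)) = (\<integral>\<^sup>+p. f (su2 0 (cnj c) (su2 0 (-1) p)) \<partial>(cgauss \<Otimes>\<^sub>M cgauss))"
    by (simp only: eq)
  also have "\<dots> = (\<integral>\<^sup>+p. f (su2 0 (cnj c) p) \<partial>(cgauss \<Otimes>\<^sub>M cgauss))"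
    by (rule nn_integral_cgauss_su2_aux[where f = "\<lambda>p. f (su2 0 (cnj c) p)"]) auto
  also have "\<dots> = (\<integral>\<^sup>+p. f p \<partial>(cgauss \<Otimes>\<^sub>M cgauss))"
    using c by (intro nn_integral_cgauss_su2_aux) auto
  finally show ?thesis .
qed

lemma distr_eqI_nn_integral:
  assumes [measurable]: "T \<in> M \<rightarrow>\<^sub>M N"
    and "\<And>f. f \<in> borel_measurable N \<Longrightarrow> (\<integral>\<^sup>+x. f (T x) \<partial>M) = (\<integral>\<^sup>+x. f x \<partial>N)"
  shows "distr M N T = N"
proof (rule measure_eqI)
  fix A assume "A \<in> sets (distr M N T)"
  then have [measurable]: "A \<in> sets N" by simp
  have "emeasure (distr M N T) A = (\<integral>\<^sup>+x. indicator A x \<partial>distr M N T)" by simp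
  also have "\<dots> = (\<integral>\<^sup>+x. indicator A (T x) \<partial>M)" by (subst nn_integral_distr) auto
  also have "\<dots> = (\<integral>\<^sup>+x. indicator A x \<partial>N)" by (rule assms(2)) measurable
  finally show "emeasure (distr M N T) A = emeasure N A" by simp
qed simp

text \<open>With \<open>s = 0\<close> the pair rotation multiplies the coordinates by
  \<open>w\<close> and \<open>cnj w\<close>; the first marginal gives the claim.\<close>

lemma distr_cgauss_phase:
  assumes "cmod w = 1"
  shows "distr cgauss cgauss (\<lambda>z. w * z) = cgauss"
proof (rule distr_eqI_nn_integral)
  fix f :: "complex \<Rightarrow> ennreal" assume [measurable]: "f \<in> borel_measurable cgauss"
  have fst: "(\<integral>\<^sup>+p. g (fst p) \<partial>(cgauss \<Otimes>\<^sub>M cgauss)) = (\<integral>\<^sup>+z. g z \<partial>cgauss)"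
    if [measurable]: "g \<in> borel_measurable borel" for g :: "complex \<Rightarrow> ennreal"
    using cgauss.emeasure_space_1 by (subst cgauss.nn_integral_fst[symmetric]) auto
  have "(\<integral>\<^sup>+p. f (fst (su2 w 0 p)) \<partial>(cgauss \<Otimes>\<^sub>M cgauss)) = (\<integral>\<^sup>+p. f (fst p) \<partial>(cgauss \<Otimes>\<^sub>M cgauss))"
    by (rule nn_integral_cgauss_su2[where f = "\<lambda>p. f (fst p)"]) (auto simp: assms)
  then show "(\<integral>\<^sup>+z. f (w * z) \<partial>cgauss) = (\<integral>\<^sup>+z. f z \<partial>cgauss)"
    using fst[of "\<lambda>z. f (w * z)"] fst[of f] by (simp add: su2_def)
qed simp

section \<open>Plane rotations of Gaussian vectors\<close>

interpretation cgauss_pair: pair_prob_space cgauss cgauss ..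

abbreviation cgauss_vec :: "'i set \<Rightarrow> ('i \<Rightarrow> complex) measure" where
  "cgauss_vec K \<equiv> Pi\<^sub>M K (\<lambda>_. cgauss)"

lemma prob_space_cgauss_vec: "prob_space (cgauss_vec K)"
  by (rule prob_space_PiM) (rule prob_space_cgauss)

definition givens :: "'i \<Rightarrow> 'i \<Rightarrow> complex \<Rightarrow> complex \<Rightarrow> ('i \<Rightarrow> complex) \<Rightarrow> 'i \<Rightarrow> complex" where
  "givens p q c s z = z(p := c * z p - cnj s * z q, q := s * z p + cnj c * z q)"

lemma measurable_givens:
  assumes "p \<in> K" "q \<in> K"
  shows "givens p q c s \<in> cgauss_vec K \<rightarrow>\<^sub>M cgauss_vec K"
proof -
  have [measurable]: "(\<lambda>z. z p) \<in> cgauss_vec K \<rightarrow>\<^sub>M cgauss" "(\<lambda>z. z q) \<in> cgauss_vec K \<rightarrow>\<^sub>M cgauss"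
    using assms by auto
  have [measurable]: "(\<lambda>z. z p) \<in> cgauss_vec K \<rightarrow>\<^sub>M borel" "(\<lambda>z. z q) \<in> cgauss_vec K \<rightarrow>\<^sub>M borel"
    using measurable_cong_sets[OF refl sets_cgauss, of "cgauss_vec K"] assms by auto
  have "(\<lambda>z. c * z p - cnj s * z q) \<in> cgauss_vec K \<rightarrow>\<^sub>M borel" "(\<lambda>z. s * z p + cnj c * z q) \<in> cgauss_vec K \<rightarrow>\<^sub>M borel"
    by measurable
  then have [measurable]: "(\<lambda>z. c * z p - cnj s * z q) \<in> cgauss_vec K \<rightarrow>\<^sub>M cgauss" "(\<lambda>z. s * z p + cnj c * z q) \<in> cgauss_vec K \<rightarrow>\<^sub>M cgauss"
    using measurable_cong_sets[OF refl sets_cgauss, of "cgauss_vec K"] by auto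
  show ?thesis
    unfolding givens_def[abs_def]
    by (intro measurable_fun_upd[where J = K] measurable_ident) (use assms in auto)
qed

text \<open>Integrating over the coordinates \<open>p\<close> and \<open>q\<close> innermost, with
  all others frozen, leaves exactly the pair rotation \<open>su2\<close>.\<close>

lemma distr_givens:
  assumes K: "finite K" "p \<in> K" "q \<in> K" "p \<noteq> q" and cs: "(cmod c)\<^sup>2 + (cmod s)\<^sup>2 = 1"
  shows "distr (cgauss_vec K) (cgauss_vec K) (givens p q c s) = cgauss_vec K"
proof (rule distr_eqI_nn_integral)
  note [measurable] = measurable_givens[OF K(2,3), of c s]
  show "givens p q c s \<in> cgauss_vec K \<rightarrow>\<^sub>M cgauss_vec K" by measurable
  fix f :: "('a \<Rightarrow> complex) \<Rightarrow> ennreal" assume f [measurable]: "f \<in> borel_measurable (cgauss_vec K)"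
  define L where "L = K - {p, q}"
  have Keq: "K = insert p (insert q L)" and L: "finite L" "p \<notin> insert q L" "q \<notin> L"
    using K by (auto simp: L_def)
  have expand: "(\<integral>\<^sup>+x. g x \<partial>cgauss_vec K) =
      (\<integral>\<^sup>+x. (\<integral>\<^sup>+z. g (x(q := snd z, p := fst z)) \<partial>(cgauss \<Otimes>\<^sub>M cgauss)) \<partial>cgauss_vec L)"
    if g: "g \<in> borel_measurable (cgauss_vec K)" for g :: "('a \<Rightarrow> complex) \<Rightarrow> ennreal"
  proof -
    have [measurable]: "g \<in> borel_measurable (cgauss_vec (insert p (insert q L)))"
      using g Keq by simp
    have "(\<integral>\<^sup>+x. g x \<partial>cgauss_vec K) = (\<integral>\<^sup>+x. (\<integral>\<^sup>+a. g (x(p := a)) \<partial>cgauss) \<partial>cgauss_vec (insert q L))"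
      unfolding Keq using L by (intro cgauss_prod.product_nn_integral_insert) auto
    also have "\<dots> = (\<integral>\<^sup>+x. (\<integral>\<^sup>+b. (\<integral>\<^sup>+a. g (x(q := b, p := a)) \<partial>cgauss) \<partial>cgauss) \<partial>cgauss_vec L)"
      using L by (intro cgauss_prod.product_nn_integral_insert) auto
    also have "\<dots> = (\<integral>\<^sup>+x. (\<integral>\<^sup>+z. g (x(q := snd z, p := fst z)) \<partial>(cgauss \<Otimes>\<^sub>M cgauss)) \<partial>cgauss_vec L)"
    proof (rule nn_integral_cong)
      fix x assume x [measurable]: "x \<in> space (cgauss_vec L)"
      show "(\<integral>\<^sup>+b. (\<integral>\<^sup>+a. g (x(q := b, p := a)) \<partial>cgauss) \<partial>cgauss) = (\<integral>\<^sup>+z. g (x(q := snd z, p := fst z)) \<partial>(cgauss \<Otimes>\<^sub>M cgauss))"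
        using L by (subst cgauss_pair.nn_integral_snd[symmetric]) (auto intro!: measurable_compose[OF _ \<open>g \<in> borel_measurable (cgauss_vec (insert p (insert q L)))\<close>])
    qed
    finally show ?thesis .
  qed
  show "(\<integral>\<^sup>+z. f (givens p q c s z) \<partial>cgauss_vec K) = (\<integral>\<^sup>+z. f z \<partial>cgauss_vec K)"
  proof -
    have "(\<integral>\<^sup>+z. f (givens p q c s z) \<partial>cgauss_vec K) =
      (\<integral>\<^sup>+x. (\<integral>\<^sup>+z. f (givens p q c s (x(q := snd z, p := fst z))) \<partial>(cgauss \<Otimes>\<^sub>M cgauss)) \<partial>cgauss_vec L)"
      by (rule expand) measurable
    also have "\<dots> = (\<integral>\<^sup>+x. (\<integral>\<^sup>+z. f (x(q := snd z, p := fst z)) \<partial>(cgauss \<Otimes>\<^sub>M cgauss)) \<partial>cgauss_vec L)"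
    proof (rule nn_integral_cong)
      fix x assume x: "x \<in> space (cgauss_vec L)"
      have f': "f \<in> borel_measurable (cgauss_vec (insert p (insert q L)))" using f Keq by simp
      have m: "(\<lambda>z. f (x(q := snd z, p := fst z))) \<in> borel_measurable (borel \<Otimes>\<^sub>M borel)"
      proof (rule measurable_compose[OF _ f'])
        show "(\<lambda>z. x(q := snd z, p := fst z)) \<in> borel \<Otimes>\<^sub>M borel \<rightarrow>\<^sub>M cgauss_vec (insert p (insert q L))"
          by (rule measurable_fun_upd[where J="insert q L"], simp, rule measurable_fun_upd[where J="L"])
            (use x in auto)
      qed
      have eq: "givens p q c s (x(q := snd z, p := fst z)) = x(q := snd (su2 c s z), p := fst (su2 c s z))" for z
        using K by (auto simp: givens_def su2_def)
      show "(\<integral>\<^sup>+z. f (givens p q c s (x(q := snd z, p := fst z))) \<partial>(cgauss \<Otimes>\<^sub>M cgauss)) = (\<integral>\<^sup>+z. f (x(q := snd z, p := fst z)) \<partial>(cgauss \<Otimes>\<^sub>M cgauss))"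
        unfolding eq by (rule nn_integral_cgauss_su2[OF m cs])
    qed
    also have "\<dots> = (\<integral>\<^sup>+z. f z \<partial>cgauss_vec K)" by (rule expand[symmetric, OF f])
    finally show ?thesis .
  qed
qed

text \<open>Unitary maps are represented by words in plane rotations: linearity, preservation of
  inner products, measurability and invariance of the Gaussian law then each need to be checked for
  a single plane rotation.\<close>

inductive rot :: "'i set \<Rightarrow> (('i \<Rightarrow> complex) \<Rightarrow> ('i \<Rightarrow> complex)) \<Rightarrow> bool" for K where
  rot_id: "rot K (\<lambda>z. z)"
| rot_step: "rot K T \<Longrightarrow> p \<in> K \<Longrightarrow> q \<in> K \<Longrightarrow> p \<noteq> q \<Longrightarrow> (cmod c)\<^sup>2 + (cmod s)\<^sup>2 = 1 \<Longrightarrow> rot K (\<lambda>z. givens p q c s (T z))"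

lemma rot_comp:
  assumes "rot K T" "rot K S"
  shows "rot K (\<lambda>z. T (S z))"
  using assms by (induction T) (auto intro: rot.intros)

lemma rot_lincomb: "rot K T \<Longrightarrow> T (\<lambda>i. x * y i + w i) = (\<lambda>i. x * T y i + T w i)"
  by (induction rule: rot.induct) (auto simp: givens_def fun_eq_iff algebra_simps)

lemma rot_zero: "rot K T \<Longrightarrow> T (\<lambda>i. 0) = (\<lambda>i. 0)"
  by (induction rule: rot.induct) (auto simp: givens_def fun_eq_iff)

lemma rot_add: "rot K T \<Longrightarrow> T (\<lambda>i. y i + w i) = (\<lambda>i. T y i + T w i)"
  using rot_lincomb[of K T 1 y w] by simp

lemma rot_scale: "rot K T \<Longrightarrow> T (\<lambda>i. x * y i) = (\<lambda>i. x * T y i)"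
  using rot_lincomb[of K T x y "\<lambda>i. 0"] by (simp add: rot_zero)

lemma rot_diff: "rot K T \<Longrightarrow> T (\<lambda>i. y i - w i) = (\<lambda>i. T y i - T w i)"
  using rot_lincomb[of K T "-1" w y] by simp

lemma rot_sum:
  assumes "rot K T"
  shows "T (\<lambda>i. \<Sum>j\<in>J. x j * A j i) = (\<lambda>i. \<Sum>j\<in>J. x j * T (A j) i)"
proof (induction J rule: infinite_finite_induct)
  case (insert j F)
  then show ?case
    using rot_lincomb[OF assms, of "x j" "A j" "\<lambda>i. \<Sum>j\<in>F. x j * A j i"] by simp
qed (simp_all add: rot_zero[OF assms])

text \<open>Vectors are total functions, whereas norms, distances and laws see only the indices in
  \<open>K\<close>; values outside \<open>K\<close> must not leak in.\<close>

lemma rot_cong: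
  assumes "rot K T"
  shows "\<forall>k\<in>K. y k = z k \<Longrightarrow> \<forall>k\<in>K. T y k = T z k"
  using assms by (induction) (auto simp: givens_def)

lemma rot_inner:
  assumes "rot K T" "finite K"
  shows "(\<Sum>k\<in>K. cnj (T y k) * T z k) = (\<Sum>k\<in>K. cnj (y k) * z k)"
  using assms
proof (induction rule: rot.induct)
  case (rot_step T p q c s)
  define L where "L = K - {p, q}"
  have Keq: "K = insert p (insert q L)" and L: "finite L" "p \<notin> insert q L" "q \<notin> L"
    using rot_step by (auto simp: L_def)
  note cs = unit_pair_cnj[OF rot_step.hyps(5)]
  have "(\<Sum>k\<in>K. cnj (givens p q c s (T y) k) * givens p q c s (T z) k)
    = (c * cnj c + s * cnj s) * (cnj (T y p) * T z p) + (c * cnj c + s * cnj s) * (cnj (T y q) * T z q)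
      + (\<Sum>k\<in>L. cnj (givens p q c s (T y) k) * givens p q c s (T z) k)"
    unfolding Keq using L by (simp add: givens_def algebra_simps)
  also have "(\<Sum>k\<in>L. cnj (givens p q c s (T y) k) * givens p q c s (T z) k) = (\<Sum>k\<in>L. cnj (T y k) * T z k)"
    using L by (intro sum.cong) (auto simp: givens_def)
  also have "(c * cnj c + s * cnj s) * (cnj (T y p) * T z p) + (c * cnj c + s * cnj s) * (cnj (T y q) * T z q) + \<dots>
     = (\<Sum>k\<in>K. cnj (T y k) * T z k)"
    unfolding cs unfolding Keq using L by simp
  also have "\<dots> = (\<Sum>k\<in>K. cnj (y k) * z k)" using rot_step by simp
  finally show ?case .
qed simp

lemma rot_norm:
  assumes "rot K T" "finite K"
  shows "(\<Sum>k\<in>K. (cmod (T z k))\<^sup>2) = (\<Sum>k\<in>K. (cmod (z k))\<^sup>2)"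
proof -
  have "complex_of_real (\<Sum>k\<in>K. (cmod (w k))\<^sup>2) = (\<Sum>k\<in>K. cnj (w k) * w k)" for w :: "'a \<Rightarrow> complex"
    unfolding of_real_sum complex_norm_square by (simp add: mult.commute)
  then show ?thesis using rot_inner[OF assms, of z z] by (metis of_real_eq_iff)
qed

lemma rot_surj:
  assumes "rot K T"
  obtains y where "T y = z"
proof -
  have "\<exists>y. T y = z" using assms
  proof (induction arbitrary: z rule: rot.induct)
    case (rot_step T p q c s)
    note cs = unit_pair_cnj[OF rot_step.hyps(5)]
    \<comment> \<open>The adjoint, hence inverse, of the plane rotation with parameters
      \<open>c\<close> and \<open>s\<close> has parameters \<open>cnj c\<close> and
      \<open>- s\<close>.\<close>
    obtain y where y: "T y = givens p q (cnj c) (- s) z" using rot_step.IH by blast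
    have "givens p q c s (T y) = (\<lambda>k. (if k = p \<or> k = q then c * cnj c + s * cnj s else 1) * z k)"
      unfolding y using \<open>p \<noteq> q\<close> by (auto simp: givens_def fun_eq_iff algebra_simps)
    also have "\<dots> = z" unfolding cs by simp
    finally show ?case by blast
  qed auto
  then show thesis using that by blast
qed

lemma measurable_rot:
  assumes "rot K T"
  shows "T \<in> cgauss_vec K \<rightarrow>\<^sub>M cgauss_vec K"
  using assms by induction (auto intro: measurable_compose[OF _ measurable_givens])

lemma distr_rot:
  assumes "rot K T" "finite K"
  shows "distr (cgauss_vec K) (cgauss_vec K) T = cgauss_vec K"
  using assms
proof (induction)
  case (rot_step T p q c s)
  have "distr (cgauss_vec K) (cgauss_vec K) (\<lambda>z. givens p q c s (T z))
    = distr (distr (cgauss_vec K) (cgauss_vec K) T) (cgauss_vec K) (givens p q c s)"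
    using rot_step measurable_rot[of K T] measurable_givens[of p K q c s] by (subst distr_distr) (auto simp: comp_def)
  then show ?case using rot_step by (simp add: distr_givens)
qed (simp add: distr_id)

text \<open>One coordinate after the other is rotated into coordinate \<open>l\<close>. A later
  rotation touches only \<open>l\<close> and a new coordinate, so zeros already produced
  persist.\<close>

lemma rot_exists:
  assumes "finite K" "l \<in> K"
  obtains T where "rot K T" "\<forall>k\<in>K - {l}. T v k = 0"
proof -
  have "\<exists>T. rot K T \<and> (\<forall>k\<in>L. T v k = 0)" if "finite L" "L \<subseteq> K - {l}" for L
    using that
  proof (induction rule: finite_induct)
    case (insert q L)
    then obtain T where T: "rot K T" "\<forall>k\<in>L. T v k = 0" by auto
    define n where "n = sqrt ((cmod (T v l))\<^sup>2 + (cmod (T v q))\<^sup>2)"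
    show ?case
    proof (cases "n = 0")
      case True
      then have "T v q = 0" by (simp add: n_def add_nonneg_eq_0_iff)
      then show ?thesis using T by auto
    next
      case False
      \<comment> \<open>The new entry at \<open>q\<close> is
        \<open>s * T v l + cnj c * T v q\<close>; these parameters make its two terms cancel, and
        \<open>n\<close> normalises them.\<close>
      define c where "c = cnj (T v l) / of_real n"
      define s where "s = - T v q / of_real n"
      have n2: "n\<^sup>2 = (cmod (T v l))\<^sup>2 + (cmod (T v q))\<^sup>2"
        by (simp add: n_def)
      have "(cmod c)\<^sup>2 + (cmod s)\<^sup>2 = ((cmod (T v l))\<^sup>2 + (cmod (T v q))\<^sup>2) / n\<^sup>2"
        by (simp add: c_def s_def norm_divide power_divide add_divide_distrib)
      then have "(cmod c)\<^sup>2 + (cmod s)\<^sup>2 = 1"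
        using False by (simp flip: n2)
      then have "rot K (\<lambda>z. givens l q c s (T z))"
        using T insert assms by (intro rot_step) auto
      moreover have "\<forall>k\<in>insert q L. givens l q c s (T v) k = 0"
        using T insert by (auto simp: givens_def c_def s_def)
      ultimately show ?thesis by blast
    qed
  qed (auto intro: rot_id)
  from this[of "K - {l}"] show thesis using assms that by auto
qed

lemma rot_lift:
  assumes "rot K T" "finite R"
    and inj: "\<And>r r' k k'. r \<in> R \<Longrightarrow> r' \<in> R \<Longrightarrow> k \<in> K \<Longrightarrow> k' \<in> K \<Longrightarrow> \<phi> r k = \<phi> r' k' \<Longrightarrow> r = r' \<and> k = k'"
    and X: "\<And>r k. r \<in> R \<Longrightarrow> k \<in> K \<Longrightarrow> \<phi> r k \<in> X"
  obtains T' where "rot X T'" "\<And>z r k. r \<in> R \<Longrightarrow> k \<in> K \<Longrightarrow> T' z (\<phi> r k) = T (\<lambda>k. z (\<phi> r k)) k"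
proof -
  have "\<exists>T'. rot X T' \<and> (\<forall>z. \<forall>r\<in>R. \<forall>k\<in>K. T' z (\<phi> r k) = T (\<lambda>k. z (\<phi> r k)) k)"
    using assms(1)
  proof induction
    case (rot_step T p q c s)
    then obtain T' where T': "rot X T'" "\<forall>z. \<forall>r\<in>R. \<forall>k\<in>K. T' z (\<phi> r k) = T (\<lambda>k. z (\<phi> r k)) k" by blast
    \<comment> \<open>A single plane rotation is carried out in the blocks of \<open>F\<close> one
      by one; injectivity of \<phi> keeps the blocks from interfering.\<close>
    have "\<exists>E. rot X E \<and> (\<forall>z. \<forall>r\<in>R. \<forall>k\<in>K. E z (\<phi> r k) = (if r \<in> F then givens p q c s (\<lambda>k. z (\<phi> r k)) k else z (\<phi> r k)))"
      if "finite F" "F \<subseteq> R" for F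
      using that
    proof induction
      case empty
      then show ?case by (intro exI[of _ "\<lambda>z. z"]) (auto intro: rot_id)
    next
      case (insert r0 F)
      then obtain E where E: "rot X E"
        "\<forall>z. \<forall>r\<in>R. \<forall>k\<in>K. E z (\<phi> r k) = (if r \<in> F then givens p q c s (\<lambda>k. z (\<phi> r k)) k else z (\<phi> r k))"
        by blast
      have r0: "r0 \<in> R" using insert by auto
      have "\<phi> r0 p \<noteq> \<phi> r0 q" using inj[OF r0 r0] rot_step by blast
      then have "rot X (\<lambda>z. givens (\<phi> r0 p) (\<phi> r0 q) c s (E z))"
        using E rot_step r0 X by (intro rot.rot_step) auto
      moreover have "givens (\<phi> r0 p) (\<phi> r0 q) c s (E z) (\<phi> r k) =
          (if r \<in> insert r0 F then givens p q c s (\<lambda>k. z (\<phi> r k)) k else z (\<phi> r k))"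
        if "r \<in> R" "k \<in> K" for z r k
      proof (cases "r = r0")
        case True
        then show ?thesis
          using that E insert rot_step.hyps inj[OF r0 r0 \<open>k \<in> K\<close> \<open>p \<in> K\<close>] inj[OF r0 r0 \<open>k \<in> K\<close> \<open>q \<in> K\<close>] \<open>\<phi> r0 p \<noteq> \<phi> r0 q\<close>
          by (auto simp: givens_def)
      next
        case False
        then show ?thesis
          using that E insert rot_step.hyps inj[OF \<open>r \<in> R\<close> r0 \<open>k \<in> K\<close> \<open>p \<in> K\<close>] inj[OF \<open>r \<in> R\<close> r0 \<open>k \<in> K\<close> \<open>q \<in> K\<close>]
          by (auto simp: givens_def)
      qed
      ultimately show ?case by blast
    qed
    from this[OF \<open>finite R\<close> order_refl] obtain E where E: "rot X E"
        "\<forall>z. \<forall>r\<in>R. \<forall>k\<in>K. E z (\<phi> r k) = givens p q c s (\<lambda>k. z (\<phi> r k)) k"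
      by auto
    show ?case
    proof (intro exI[of _ "\<lambda>z. E (T' z)"] conjI allI ballI)
      show "rot X (\<lambda>z. E (T' z))" using E(1) T'(1) by (rule rot_comp)
      fix z r k assume rk: "r \<in> R" "k \<in> K"
      then show "E (T' z) (\<phi> r k) = givens p q c s (T (\<lambda>k. z (\<phi> r k))) k"
        using E(2) T'(2) rot_step.hyps by (auto simp: givens_def)
    qed
  qed (auto intro!: exI[of _ "\<lambda>z. z"] rot_id)
  then show thesis using that by blast
qed

section \<open>Squared norms of Gaussian vectors\<close>

interpretation erl: prob_space "erl k" for k by (rule prob_space_erl)

lemma nn_integral_erl:
  assumes [measurable]: "f \<in> borel_measurable borel"
  shows "(\<integral>\<^sup>+t. f t \<partial>erl k) = (\<integral>\<^sup>+t. ennreal (erlang_density k 1 t) * f t \<partial>lborel)"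
  unfolding erl_def by (subst nn_integral_density) auto

text \<open>The shapes \<open>k + 1\<close> and \<open>l + 1\<close> add up, whence the extra one in
  the index.\<close>

lemma nn_integral_erl_add:
  assumes [measurable]: "f \<in> borel_measurable borel"
  shows "(\<integral>\<^sup>+u. (\<integral>\<^sup>+t. f (t + u) \<partial>erl k) \<partial>erl l) = (\<integral>\<^sup>+t. f t \<partial>erl (k + l + 1))"
proof -
  let ?e = "\<lambda>k t. ennreal (erlang_density k 1 t)"
  have "(\<integral>\<^sup>+u. (\<integral>\<^sup>+t. f (t + u) \<partial>erl k) \<partial>erl l) = (\<integral>\<^sup>+u. ?e l u * (\<integral>\<^sup>+t. ?e k t * f (t + u) \<partial>lborel) \<partial>lborel)"
    by (subst nn_integral_erl; (subst nn_integral_erl)?) measurable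
  also have "\<dots> = (\<integral>\<^sup>+u. ?e l u * (\<integral>\<^sup>+t. ?e k (t - u) * f t \<partial>lborel) \<partial>lborel)"
  proof (rule nn_integral_cong)
    fix u :: real
    show "?e l u * (\<integral>\<^sup>+t. ?e k t * f (t + u) \<partial>lborel) = ?e l u * (\<integral>\<^sup>+t. ?e k (t - u) * f t \<partial>lborel)"
      by (subst nn_integral_lborel_translate[of "\<lambda>t. ?e k (t - u) * f t" u, symmetric]) auto
  qed
  also have "\<dots> = (\<integral>\<^sup>+u. (\<integral>\<^sup>+t. ?e k (t - u) * ?e l u * f t \<partial>lborel) \<partial>lborel)"
    by (intro nn_integral_cong) (subst nn_integral_cmult[symmetric], measurable, simp add: mult_ac)
  also have "\<dots> = (\<integral>\<^sup>+t. (\<integral>\<^sup>+u. ?e k (t - u) * ?e l u * f t \<partial>lborel) \<partial>lborel)"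
    by (rule lborel_pair.Fubini') measurable
  also have "\<dots> = (\<integral>\<^sup>+t. ?e (k + l + 1) t * f t \<partial>lborel)"
  proof (intro nn_integral_cong)
    fix t :: real
    have "(\<integral>\<^sup>+u. ?e k (t - u) * ?e l u * f t \<partial>lborel) = (\<integral>\<^sup>+u. ?e k (t - u) * ?e l u \<partial>lborel) * f t"
      by (rule nn_integral_multc) measurable
    then show "(\<integral>\<^sup>+u. ?e k (t - u) * ?e l u * f t \<partial>lborel) = ?e (k + l + 1) t * f t"
      using fun_cong[OF convolution_erlang_density[of 1 k l], of t] by simp
  qed
  also have "\<dots> = (\<integral>\<^sup>+t. f t \<partial>erl (k + l + 1))"
    by (subst nn_integral_erl) measurable
  finally show ?thesis .
qed

lemma erlang_density_shift:
  "t ^ n * erlang_density k 1 t = fact (k + n) / fact k * erlang_density (k + n) 1 t"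
  by (simp add: erlang_density_def power_add)

lemma nn_integral_erl_power:
  assumes [measurable]: "f \<in> borel_measurable borel"
  shows "(\<integral>\<^sup>+t. ennreal (t ^ n) * f t \<partial>erl k) = ennreal (fact (k + n) / fact k) * (\<integral>\<^sup>+t. f t \<partial>erl (k + n))"
proof -
  have "(\<integral>\<^sup>+t. ennreal (t ^ n) * f t \<partial>erl k) = (\<integral>\<^sup>+t. ennreal (erlang_density k 1 t) * (ennreal (t ^ n) * f t) \<partial>lborel)"
    by (subst nn_integral_erl) measurable
  also have "\<dots> = (\<integral>\<^sup>+t. ennreal (fact (k + n) / fact k) * (ennreal (erlang_density (k + n) 1 t) * f t) \<partial>lborel)"
  proof (intro nn_integral_cong)
    fix t :: real
    have "ennreal (erlang_density k 1 t) * ennreal (t ^ n) = ennreal (t ^ n * erlang_density k 1 t)"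
      by (cases "t < 0") (auto simp: erlang_density_def ennreal_mult[symmetric] mult_ac)
    also have "\<dots> = ennreal (fact (k + n) / fact k) * ennreal (erlang_density (k + n) 1 t)"
      by (simp add: erlang_density_shift ennreal_mult[symmetric])
    finally show "ennreal (erlang_density k 1 t) * (ennreal (t ^ n) * f t) =
        ennreal (fact (k + n) / fact k) * (ennreal (erlang_density (k + n) 1 t) * f t)"
      by (simp flip: mult.assoc)
  qed
  also have "\<dots> = ennreal (fact (k + n) / fact k) * (\<integral>\<^sup>+t. f t \<partial>erl (k + n))"
    by (subst nn_integral_cmult, measurable, subst nn_integral_erl, measurable)
  finally show ?thesis .
qed

lemma AE_erl_pos: "AE t in erl k. 0 < t"
proof -
  have "AE t in lborel. t \<noteq> (0::real)" by (rule AE_lborel_singleton)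
  then have "AE t in lborel. 0 < ennreal (erlang_density k 1 t) \<longrightarrow> 0 < t"
    by eventually_elim (auto simp: erlang_density_def split: if_splits)
  then show ?thesis unfolding erl_def by (subst AE_density) auto
qed

text \<open>\<open>t ^ k / fact k\<close> is one term of the series of \<open>exp t\<close>. The
  bound is uniform in \<open>k\<close>, so mixtures of these densities with summable weights
  converge at every point.\<close>

lemma erlang_density_le_1: "erlang_density k 1 t \<le> 1"
proof (cases "t < 0")
  case False
  have "t ^ k / fact k \<le> exp t"
    using False sum_le_suminf[of "\<lambda>n. t ^ n / fact n" "{k}"] summable_exp[of t]
    by (simp add: exp_def divide_inverse scaleR_conv_of_real mult.commute)
  then show ?thesis using False by (simp add: erlang_density_def exp_minus field_simps)
qed (simp add: erlang_density_def)

section \<open>Poisson mixtures of Erlang laws\<close>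

definition poisson_weight :: "real \<Rightarrow> nat \<Rightarrow> real" where
  "poisson_weight x n = exp (- x) * x ^ n / fact n"

lemma poisson_weight_nonneg [simp]: "0 \<le> x \<Longrightarrow> 0 \<le> poisson_weight x n"
  by (simp add: poisson_weight_def)

lemma poisson_weight_sums: "poisson_weight x sums 1"
proof -
  have "(\<lambda>n. exp (- x) * (x ^ n /\<^sub>R fact n)) sums (exp (- x) * exp x)"
    by (intro sums_mult exp_converges)
  then show ?thesis
    by (simp add: poisson_weight_def[abs_def] exp_minus field_simps)
qed

definition nce_density :: "nat \<Rightarrow> real \<Rightarrow> real \<Rightarrow> real" where
  "nce_density N x t = (\<Sum>n. poisson_weight x n * erlang_density (N - 1 + n) 1 t)"

text \<open>The law of the squared norm of a complex Gaussian vector in dimension \<open>N\<close> whose mean has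
  squared norm \<open>x\<close>, as a Poisson mixture of Erlang laws.\<close>
definition nce :: "nat \<Rightarrow> real \<Rightarrow> real measure" where
  "nce N x = density lborel (\<lambda>t. ennreal (nce_density N x t))"

lemma sets_nce [simp, measurable_cong]: "sets (nce N x) = sets borel"
  by (simp add: nce_def)

lemma space_nce [simp]: "space (nce N x) = UNIV"
  by (simp add: nce_def)

lemma measurable_nce_density [measurable]: "nce_density N x \<in> borel_measurable borel"
  unfolding nce_density_def[abs_def] by measurable

lemma nce_density_sums:
  assumes "0 \<le> x"
  shows "(\<lambda>n. poisson_weight x n * erlang_density (N - 1 + n) 1 t) sums nce_density N x t"
proof -
  have "summable (\<lambda>n. poisson_weight x n * erlang_density (N - 1 + n) 1 t)"
    using assms erlang_density_le_1 sums_summable[OF poisson_weight_sums, of x]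
    by (intro summable_comparison_test'[OF sums_summable[OF poisson_weight_sums, of x], of 0])
       (auto simp: abs_mult intro!: mult_left_le)
  then show ?thesis unfolding nce_density_def by (rule summable_sums)
qed

lemma nce_density_nonneg: "0 \<le> x \<Longrightarrow> 0 \<le> nce_density N x t"
  using sums_le[OF _ sums_zero nce_density_sums] by auto

lemma nn_integral_nce:
  assumes x: "0 \<le> x" and [measurable]: "f \<in> borel_measurable borel"
  shows "(\<integral>\<^sup>+t. f t \<partial>nce N x) = (\<Sum>n. ennreal (poisson_weight x n) * (\<integral>\<^sup>+t. f t \<partial>erl (N - 1 + n)))"
proof -
  have "(\<integral>\<^sup>+t. f t \<partial>nce N x) = (\<integral>\<^sup>+t. ennreal (nce_density N x t) * f t \<partial>lborel)"
    unfolding nce_def by (subst nn_integral_density) auto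
  also have "\<dots> = (\<integral>\<^sup>+t. (\<Sum>n. ennreal (poisson_weight x n) * (ennreal (erlang_density (N - 1 + n) 1 t) * f t)) \<partial>lborel)"
  proof (intro nn_integral_cong)
    fix t
    have "ennreal (nce_density N x t) = (\<Sum>n. ennreal (poisson_weight x n * erlang_density (N - 1 + n) 1 t))"
      unfolding nce_density_def
      by (rule suminf_ennreal2[symmetric]) (use nce_density_sums[OF x] x in \<open>auto simp: sums_iff\<close>)
    then show "ennreal (nce_density N x t) * f t = (\<Sum>n. ennreal (poisson_weight x n) * (ennreal (erlang_density (N - 1 + n) 1 t) * f t))"
      using x by (simp add: ennreal_mult mult.assoc flip: ennreal_suminf_multc)
  qed
  also have "\<dots> = (\<Sum>n. ennreal (poisson_weight x n) * (\<integral>\<^sup>+t. f t \<partial>erl (N - 1 + n)))"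
    by (subst nn_integral_suminf) (auto simp: nn_integral_cmult nn_integral_erl)
  finally show ?thesis .
qed

lemma prob_space_nce:
  assumes "0 \<le> x" shows "prob_space (nce N x)"
proof
  have "emeasure (nce N x) (space (nce N x)) = (\<integral>\<^sup>+t. 1 \<partial>nce N x)" by simp
  also have "\<dots> = (\<Sum>n. ennreal (poisson_weight x n))"
    using assms erl.emeasure_space_1 by (subst nn_integral_nce) auto
  also have "\<dots> = 1"
    using assms poisson_weight_sums[of x] by (subst suminf_ennreal2) (auto simp: sums_iff)
  finally show "emeasure (nce N x) (space (nce N x)) = 1" .
qed

lemma nce_0: "nce N 0 = erl (N - 1)"
proof -
  have "nce_density N 0 t = erlang_density (N - 1) 1 t" for t
    unfolding nce_density_def
    by (subst suminf_finite[of "{0}"]) (auto simp: poisson_weight_def)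
  then show ?thesis by (simp add: nce_def erl_def)
qed

lemma AE_nce_pos: 
  assumes "0 \<le> x" shows "AE t in nce N x. 0 < t"
proof -
  have "AE t in lborel. t \<noteq> (0::real)" by (rule AE_lborel_singleton)
  then have "AE t in lborel. 0 < ennreal (nce_density N x t) \<longrightarrow> 0 < t"
  proof eventually_elim
    case (elim t)
    have "nce_density N x t = 0" if "t < 0"
      unfolding nce_density_def using that by (simp add: erlang_density_def)
    then show ?case using elim by (cases "t < 0") auto
  qed
  then show ?thesis unfolding nce_def by (subst AE_density) auto
qed

lemma integral_erl:
  fixes f :: "real \<Rightarrow> 'a::{banach, second_countable_topology}"
  assumes [measurable]: "f \<in> borel_measurable borel"
  shows "(\<integral>t. f t \<partial>erl k) = (\<integral>t. erlang_density k 1 t *\<^sub>R f t \<partial>lborel)"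
    and "integrable (erl k) f \<longleftrightarrow> integrable lborel (\<lambda>t. erlang_density k 1 t *\<^sub>R f t)"
  unfolding erl_def by (subst integral_density; simp) (subst integrable_density; simp)

lemma integral_nce_sums:
  fixes f :: "real \<Rightarrow> 'a::{banach, second_countable_topology}"
  assumes x: "0 \<le> x" and [measurable]: "f \<in> borel_measurable borel"
    and f: "\<And>n. integrable (erl (N - 1 + n)) f"
    and summ: "summable (\<lambda>n. poisson_weight x n * (\<integral>t. norm (f t) \<partial>erl (N - 1 + n)))"
  shows "integrable (nce N x) f"
    and "(\<lambda>n. poisson_weight x n *\<^sub>R (\<integral>t. f t \<partial>erl (N - 1 + n))) sums (\<integral>t. f t \<partial>nce N x)"
proof -
  let ?g = "\<lambda>n t. poisson_weight x n *\<^sub>R (erlang_density (N - 1 + n) 1 t *\<^sub>R f t)"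
  have int: "integrable lborel (?g n)" for n
    by (intro integrable_scaleR_right) (use f[of n] in \<open>simp only: integral_erl(2)[OF assms(2)]\<close>)
  have norm_g: "norm (?g n t) = poisson_weight x n * erlang_density (N - 1 + n) 1 t * norm (f t)" for n t
    using x by (simp add: abs_mult)
  have ptw: "(\<lambda>n. ?g n t) sums (nce_density N x t *\<^sub>R f t)" for t
    using sums_scaleR_left[OF nce_density_sums[OF x, of N t], of "f t"] by simp
  have s1: "AE t in lborel. summable (\<lambda>n. norm (?g n t))"
    unfolding norm_g using nce_density_sums[OF x] by (auto intro!: summable_mult2 simp: sums_iff)
  have s2: "summable (\<lambda>n. (\<integral>t. norm (?g n t) \<partial>lborel))"
  proof -
    have "(\<integral>t. norm (?g n t) \<partial>lborel) = poisson_weight x n * (\<integral>t. norm (f t) \<partial>erl (N - 1 + n))" for n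
      using x by (simp add: integral_erl mult.assoc)
    then show ?thesis using summ by simp
  qed
  have lim: "(\<lambda>t. \<Sum>n. ?g n t) = (\<lambda>t. nce_density N x t *\<^sub>R f t)"
    using ptw by (auto simp: sums_iff)
  show "integrable (nce N x) f"
    unfolding nce_def using integrable_suminf[OF int s1 s2, unfolded lim] nce_density_nonneg[OF x]
    by (subst integrable_density) auto
  have "(\<integral>t. f t \<partial>nce N x) = (\<integral>t. (\<Sum>n. ?g n t) \<partial>lborel)"
    unfolding lim nce_def using nce_density_nonneg[OF x] by (subst integral_density) auto
  moreover have "(\<integral>t. ?g n t \<partial>lborel) = poisson_weight x n *\<^sub>R (\<integral>t. f t \<partial>erl (N - 1 + n))" for n
    by (simp only: integral_scaleR_right integral_erl(1)[OF assms(2)])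
  ultimately show "(\<lambda>n. poisson_weight x n *\<^sub>R (\<integral>t. f t \<partial>erl (N - 1 + n))) sums (\<integral>t. f t \<partial>nce N x)"
    using sums_integral[OF int s1 s2] by simp
qed

section \<open>Gaussian moments and the squared modulus of a shifted Gaussian\<close>

lemma borel_measurable_cnj [measurable]: "cnj \<in> borel_measurable borel"
  by (intro borel_measurable_continuous_onI continuous_intros)

lemma nn_integral_cgauss_cmod_square:
  assumes [measurable]: "f \<in> borel_measurable borel"
  shows "(\<integral>\<^sup>+z. f ((cmod z)\<^sup>2) \<partial>cgauss) = (\<integral>\<^sup>+t. f t \<partial>erl 0)"
  unfolding distr_cgauss_cmod_square[symmetric] by (subst nn_integral_distr) auto

text \<open>Completing the square bounds \<open>c * cmod z\<close> by
  \<open>c\<^sup>2 / 2 + (cmod z)\<^sup>2 / 2\<close>, and half of the quadratic exponent of the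
  density is left for convergence. This supplies the dominating functions for the power series
  expansions below.\<close>

lemma integrable_cgauss_exp_cmod:
  shows "integrable cgauss (\<lambda>z. exp (c * cmod z))"
proof (rule integrableI_bounded)
  have "(\<integral>\<^sup>+z. ennreal (norm (exp (c * cmod z))) \<partial>cgauss) \<le> (\<integral>\<^sup>+z. ennreal (exp (c\<^sup>2 / 2)) * ennreal (exp ((cmod z)\<^sup>2 / 2)) \<partial>cgauss)"
  proof (intro nn_integral_mono)
    fix z
    have "c * cmod z \<le> c\<^sup>2 / 2 + (cmod z)\<^sup>2 / 2"
      using zero_le_power2[of "c - cmod z"] unfolding power2_diff by simp
    then show "ennreal (norm (exp (c * cmod z))) \<le> ennreal (exp (c\<^sup>2 / 2)) * ennreal (exp ((cmod z)\<^sup>2 / 2))"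
      by (simp add: ennreal_mult[symmetric] exp_add[symmetric])
  qed
  also have "\<dots> = ennreal (exp (c\<^sup>2 / 2)) * (\<integral>\<^sup>+z. ennreal (exp ((cmod z)\<^sup>2 / 2)) \<partial>cgauss)"
    by (rule nn_integral_cmult) measurable
  also have "(\<integral>\<^sup>+z. ennreal (exp ((cmod z)\<^sup>2 / 2)) \<partial>cgauss) = (\<integral>\<^sup>+t. ennreal (exp (t / 2)) \<partial>erl 0)"
    by (rule nn_integral_cgauss_cmod_square[where f = "\<lambda>t. ennreal (exp (t / 2))"]) measurable
  also have "\<dots> = (\<integral>\<^sup>+t. ennreal (exp (- t / 2)) * indicator {0..} t \<partial>lborel)"
    by (subst nn_integral_erl)
       (auto intro!: nn_integral_cong simp: erlang_density_def indicator_def ennreal_mult[symmetric] exp_add[symmetric])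
  also have "\<dots> = ennreal (0 - (- 2 * exp (- 0 / 2)))"
  proof (rule nn_integral_FTC_atLeast)
    show "((\<lambda>t. - 2 * exp (- t / 2)) \<longlongrightarrow> (0::real)) at_top" by real_asymp
  qed (auto intro!: derivative_eq_intros)
  also have "ennreal (exp (c\<^sup>2 / 2)) * \<dots> < \<infinity>"
    by (simp add: ennreal_mult_less_top)
  finally show "(\<integral>\<^sup>+z. ennreal (norm (exp (c * cmod z))) \<partial>cgauss) < \<infinity>" .
qed simp

text \<open>A monomial is multiplied by \<open>-1\<close> under a suitable rotation unless its two exponents agree.\<close>
lemma cgauss_moment_zero:
  assumes "k \<noteq> l" and [measurable]: "g \<in> borel_measurable borel"
  shows "(\<integral>z. z ^ k * cnj z ^ l * complex_of_real (g ((cmod z)\<^sup>2)) \<partial>cgauss) = 0" (is "?I = 0")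
proof -
  define \<theta> where "\<theta> = pi / (real k - real l)"
  define w where "w = cis \<theta>"
  have w: "cmod w = 1" by (simp add: w_def)
  have "w ^ k * cnj w ^ l = cis (real k * \<theta> - real l * \<theta>)"
    by (simp only: w_def cis_cnj Complex.DeMoivre cis_mult) (rule arg_cong[where f = cis], simp)
  also have "real k * \<theta> - real l * \<theta> = pi"
    unfolding left_diff_distrib[symmetric] using assms(1) by (simp add: \<theta>_def)
  finally have wkl: "w ^ k * cnj w ^ l = - 1" by simp
  have "?I = (\<integral>z. z ^ k * cnj z ^ l * complex_of_real (g ((cmod z)\<^sup>2)) \<partial>distr cgauss cgauss (\<lambda>z. w * z))"
    by (simp add: distr_cgauss_phase[OF w])
  also have "\<dots> = (\<integral>z. (w * z) ^ k * cnj (w * z) ^ l * complex_of_real (g ((cmod (w * z))\<^sup>2)) \<partial>cgauss)"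
    by (subst integral_distr) auto
  also have "\<dots> = (\<integral>z. (w ^ k * cnj w ^ l) * (z ^ k * cnj z ^ l * complex_of_real (g ((cmod z)\<^sup>2))) \<partial>cgauss)"
    by (simp add: power_mult_distrib norm_mult w mult_ac)
  also have "\<dots> = - ?I" unfolding wkl by simp
  finally show ?thesis by simp
qed

lemma cgauss_moment_even:
  assumes [measurable]: "A \<in> sets borel"
  shows "(\<integral>z. (cmod z) ^ (2 * p) * indicat_real A ((cmod z)\<^sup>2) \<partial>cgauss) = fact p * measure (erl p) A"
proof -
  have "(\<integral>z. (cmod z) ^ (2 * p) * indicat_real A ((cmod z)\<^sup>2) \<partial>cgauss) = (\<integral>z. ((cmod z)\<^sup>2) ^ p * indicat_real A ((cmod z)\<^sup>2) \<partial>cgauss)"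
    by (simp add: power_mult)
  also have "\<dots> = enn2real (\<integral>\<^sup>+z. ennreal (((cmod z)\<^sup>2) ^ p) * indicator A ((cmod z)\<^sup>2) \<partial>cgauss)"
    by (subst integral_eq_nn_integral) (auto intro!: arg_cong[where f = enn2real] nn_integral_cong simp: indicator_def)
  also have "(\<integral>\<^sup>+z. ennreal (((cmod z)\<^sup>2) ^ p) * indicator A ((cmod z)\<^sup>2) \<partial>cgauss) = (\<integral>\<^sup>+t. ennreal (t ^ p) * indicator A t \<partial>erl 0)"
    by (rule nn_integral_cgauss_cmod_square[where f = "\<lambda>t. ennreal (t ^ p) * indicator A t"]) measurable
  also have "\<dots> = ennreal (fact p) * emeasure (erl p) A"
    by (subst nn_integral_erl_power) auto
  finally show ?thesis by (simp add: enn2real_mult measure_def)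
qed

text \<open>\<open>2 * Re w\<close> is \<open>w + cnj w\<close>, so the binomial theorem yields
  monomials in \<open>z\<close> and \<open>cnj z\<close>. Only the one with equal exponents survives
  integration: odd powers vanish, and an even power contributes its central binomial coefficient.
  The indicator depends on the modulus alone and respects the phase symmetry.\<close>

lemma cgauss_Re_power:
  assumes [measurable]: "A \<in> sets borel"
  shows "integrable cgauss (\<lambda>z. (2 * Re (cnj a * z)) ^ n * indicat_real A ((cmod z)\<^sup>2))" (is ?int)
    and "odd n \<Longrightarrow> (\<integral>z. (2 * Re (cnj a * z)) ^ n * indicat_real A ((cmod z)\<^sup>2) \<partial>cgauss) = 0"
    and "(\<integral>z. (2 * Re (cnj a * z)) ^ (2 * p) * indicat_real A ((cmod z)\<^sup>2) \<partial>cgauss)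
       = fact (2 * p) / fact p * (cmod a) ^ (2 * p) * measure (erl p) A"
proof -
  have cmod_power: "(cmod z) ^ n \<le> fact n * exp (1 * cmod z)" for z n
  proof -
    have "(cmod z) ^ n / fact n \<le> exp (cmod z)"
      using sum_le_suminf[of "\<lambda>n. (cmod z) ^ n / fact n" "{n}"] summable_exp[of "cmod z"]
      by (simp add: exp_def divide_inverse scaleR_conv_of_real mult.commute)
    then show ?thesis by (simp add: field_simps)
  qed
  have mono: "integrable cgauss (\<lambda>z. z ^ k * cnj z ^ l * complex_of_real (indicat_real A ((cmod z)\<^sup>2)))" for k l
  proof (rule Bochner_Integration.integrable_bound)
    show "integrable cgauss (\<lambda>z. fact (k + l) * exp (1 * cmod z))"
      by (intro integrable_mult_right integrable_cgauss_exp_cmod)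
    show "AE z in cgauss. norm (z ^ k * cnj z ^ l * complex_of_real (indicat_real A ((cmod z)\<^sup>2))) \<le> norm (fact (k + l) * exp (1 * cmod z))"
      using cmod_power[of _ "k + l"] by (auto simp: norm_mult norm_power power_add indicator_def)
  qed measurable
  have expand: "complex_of_real ((2 * Re (cnj a * z)) ^ n * indicat_real A ((cmod z)\<^sup>2)) =
     (\<Sum>k\<le>n. (of_nat (n choose k) * cnj a ^ k * a ^ (n - k)) * (z ^ k * cnj z ^ (n - k) * complex_of_real (indicat_real A ((cmod z)\<^sup>2))))" for z n
  proof -
    have "complex_of_real (2 * Re (cnj a * z)) = cnj a * z + a * cnj z"
      using complex_add_cnj[of "cnj a * z"] by simp
    then have "complex_of_real ((2 * Re (cnj a * z)) ^ n) = (cnj a * z + a * cnj z) ^ n"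
      by (metis of_real_power)
    also have "\<dots> = (\<Sum>k\<le>n. of_nat (n choose k) * (cnj a * z) ^ k * (a * cnj z) ^ (n - k))"
      by (rule binomial_ring)
    finally show ?thesis by (simp add: sum_distrib_left sum_distrib_right power_mult_distrib mult_ac)
  qed
  have int: "integrable cgauss (\<lambda>z. complex_of_real ((2 * Re (cnj a * z)) ^ n * indicat_real A ((cmod z)\<^sup>2)))" for n
    unfolding expand by (intro Bochner_Integration.integrable_sum integrable_mult_right mono)
  show ?int using integrable_Re[OF int[of n]] by simp
  have I: "complex_of_real (\<integral>z. (2 * Re (cnj a * z)) ^ n * indicat_real A ((cmod z)\<^sup>2) \<partial>cgauss) =
     (\<Sum>k\<le>n. (of_nat (n choose k) * cnj a ^ k * a ^ (n - k)) * (\<integral>z. z ^ k * cnj z ^ (n - k) * complex_of_real (indicat_real A ((cmod z)\<^sup>2)) \<partial>cgauss))" for n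
    unfolding integral_complex_of_real[symmetric] expand
    by (subst Bochner_Integration.integral_sum) (auto intro!: sum.cong integrable_mult_right mono)
  show "(\<integral>z. (2 * Re (cnj a * z)) ^ n * indicat_real A ((cmod z)\<^sup>2) \<partial>cgauss) = 0" if "odd n"
  proof -
    have "(\<integral>z. z ^ k * cnj z ^ (n - k) * complex_of_real (indicat_real A ((cmod z)\<^sup>2)) \<partial>cgauss) = 0" if "k \<le> n" for k
      using \<open>odd n\<close> that by (intro cgauss_moment_zero) (presburger, measurable)
    then have "complex_of_real (\<integral>z. (2 * Re (cnj a * z)) ^ n * indicat_real A ((cmod z)\<^sup>2) \<partial>cgauss) = 0"
      unfolding I by (intro sum.neutral) auto
    then show ?thesis by (simp only: of_real_eq_0_iff)
  qed
  show "(\<integral>z. (2 * Re (cnj a * z)) ^ (2 * p) * indicat_real A ((cmod z)\<^sup>2) \<partial>cgauss)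
       = fact (2 * p) / fact p * (cmod a) ^ (2 * p) * measure (erl p) A"
  proof -
    have z: "(\<integral>z. z ^ k * cnj z ^ (2 * p - k) * complex_of_real (indicat_real A ((cmod z)\<^sup>2)) \<partial>cgauss) = 0" if "k \<le> 2 * p" "k \<noteq> p" for k
      using that by (intro cgauss_moment_zero) (presburger, measurable)
    have sq: "w ^ p * cnj w ^ p = complex_of_real (cmod w ^ (2 * p))" for w
      by (simp add: power_mult flip: power_mult_distrib complex_norm_square)
    have "complex_of_real (\<integral>z. (2 * Re (cnj a * z)) ^ (2 * p) * indicat_real A ((cmod z)\<^sup>2) \<partial>cgauss) =
      (of_nat (2 * p choose p) * cnj a ^ p * a ^ (2 * p - p)) * (\<integral>z. z ^ p * cnj z ^ (2 * p - p) * complex_of_real (indicat_real A ((cmod z)\<^sup>2)) \<partial>cgauss)"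
      unfolding I by (subst sum.remove[of _ p]) (auto intro!: sum.neutral simp: z)
    also have "(\<integral>z. z ^ p * cnj z ^ (2 * p - p) * complex_of_real (indicat_real A ((cmod z)\<^sup>2)) \<partial>cgauss)
       = complex_of_real (\<integral>z. (cmod z) ^ (2 * p) * indicat_real A ((cmod z)\<^sup>2) \<partial>cgauss)"
      unfolding integral_complex_of_real[symmetric] using sq by simp
    also have "\<dots> = complex_of_real (fact p * measure (erl p) A)"
      by (subst cgauss_moment_even) auto
    also have "of_nat (2 * p choose p) * cnj a ^ p * a ^ (2 * p - p) = complex_of_real (of_nat (2 * p choose p) * cmod a ^ (2 * p))"
      using sq[of a] by (simp add: mult_ac)
    also have "complex_of_real (of_nat (2 * p choose p) * cmod a ^ (2 * p)) * complex_of_real (fact p * measure (erl p) A)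
       = complex_of_real (fact (2 * p) / fact p * (cmod a) ^ (2 * p) * measure (erl p) A)"
      by (simp add: binomial_fact)
    finally show ?thesis by (simp only: of_real_eq_iff)
  qed
qed

text \<open>Moving the shift onto the density produces the factor
  \<open>exp (- (cmod a)\<^sup>2) * exp (2 * Re (cnj a * z))\<close>. In the expansion of the second
  exponential, the power \<open>2 * p\<close> divided by \<open>fact (2 * p)\<close> integrates to
  \<open>(cmod a) ^ (2 * p) / fact p\<close> times the measure \<open>erl p\<close>, which is the
  unnormalised Poisson weight.\<close>

lemma distr_cgauss_shift: "distr cgauss borel (\<lambda>z. (cmod (z + a))\<^sup>2) = nce 1 ((cmod a)\<^sup>2)"
proof (rule measure_eqI)
  fix A assume "A \<in> sets (distr cgauss borel (\<lambda>z. (cmod (z + a))\<^sup>2))"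
  then have A [measurable]: "A \<in> sets borel" by simp
  let ?x = "(cmod a)\<^sup>2"
  let ?h = "\<lambda>z. exp (- ?x) * (exp (2 * Re (cnj a * z)) * indicat_real A ((cmod z)\<^sup>2))"
  let ?f = "\<lambda>n. (\<integral>z. (2 * Re (cnj a * z)) ^ n * indicat_real A ((cmod z)\<^sup>2) \<partial>cgauss) / fact n"
  have dens: "std_cgauss_density (z - a) = std_cgauss_density z * (exp (- ?x) * exp (2 * Re (cnj a * z)))" for z
  proof -
    have "(cmod (z - a))\<^sup>2 = (cmod z)\<^sup>2 - 2 * Re (cnj a * z) + ?x"
      unfolding cmod_power2 by (simp add: power2_eq_square algebra_simps)
    then show ?thesis by (simp add: std_cgauss_density_def flip: exp_add)
  qed
  have Re_le: "\<bar>Re (cnj a * z)\<bar> \<le> cmod a * cmod z" for z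
    using abs_Re_le_cmod[of "cnj a * z"] by (simp add: norm_mult)
  have dom: "integrable cgauss (\<lambda>z. exp (2 * cmod a * cmod z))"
    by (rule integrable_cgauss_exp_cmod)
  have int: "integrable cgauss (\<lambda>z. exp (2 * Re (cnj a * z)) * indicat_real A ((cmod z)\<^sup>2))"
  proof (rule Bochner_Integration.integrable_bound[OF dom])
    have "norm (exp (2 * Re (cnj a * z)) * indicat_real A ((cmod z)\<^sup>2)) \<le> norm (exp (2 * cmod a * cmod z))" for z
      using abs_le_D1[OF Re_le[of z]] by (simp add: indicator_def del: times_complex.sel)
    then show "AE z in cgauss. norm (exp (2 * Re (cnj a * z)) * indicat_real A ((cmod z)\<^sup>2)) \<le> norm (exp (2 * cmod a * cmod z))"
      by (rule AE_I2)
  qed measurable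
  have partial: "(\<integral>z. (\<Sum>i<n. (2 * Re (cnj a * z)) ^ i / fact i) * indicat_real A ((cmod z)\<^sup>2) \<partial>cgauss) = (\<Sum>i<n. ?f i)" for n
  proof -
    have "(\<integral>z. (\<Sum>i<n. (2 * Re (cnj a * z)) ^ i / fact i) * indicat_real A ((cmod z)\<^sup>2) \<partial>cgauss)
      = (\<integral>z. (\<Sum>i<n. (2 * Re (cnj a * z)) ^ i * indicat_real A ((cmod z)\<^sup>2) / fact i) \<partial>cgauss)"
      by (simp add: sum_distrib_right)
    also have "\<dots> = (\<Sum>i<n. \<integral>z. (2 * Re (cnj a * z)) ^ i * indicat_real A ((cmod z)\<^sup>2) / fact i \<partial>cgauss)"
      using cgauss_Re_power(1)[OF A, of a] by (intro Bochner_Integration.integral_sum integrable_divide_zero) auto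
    finally show ?thesis by (simp only: integral_divide_zero)
  qed
  have exp_sums: "(\<lambda>i. x ^ i / fact i) sums exp x" for x :: real
    using exp_converges[of x] by (simp add: divide_inverse scaleR_conv_of_real mult.commute)
  have bound: "\<bar>\<Sum>i<n. x ^ i / fact i\<bar> \<le> exp \<bar>x\<bar>" for x :: real and n
  proof -
    have "\<bar>\<Sum>i<n. x ^ i / fact i\<bar> \<le> (\<Sum>i<n. \<bar>x\<bar> ^ i / fact i)"
      by (rule order_trans[OF sum_abs]) (simp add: power_abs)
    also have "\<dots> \<le> (\<Sum>i. \<bar>x\<bar> ^ i / fact i)"
      using exp_sums[of "\<bar>x\<bar>"] by (intro sum_le_suminf) (auto simp: sums_iff)
    also have "\<dots> = exp \<bar>x\<bar>" using exp_sums[of "\<bar>x\<bar>"] by (simp add: sums_iff)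
    finally show ?thesis .
  qed
  have "(\<lambda>n. \<integral>z. (\<Sum>i<n. (2 * Re (cnj a * z)) ^ i / fact i) * indicat_real A ((cmod z)\<^sup>2) \<partial>cgauss)
      \<longlonglongrightarrow> (\<integral>z. exp (2 * Re (cnj a * z)) * indicat_real A ((cmod z)\<^sup>2) \<partial>cgauss)"
  proof (rule integral_dominated_convergence[OF _ _ dom])
    show "AE z in cgauss. (\<lambda>n. (\<Sum>i<n. (2 * Re (cnj a * z)) ^ i / fact i) * indicat_real A ((cmod z)\<^sup>2))
        \<longlonglongrightarrow> exp (2 * Re (cnj a * z)) * indicat_real A ((cmod z)\<^sup>2)"
      using exp_sums unfolding sums_def by (intro AE_I2 tendsto_mult_right) auto
    fix n
    have "\<bar>\<Sum>i<n. (2 * Re (cnj a * z)) ^ i / fact i\<bar> \<le> exp (2 * cmod a * cmod z)" for z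
      by (rule order_trans[OF bound]) (use Re_le[of z] in \<open>simp add: abs_mult del: times_complex.sel\<close>)
    then show "AE z in cgauss. norm ((\<Sum>i<n. (2 * Re (cnj a * z)) ^ i / fact i) * indicat_real A ((cmod z)\<^sup>2)) \<le> exp (2 * cmod a * cmod z)"
      by (intro AE_I2) (simp only: real_norm_def abs_mult, simp add: indicator_def)
  qed measurable
  then have "?f sums (\<integral>z. exp (2 * Re (cnj a * z)) * indicat_real A ((cmod z)\<^sup>2) \<partial>cgauss)"
    unfolding partial sums_def .
  \<comment> \<open>The odd terms are zero, so the series may be indexed by its even terms
    alone.\<close>
  also have "?this \<longleftrightarrow> (\<lambda>p. ?f (2 * p)) sums (\<integral>z. exp (2 * Re (cnj a * z)) * indicat_real A ((cmod z)\<^sup>2) \<partial>cgauss)"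
  proof (rule sums_mono_reindex[symmetric])
    show "strict_mono (\<lambda>p::nat. 2 * p)" by (rule strict_monoI) simp
    fix n :: nat assume "n \<notin> range (\<lambda>p. 2 * p)"
    then have "odd n" by (auto elim!: evenE)
    then show "?f n = 0" using cgauss_Re_power(2)[OF A] by simp
  qed
  finally have "(\<lambda>p. exp (- ?x) * ?f (2 * p)) sums (exp (- ?x) * (\<integral>z. exp (2 * Re (cnj a * z)) * indicat_real A ((cmod z)\<^sup>2) \<partial>cgauss))"
    by (rule sums_mult)
  also have "(\<lambda>p. exp (- ?x) * ?f (2 * p)) = (\<lambda>p. poisson_weight ?x p * measure (erl p) A)"
    unfolding cgauss_Re_power(3)[OF A] by (auto simp: poisson_weight_def power_mult)
  also have "exp (- ?x) * (\<integral>z. exp (2 * Re (cnj a * z)) * indicat_real A ((cmod z)\<^sup>2) \<partial>cgauss) = (\<integral>z. ?h z \<partial>cgauss)"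
    by simp
  finally have S: "(\<lambda>p. poisson_weight ?x p * measure (erl p) A) sums (\<integral>z. ?h z \<partial>cgauss)" .
  have "emeasure (distr cgauss borel (\<lambda>z. (cmod (z + a))\<^sup>2)) A = (\<integral>\<^sup>+t. indicator A t \<partial>distr cgauss borel (\<lambda>z. (cmod (z + a))\<^sup>2))"
    by simp
  also have "\<dots> = (\<integral>\<^sup>+z. indicator A ((cmod (z + a))\<^sup>2) \<partial>cgauss)"
    by (subst nn_integral_distr) auto
  also have "\<dots> = (\<integral>\<^sup>+z. ennreal (std_cgauss_density z) * indicator A ((cmod (z + a))\<^sup>2) \<partial>lborel)"
    unfolding cgauss_def by (subst nn_integral_density) auto
  also have "\<dots> = (\<integral>\<^sup>+z. ennreal (std_cgauss_density (z - a)) * indicator A ((cmod z)\<^sup>2) \<partial>lborel)"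
    by (subst nn_integral_lborel_translate[of "\<lambda>z. ennreal (std_cgauss_density (z - a)) * indicator A ((cmod z)\<^sup>2)" a, symmetric]) auto
  also have "\<dots> = (\<integral>\<^sup>+z. ennreal (std_cgauss_density z) * ennreal (?h z) \<partial>lborel)"
    unfolding dens by (intro nn_integral_cong) (auto simp: indicator_def ennreal_mult mult.assoc)
  also have "\<dots> = (\<integral>\<^sup>+z. ennreal (?h z) \<partial>cgauss)"
    unfolding cgauss_def by (subst nn_integral_density) auto
  also have "\<dots> = ennreal (\<integral>z. ?h z \<partial>cgauss)"
    by (rule nn_integral_eq_integral) (use int in auto)
  also have "\<dots> = (\<Sum>p. ennreal (poisson_weight ?x p * measure (erl p) A))"
    using S by (subst suminf_ennreal2) (auto simp: sums_iff)
  also have "\<dots> = (\<Sum>p. ennreal (poisson_weight ?x p) * (\<integral>\<^sup>+t. indicator A t \<partial>erl (1 - 1 + p)))"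
    by (simp add: ennreal_mult erl.emeasure_eq_measure)
  also have "\<dots> = (\<integral>\<^sup>+t. indicator A t \<partial>nce 1 ?x)"
    by (rule nn_integral_nce[symmetric]) auto
  also have "\<dots> = emeasure (nce 1 ?x) A" by simp
  finally show "emeasure (distr cgauss borel (\<lambda>z. (cmod (z + a))\<^sup>2)) A = emeasure (nce 1 ?x) A" .
qed simp

lemma measurable_cgauss_vec_component [measurable (raw)]:
  "i \<in> K \<Longrightarrow> (\<lambda>z. z i) \<in> borel_measurable (cgauss_vec K)"
  using measurable_component_singleton[of i K "\<lambda>_. cgauss"] measurable_cong_sets[OF refl sets_cgauss, of "cgauss_vec K"] by auto

lemma measurable_cgauss_vec_sqnorm:
  "(\<lambda>z. \<Sum>i\<in>J. (cmod (z i + \<alpha> i))\<^sup>2) \<in> borel_measurable (cgauss_vec J)"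
  by (intro borel_measurable_sum) measurable

lemma nn_integral_cgauss_vec_central:
  assumes "finite J" "J \<noteq> {}" and "f \<in> borel_measurable borel"
  shows "(\<integral>\<^sup>+z. f (\<Sum>i\<in>J. (cmod (z i))\<^sup>2) \<partial>cgauss_vec J) = (\<integral>\<^sup>+t. f t \<partial>erl (card J - 1))"
  using assms
proof (induction arbitrary: f rule: finite_ne_induct)
  case (singleton j)
  have mm: "(\<lambda>w. f ((cmod w)\<^sup>2)) \<in> borel_measurable cgauss"
    by (rule measurable_compose[OF _ singleton.prems]) simp
  have "(\<integral>\<^sup>+z. f (\<Sum>i\<in>{j}. (cmod (z i))\<^sup>2) \<partial>cgauss_vec {j}) = (\<integral>\<^sup>+z. f ((cmod (z j))\<^sup>2) \<partial>cgauss_vec {j})"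
    by simp
  also have "\<dots> = (\<integral>\<^sup>+z. f ((cmod z)\<^sup>2) \<partial>cgauss)"
    by (rule cgauss_prod.product_nn_integral_singleton[OF mm])
  finally show ?case using nn_integral_cgauss_cmod_square[OF singleton.prems] by simp
next
  case (insert j J)
  note [measurable] = insert.prems
  have m: "(\<lambda>z. \<Sum>i\<in>insert j J. (cmod (z i))\<^sup>2) \<in> borel_measurable (cgauss_vec (insert j J))"
    using measurable_cgauss_vec_sqnorm[where J = "insert j J" and \<alpha> = "\<lambda>_. 0"] by (simp only: add_0_right)
  have m': "(\<lambda>z. \<Sum>i\<in>J. (cmod (z i))\<^sup>2) \<in> borel_measurable (cgauss_vec J)"
    using measurable_cgauss_vec_sqnorm[where J = J and \<alpha> = "\<lambda>_. 0"] by (simp only: add_0_right)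
  have "(\<integral>\<^sup>+z. f (\<Sum>i\<in>insert j J. (cmod (z i))\<^sup>2) \<partial>cgauss_vec (insert j J)) =
      (\<integral>\<^sup>+x. (\<integral>\<^sup>+y. f (\<Sum>i\<in>insert j J. (cmod ((x(j := y)) i))\<^sup>2) \<partial>cgauss) \<partial>cgauss_vec J)"
    by (rule cgauss_prod.product_nn_integral_insert[OF insert.hyps(1,3) measurable_compose[OF m insert.prems]])
  also have "\<dots> = (\<integral>\<^sup>+x. (\<integral>\<^sup>+t. f (t + (\<Sum>i\<in>J. (cmod (x i))\<^sup>2)) \<partial>erl 0) \<partial>cgauss_vec J)"
  proof (rule nn_integral_cong)
    fix x
    have "(\<Sum>i\<in>insert j J. (cmod ((x(j := y)) i))\<^sup>2) = (cmod y)\<^sup>2 + (\<Sum>i\<in>J. (cmod (x i))\<^sup>2)" for y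
      using insert.hyps by (auto intro!: sum.cong split: if_splits)
    then show "(\<integral>\<^sup>+y. f (\<Sum>i\<in>insert j J. (cmod ((x(j := y)) i))\<^sup>2) \<partial>cgauss) = (\<integral>\<^sup>+t. f (t + (\<Sum>i\<in>J. (cmod (x i))\<^sup>2)) \<partial>erl 0)"
      using nn_integral_cgauss_cmod_square[of "\<lambda>t. f (t + (\<Sum>i\<in>J. (cmod (x i))\<^sup>2))"] by simp
  qed
  also have "\<dots> = (\<integral>\<^sup>+u. (\<integral>\<^sup>+t. f (t + u) \<partial>erl 0) \<partial>erl (card J - 1))"
    by (rule insert.IH) measurable
  also have "\<dots> = (\<integral>\<^sup>+t. f t \<partial>erl (0 + (card J - 1) + 1))"
    by (rule nn_integral_erl_add) measurable
  also have "0 + (card J - 1) + 1 = card (insert j J) - 1"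
    using insert.hyps by (simp add: card_gt_0_iff)
  finally show ?case .
qed

text \<open>A rotation moves the whole mean into coordinate \<open>l\<close>. That coordinate is a
  one-dimensional Poisson mixture, and the central remainder raises the Erlang index of each
  component by \<open>card J - 1\<close>.\<close>

lemma nn_integral_cgauss_vec_sqnorm:
  assumes J: "finite J" "J \<noteq> {}" and [measurable]: "f \<in> borel_measurable borel"
  shows "(\<integral>\<^sup>+z. f (\<Sum>i\<in>J. (cmod (z i + \<alpha> i))\<^sup>2) \<partial>cgauss_vec J) = (\<integral>\<^sup>+t. f t \<partial>nce (card J) (\<Sum>i\<in>J. (cmod (\<alpha> i))\<^sup>2))"
proof -
  obtain l where l: "l \<in> J" using J by auto
  obtain T where T: "rot J T" "\<forall>k\<in>J - {l}. T \<alpha> k = 0" by (rule rot_exists[OF J(1) l, of \<alpha>])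
  define a where "a = T \<alpha> l"
  define J' where "J' = J - {l}"
  have Jeq: "J = insert l J'" "l \<notin> J'" "finite J'" using l J by (auto simp: J'_def)
  define x where "x = (cmod a)\<^sup>2"
  have "(\<Sum>i\<in>J. (cmod (T \<alpha> i))\<^sup>2) = (\<Sum>i\<in>insert l J'. (cmod (T \<alpha> i))\<^sup>2)"
    by (rule arg_cong[where f = "sum _", OF Jeq(1)])
  also have "\<dots> = x + (\<Sum>i\<in>J'. (cmod (T \<alpha> i))\<^sup>2)"
    using Jeq(2,3) by (simp add: a_def x_def)
  also have "(\<Sum>i\<in>J'. (cmod (T \<alpha> i))\<^sup>2) = 0"
    using T(2) by (auto simp: J'_def)
  finally have x: "(\<Sum>i\<in>J. (cmod (\<alpha> i))\<^sup>2) = x" "0 \<le> x"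
    using rot_norm[OF T(1) J(1), of \<alpha>] by (simp_all add: x_def)
  let ?S = "\<lambda>z. (cmod (z l + a))\<^sup>2 + (\<Sum>i\<in>J'. (cmod (z i))\<^sup>2)"
  have split: "(\<Sum>i\<in>J. (cmod (z i + \<alpha> i))\<^sup>2) = ?S (T z)" for z
  proof -
    have "(\<Sum>i\<in>J. (cmod (z i + \<alpha> i))\<^sup>2) = (\<Sum>i\<in>J. (cmod (T z i + T \<alpha> i))\<^sup>2)"
      using rot_norm[OF T(1) J(1), of "\<lambda>i. z i + \<alpha> i"] by (simp add: rot_add[OF T(1)])
    also have "\<dots> = (\<Sum>i\<in>insert l J'. (cmod (T z i + T \<alpha> i))\<^sup>2)"
      by (rule arg_cong[where f = "sum _", OF Jeq(1)])
    also have "\<dots> = (cmod (T z l + T \<alpha> l))\<^sup>2 + (\<Sum>i\<in>J'. (cmod (T z i + T \<alpha> i))\<^sup>2)"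
      using Jeq(2,3) by simp
    finally show ?thesis using T(2) by (auto simp: a_def J'_def)
  qed
  have mS: "?S \<in> borel_measurable (cgauss_vec J)"
    using l by (intro borel_measurable_add borel_measurable_sum) (auto simp: J'_def)
  have one: "(\<integral>\<^sup>+y. g ((cmod (y + a))\<^sup>2) \<partial>cgauss) = (\<Sum>n. ennreal (poisson_weight x n) * (\<integral>\<^sup>+t. g t \<partial>erl n))"
    if [measurable]: "g \<in> borel_measurable borel" for g
  proof -
    have "(\<integral>\<^sup>+y. g ((cmod (y + a))\<^sup>2) \<partial>cgauss) = (\<integral>\<^sup>+t. g t \<partial>nce 1 x)"
      unfolding x_def distr_cgauss_shift[symmetric] by (subst nn_integral_distr) auto
    also have "\<dots> = (\<Sum>n. ennreal (poisson_weight x n) * (\<integral>\<^sup>+t. g t \<partial>erl n))"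
      using x by (subst nn_integral_nce) auto
    finally show ?thesis .
  qed
  have "(\<integral>\<^sup>+z. f (\<Sum>i\<in>J. (cmod (z i + \<alpha> i))\<^sup>2) \<partial>cgauss_vec J) = (\<integral>\<^sup>+z. f (?S (T z)) \<partial>cgauss_vec J)"
    by (simp only: split)
  also have "\<dots> = (\<integral>\<^sup>+z. f (?S z) \<partial>distr (cgauss_vec J) (cgauss_vec J) T)"
    by (rule nn_integral_distr[symmetric, OF measurable_rot[OF T(1)]]) (use mS in measurable)
  also have "\<dots> = (\<integral>\<^sup>+z. f (?S z) \<partial>cgauss_vec J)"
    by (simp only: distr_rot[OF T(1) J(1)])
  also have "\<dots> = (\<integral>\<^sup>+z. (\<integral>\<^sup>+y. f (?S (z(l := y))) \<partial>cgauss) \<partial>cgauss_vec J')"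
    unfolding Jeq(1)
    by (rule cgauss_prod.product_nn_integral_insert[OF Jeq(3,2)])
      (use measurable_compose[OF mS assms(3)] in \<open>simp only: Jeq(1)[symmetric]\<close>)
  also have "\<dots> = (\<integral>\<^sup>+z. (\<Sum>n. ennreal (poisson_weight x n) * (\<integral>\<^sup>+t. f (t + (\<Sum>i\<in>J'. (cmod (z i))\<^sup>2)) \<partial>erl n)) \<partial>cgauss_vec J')"
  proof (rule nn_integral_cong)
    fix z
    have "?S (z(l := y)) = (cmod (y + a))\<^sup>2 + (\<Sum>i\<in>J'. (cmod (z i))\<^sup>2)" for y
      using Jeq(2,3) by (auto intro!: sum.cong split: if_splits)
    then show "(\<integral>\<^sup>+y. f (?S (z(l := y))) \<partial>cgauss) = (\<Sum>n. ennreal (poisson_weight x n) * (\<integral>\<^sup>+t. f (t + (\<Sum>i\<in>J'. (cmod (z i))\<^sup>2)) \<partial>erl n))"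
      using one[of "\<lambda>t. f (t + (\<Sum>i\<in>J'. (cmod (z i))\<^sup>2))"] by simp
  qed
  also have "\<dots> = (\<Sum>n. ennreal (poisson_weight x n) * (\<integral>\<^sup>+z. (\<integral>\<^sup>+t. f (t + (\<Sum>i\<in>J'. (cmod (z i))\<^sup>2)) \<partial>erl n) \<partial>cgauss_vec J'))"
    by (subst nn_integral_suminf, measurable, subst nn_integral_cmult, measurable)
  also have "\<dots> = (\<Sum>n. ennreal (poisson_weight x n) * (\<integral>\<^sup>+t. f t \<partial>erl (card J - 1 + n)))"
  proof (rule arg_cong[where f = suminf], rule ext, rule arg_cong2[where f = "(*)", OF refl])
    fix n
    show "(\<integral>\<^sup>+z. (\<integral>\<^sup>+t. f (t + (\<Sum>i\<in>J'. (cmod (z i))\<^sup>2)) \<partial>erl n) \<partial>cgauss_vec J') = (\<integral>\<^sup>+t. f t \<partial>erl (card J - 1 + n))"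
    proof (cases "J' = {}")
      \<comment> \<open>In dimension one there is no central remainder, and the index stays
        \<open>n\<close>.\<close>
      case True
      moreover have "card J = 1"
        unfolding Jeq(1) True by simp
      ultimately show ?thesis
        using prob_space.emeasure_space_1[OF prob_space_cgauss_vec, of J'] by simp
    next
      case False
      have "(\<integral>\<^sup>+z. (\<integral>\<^sup>+t. f (t + (\<Sum>i\<in>J'. (cmod (z i))\<^sup>2)) \<partial>erl n) \<partial>cgauss_vec J') = (\<integral>\<^sup>+u. (\<integral>\<^sup>+t. f (t + u) \<partial>erl n) \<partial>erl (card J' - 1))"
        by (rule nn_integral_cgauss_vec_central[OF Jeq(3) False, where f = "\<lambda>u. \<integral>\<^sup>+t. f (t + u) \<partial>erl n"]) measurable
      also have "\<dots> = (\<integral>\<^sup>+t. f t \<partial>erl (n + (card J' - 1) + 1))"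
        by (rule nn_integral_erl_add) measurable
      also have "n + (card J' - 1) + 1 = card J - 1 + n"
        unfolding Jeq(1) using False Jeq(2,3) by (simp add: card_gt_0_iff)
      finally show ?thesis .
    qed
  qed
  also have "\<dots> = (\<integral>\<^sup>+t. f t \<partial>nce (card J) x)"
    using x by (subst nn_integral_nce) auto
  finally show ?thesis by (simp only: x)
qed

lemma distr_cgauss_vec_sqnorm:
  assumes J: "finite J" "J \<noteq> {}"
  shows "distr (cgauss_vec J) borel (\<lambda>z. \<Sum>i\<in>J. (cmod (z i + \<alpha> i))\<^sup>2) = nce (card J) (\<Sum>i\<in>J. (cmod (\<alpha> i))\<^sup>2)"
proof (rule measure_eqI)
  fix A assume "A \<in> sets (distr (cgauss_vec J) borel (\<lambda>z. \<Sum>i\<in>J. (cmod (z i + \<alpha> i))\<^sup>2))"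
  then have A [measurable]: "A \<in> sets borel" by simp
  have "emeasure (distr (cgauss_vec J) borel (\<lambda>z. \<Sum>i\<in>J. (cmod (z i + \<alpha> i))\<^sup>2)) A = (\<integral>\<^sup>+t. indicator A t \<partial>distr (cgauss_vec J) borel (\<lambda>z. \<Sum>i\<in>J. (cmod (z i + \<alpha> i))\<^sup>2))"
    by simp
  also have "\<dots> = (\<integral>\<^sup>+z. indicator A (\<Sum>i\<in>J. (cmod (z i + \<alpha> i))\<^sup>2) \<partial>cgauss_vec J)"
    by (subst nn_integral_distr) auto
  also have "\<dots> = (\<integral>\<^sup>+t. indicator A t \<partial>nce (card J) (\<Sum>i\<in>J. (cmod (\<alpha> i))\<^sup>2))"
    using J by (rule nn_integral_cgauss_vec_sqnorm) measurable
  finally show "emeasure (distr (cgauss_vec J) borel (\<lambda>z. \<Sum>i\<in>J. (cmod (z i + \<alpha> i))\<^sup>2)) A = emeasure (nce (card J) (\<Sum>i\<in>J. (cmod (\<alpha> i))\<^sup>2)) A"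
    by simp
qed simp

section \<open>Transforms of the Erlang mixtures\<close>

lemma set_integral_FTC_halfline:
  fixes F f :: "real \<Rightarrow> complex"
  assumes F: "\<And>x. (F has_vector_derivative f x) (at x)" and f: "\<And>x. isCont f x"
    and int: "set_integrable lborel {0<..} f" and lim: "(F \<longlongrightarrow> 0) at_top"
  shows "(LINT x:{0<..}|lborel. f x) = - F 0"
proof -
  have F0: "(F \<longlongrightarrow> F 0) (at_right 0)"
    using has_vector_derivative_continuous[OF F[of 0]]
    by (simp add: isCont_def filterlim_at_split)
  have "(LBINT x=ereal 0..\<infinity>. f x) = 0 - F 0"
  proof (rule interval_integral_FTC_integrable[where F = F])
    show "set_integrable lborel (einterval (ereal 0) \<infinity>) f"
      using int by (simp only: einterval_eq)
    show "((F \<circ> real_of_ereal) \<longlongrightarrow> F 0) (at_right (ereal 0))" "((F \<circ> real_of_ereal) \<longlongrightarrow> 0) (at_left \<infinity>)"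
      using F0 lim by (simp_all only: ereal_tendsto_simps1)
  qed (use F f in auto)
  moreover have "(LBINT x=ereal 0..\<infinity>. f x) = (LINT x:{0<..}|lborel. f x)"
    unfolding interval_lebesgue_integral_def einterval_eq by simp
  ultimately show ?thesis by simp
qed

text \<open>Tilting by \<open>exp (r * t)\<close> gives a multiple of the Erlang density of rate
  \<open>1 - r\<close>, whose total mass is known. This settles real exponents and, by taking norms,
  integrability for complex ones.\<close>

lemma integral_erl_exp_real:
  assumes r: "r < 1"
  shows "integrable (erl k) (\<lambda>t. exp (r * t))" "(\<integral>t. exp (r * t) \<partial>erl k) = 1 / (1 - r) ^ Suc k"
proof -
  interpret e: prob_space "density lborel (\<lambda>t. ennreal (erlang_density k (1 - r) t))"
    using r by (intro prob_space_erlang_density) simp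
  have "(\<integral>\<^sup>+t. ennreal (exp (r * t)) \<partial>erl k) = (\<integral>\<^sup>+t. ennreal (1 / (1 - r) ^ Suc k) * ennreal (erlang_density k (1 - r) t) \<partial>lborel)"
  proof (subst nn_integral_erl, measurable, intro nn_integral_cong)
    fix t :: real
    have "erlang_density k 1 t * exp (r * t) = 1 / (1 - r) ^ Suc k * erlang_density k (1 - r) t"
    proof -
      have "exp (- (1 - r) * t) = exp (- 1 * t) * exp (r * t)"
        by (simp add: algebra_simps flip: exp_add)
      then show ?thesis
        using r by (simp only: erlang_density_def power_one mult_1_left) (simp del: power_Suc)
    qed
    then show "ennreal (erlang_density k 1 t) * ennreal (exp (r * t)) = ennreal (1 / (1 - r) ^ Suc k) * ennreal (erlang_density k (1 - r) t)"
      using r by (simp add: ennreal_mult[symmetric] del: power_Suc)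
  qed
  also have "\<dots> = ennreal (1 / (1 - r) ^ Suc k) * (\<integral>\<^sup>+t. ennreal (erlang_density k (1 - r) t) \<partial>lborel)"
    by (rule nn_integral_cmult) measurable
  also have "(\<integral>\<^sup>+t. ennreal (erlang_density k (1 - r) t) \<partial>lborel) = 1"
    using e.emeasure_space_1 by (simp add: emeasure_density)
  finally have *: "(\<integral>\<^sup>+t. ennreal (exp (r * t)) \<partial>erl k) = ennreal (1 / (1 - r) ^ Suc k)" by simp
  show "integrable (erl k) (\<lambda>t. exp (r * t))"
    by (rule integrableI_nn_integral_finite[OF _ _ *]) auto
  show "(\<integral>t. exp (r * t) \<partial>erl k) = 1 / (1 - r) ^ Suc k"
    using r by (subst integral_eq_nn_integral) (auto simp: * simp del: power_Suc)
qed

lemma integrable_erl_exp: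
  assumes "Re \<tau> < 1"
  shows "integrable (erl k) (\<lambda>t. exp (\<tau> * complex_of_real t))"
  by (rule Bochner_Integration.integrable_bound[OF integral_erl_exp_real(1)[OF assms, of k]]) auto

text \<open>Tilting by a complex exponent leaves the realm of densities, so integration by parts is
  used: \<open>g (Suc k)\<close> has derivative \<open>g k - c * g (Suc k)\<close> and vanishes at
  both ends, so every step divides by \<open>c\<close>.\<close>

lemma integral_erl_exp:
  assumes \<tau>: "Re \<tau> < 1"
  shows "(\<integral>t. exp (\<tau> * complex_of_real t) \<partial>erl k) = 1 / (1 - \<tau>) ^ Suc k"
proof -
  define c where "c = 1 - \<tau>"
  have c: "0 < Re c" "c \<noteq> 0" using \<tau> by (auto simp: c_def)
  \<comment> \<open>A smooth function on the whole line that agrees with the integrand at positive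
    arguments; the possible jump of the density at zero sits on a null set.\<close>
  define g where "g k t = complex_of_real (t ^ k / fact k) * exp (- c * complex_of_real t)" for k t
  have eq: "AE t in lborel. erlang_density k 1 t *\<^sub>R exp (\<tau> * complex_of_real t) = indicator {0<..} t *\<^sub>R g k t" for k
  proof -
    have "AE t in lborel. t \<noteq> (0::real)" by (rule AE_lborel_singleton)
    then show ?thesis
    proof eventually_elim
      case (elim t)
      have "complex_of_real (exp (- t)) * exp (\<tau> * complex_of_real t) = exp (- c * complex_of_real t)"
        by (simp add: c_def algebra_simps flip: exp_of_real exp_add)
      then show ?case using elim
        by (auto simp: erlang_density_def g_def indicator_def scaleR_conv_of_real)
    qed
  qed
  have gm [measurable]: "g k \<in> borel_measurable borel" for k
    unfolding g_def[abs_def] by measurable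
  have int: "set_integrable lborel {0<..} (g k)" for k
  proof -
    have "integrable lborel (\<lambda>t. erlang_density k 1 t *\<^sub>R exp (\<tau> * complex_of_real t))"
      using integrable_erl_exp[OF \<tau>, of k] by (subst (asm) integral_erl(2)) measurable
    moreover have "(\<lambda>t. indicat_real {0<..} t *\<^sub>R g k t) \<in> borel_measurable lborel"
      by measurable
    ultimately show ?thesis
      unfolding set_integrable_def using eq[of k] by (rule integrable_cong_AE_imp)
  qed
  have J: "(\<integral>t. exp (\<tau> * complex_of_real t) \<partial>erl k) = (LINT t:{0<..}|lborel. g k t)" for k
    unfolding set_lebesgue_integral_def
    by (subst integral_erl(1), measurable, rule integral_cong_AE) (use eq[of k] in auto)
  have lim: "(g k \<longlongrightarrow> 0) at_top" for k
  proof (rule tendsto_norm_zero_cancel)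
    have "((\<lambda>t. \<bar>t ^ k / fact k\<bar> * exp (- Re c * t)) \<longlongrightarrow> 0) at_top"
    proof -
      have "((\<lambda>t. t ^ k / fact k * exp (- Re c * t)) \<longlongrightarrow> 0) at_top"
        using c(1) by real_asymp
      from tendsto_rabs[OF this] show ?thesis by (simp add: abs_mult)
    qed
    moreover have "norm (g k t) = \<bar>t ^ k / fact k\<bar> * exp (- Re c * t)" for t
      unfolding g_def norm_mult norm_of_real norm_exp_eq_Re by simp
    ultimately show "((\<lambda>t. norm (g k t)) \<longlongrightarrow> 0) at_top" by simp
  qed
  have cont: "isCont (g k) t" for k t
    unfolding g_def[abs_def] by (intro continuous_intros) auto
  show ?thesis
  proof (induction k)
    case 0
    have D: "(g 0 has_vector_derivative - c * g 0 t) (at t)" for t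
      unfolding g_def[abs_def] by (auto intro!: derivative_eq_intros has_vector_derivative_real_field)
    have "set_integrable lborel {0<..} (\<lambda>t. - c * g 0 t)"
      using int by (intro set_integrable_mult_right) auto
    from set_integral_FTC_halfline[OF D _ this lim] cont
    have "(LINT t:{0<..}|lborel. - c * g 0 t) = - g 0 0" by (simp add: continuous_intros)
    then have "- c * (LINT t:{0<..}|lborel. g 0 t) = - g 0 0"
      by (simp only: set_integral_mult_right)
    then have "c * (LINT t:{0<..}|lborel. g 0 t) = 1"
      by (simp add: g_def[of 0 0])
    then show ?case using c unfolding J c_def[symmetric] by (simp add: field_simps)
  next
    case (Suc k)
    have D: "(g (Suc k) has_vector_derivative g k t - c * g (Suc k) t) (at t)" for t
    proof -
      have "((\<lambda>t. t ^ Suc k / fact (Suc k)) has_real_derivative t ^ k / fact k) (at t)"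
        by (rule derivative_eq_intros refl | simp)+
      then have 1: "((\<lambda>t. complex_of_real (t ^ Suc k / fact (Suc k))) has_vector_derivative complex_of_real (t ^ k / fact k)) (at t)"
        by (rule has_vector_derivative_of_real)
      have 2: "((\<lambda>t. exp (- c * complex_of_real t)) has_vector_derivative - c * exp (- c * complex_of_real t)) (at t)"
        by (auto intro!: derivative_eq_intros has_vector_derivative_real_field)
      have 3: "P * (- c * E) + Q * E = Q * E - c * (P * E)" for P Q E
        by (simp add: algebra_simps)
      show ?thesis
        unfolding g_def[abs_def]
        by (rule has_vector_derivative_eq_rhs[OF has_vector_derivative_mult[OF 1 2]]) (rule 3)
    qed
    have ct: "isCont (\<lambda>t. g k t - c * g (Suc k) t) t" for t
      by (intro continuous_intros cont)
    have "set_integrable lborel {0<..} (\<lambda>t. g k t - c * g (Suc k) t)"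
      using int by (intro set_integral_diff set_integrable_mult_right) auto
    from set_integral_FTC_halfline[OF D ct this lim]
    have "(LINT t:{0<..}|lborel. g k t - c * g (Suc k) t) = 0" by (simp add: g_def[of "Suc k" 0])
    also have "(LINT t:{0<..}|lborel. g k t - c * g (Suc k) t) = (LINT t:{0<..}|lborel. g k t) - c * (LINT t:{0<..}|lborel. g (Suc k) t)"
      using int by (subst set_integral_diff) auto
    finally show ?case using Suc.IH c unfolding J c_def[symmetric] by (simp add: field_simps)
  qed
qed

lemma poisson_weight_power_sums:
  fixes q :: complex
  shows "(\<lambda>n. complex_of_real (poisson_weight x n) * q ^ n) sums exp (of_real x * (q - 1))"
proof -
  have "(\<lambda>n. exp (- of_real x) * ((of_real x * q) ^ n /\<^sub>R fact n)) sums (exp (- of_real x) * exp (of_real x * q))"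
    by (intro sums_mult exp_converges)
  also have "(\<lambda>n. exp (- of_real x) * ((of_real x * q) ^ n /\<^sub>R fact n)) = (\<lambda>n. complex_of_real (poisson_weight x n) * q ^ n)"
    by (auto simp: poisson_weight_def power_mult_distrib exp_of_real[symmetric] scaleR_conv_of_real field_simps)
  finally show ?thesis by (simp add: exp_add[symmetric] algebra_simps)
qed

text \<open>The transforms of the components are geometric in the Poisson index, so the Poisson
  generating function at \<open>1 / (1 - \<tau>)\<close> sums them; subtracting one from this point
  gives the exponent \<open>\<tau> / (1 - \<tau>)\<close>.\<close>

lemma nce_laplace:
  assumes x: "0 \<le> x" and N: "1 \<le> N" and \<tau>: "Re \<tau> < 1"
  shows "integrable (nce N x) (\<lambda>t. exp (\<tau> * complex_of_real t))"
    and "(\<integral>t. exp (\<tau> * complex_of_real t) \<partial>nce N x) = 1 / (1 - \<tau>) ^ N * exp (\<tau> / (1 - \<tau>) * of_real x)"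
proof -
  have N': "Suc (N - 1 + n) = N + n" for n using N by simp
  have E: "(\<integral>t. norm (exp (\<tau> * complex_of_real t)) \<partial>erl (N - 1 + n)) = 1 / (1 - Re \<tau>) ^ (N + n)" for n
    using integral_erl_exp_real(2)[OF \<tau>, of "N - 1 + n"] unfolding N' by simp
  have summ: "summable (\<lambda>n. poisson_weight x n * (\<integral>t. norm (exp (\<tau> * complex_of_real t)) \<partial>erl (N - 1 + n)))"
  proof -
    have "summable (\<lambda>n. complex_of_real (poisson_weight x n) * complex_of_real (1 / (1 - Re \<tau>)) ^ n)"
      by (rule sums_summable[OF poisson_weight_power_sums])
    then have "summable (\<lambda>n. complex_of_real (poisson_weight x n * (1 / (1 - Re \<tau>)) ^ n))"
      by simp
    then have "summable (\<lambda>n. (1 / (1 - Re \<tau>) ^ N) * (poisson_weight x n * (1 / (1 - Re \<tau>)) ^ n))"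
      unfolding summable_of_real_iff by (rule summable_mult)
    also have "(\<lambda>n. (1 / (1 - Re \<tau>) ^ N) * (poisson_weight x n * (1 / (1 - Re \<tau>)) ^ n)) =
       (\<lambda>n. poisson_weight x n * (\<integral>t. norm (exp (\<tau> * complex_of_real t)) \<partial>erl (N - 1 + n)))"
      unfolding E by (simp add: power_add power_divide)
    finally show ?thesis .
  qed
  have m: "(\<lambda>t. exp (\<tau> * complex_of_real t)) \<in> borel_measurable borel" by measurable
  note I = integral_nce_sums[OF x m integrable_erl_exp[OF \<tau>] summ]
  show "integrable (nce N x) (\<lambda>t. exp (\<tau> * complex_of_real t))"
    by (rule I(1))
  have "(\<lambda>n. poisson_weight x n *\<^sub>R (1 / (1 - \<tau>) ^ (N + n))) sums (\<integral>t. exp (\<tau> * complex_of_real t) \<partial>nce N x)"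
    using I(2) by (simp only: integral_erl_exp[OF \<tau>] N')
  moreover have "(\<lambda>n. 1 / (1 - \<tau>) ^ N * (complex_of_real (poisson_weight x n) * (1 / (1 - \<tau>)) ^ n)) sums
      (1 / (1 - \<tau>) ^ N * exp (of_real x * (1 / (1 - \<tau>) - 1)))"
    by (intro sums_mult poisson_weight_power_sums)
  moreover have "1 / (1 - \<tau>) - 1 = \<tau> / (1 - \<tau>)"
  proof -
    have "1 - \<tau> \<noteq> 0" using \<tau> by auto
    then show ?thesis by (simp add: divide_simps)
  qed
  ultimately show "(\<integral>t. exp (\<tau> * complex_of_real t) \<partial>nce N x) = 1 / (1 - \<tau>) ^ N * exp (\<tau> / (1 - \<tau>) * of_real x)"
    by (simp add: sums_iff scaleR_conv_of_real power_add power_divide mult.commute)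
qed

section \<open>Erlang ratios and the confluent hypergeometric series\<close>

lemma pochhammer_of_nat_fact: "0 < n \<Longrightarrow> pochhammer (of_nat n) k = (fact (n + k - 1) / fact (n - 1) :: 'a::field_char_0)"
proof (induction k)
  case (Suc k)
  then have "fact (n + Suc k - 1) = (of_nat n + of_nat k :: 'a) * fact (n + k - 1)"
    by (cases n) (auto simp: algebra_simps)
  then show ?case using Suc by (simp add: pochhammer_Suc)
qed simp

text \<open>Multiplying the Erlang density by \<open>t ^ k\<close> gives again a multiple of an Erlang density, and \<open>t + v\<close> has an
  Erlang law, so the moments of the ratio \<open>t / (t + v)\<close> can be read off.\<close>
lemma erl_ratio_moment:
  assumes N: "1 \<le> N"
  shows "(\<integral>\<^sup>+v. (\<integral>\<^sup>+t. ennreal ((t / (t + v)) ^ k) \<partial>erl (N - 1)) \<partial>erl K)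
    = ennreal (pochhammer (real N) k / pochhammer (real (N + K + 1)) k)"
proof -
  let ?g = "\<lambda>s::real. ennreal (inverse (s ^ k))"
  let ?m = "N + K"
  \<comment> \<open>The negative moment is obtained backwards:
    \<open>s ^ k * inverse (s ^ k)\<close> has expectation one, and absorbing the factor
    \<open>s ^ k\<close> shifts the index.\<close>
  have g1: "ennreal (fact (?m + k) / fact ?m) * (\<integral>\<^sup>+s. ?g s \<partial>erl (?m + k)) = 1"
  proof -
    have "(\<integral>\<^sup>+s. ennreal (s ^ k) * ?g s \<partial>erl ?m) = (\<integral>\<^sup>+s. 1 \<partial>erl ?m)"
      by (rule nn_integral_cong_AE, rule AE_mp[OF AE_erl_pos], rule AE_I2)
         (auto simp: ennreal_mult[symmetric])
    also have "\<dots> = 1" using erl.emeasure_space_1 by simp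
    finally show ?thesis by (subst (asm) nn_integral_erl_power) auto
  qed
  have g: "(\<integral>\<^sup>+s. ?g s \<partial>erl (?m + k)) = ennreal (fact ?m / fact (?m + k))"
  proof -
    have "ennreal (fact ?m / fact (?m + k)) * (ennreal (fact (?m + k) / fact ?m) * (\<integral>\<^sup>+s. ?g s \<partial>erl (?m + k))) = (\<integral>\<^sup>+s. ?g s \<partial>erl (?m + k))"
      by (simp add: ennreal_mult[symmetric] flip: mult.assoc)
    then show ?thesis unfolding g1 by simp
  qed
  have "(\<integral>\<^sup>+v. (\<integral>\<^sup>+t. ennreal ((t / (t + v)) ^ k) \<partial>erl (N - 1)) \<partial>erl K)
     = (\<integral>\<^sup>+v. (\<integral>\<^sup>+t. ennreal (t ^ k) * ?g (t + v) \<partial>erl (N - 1)) \<partial>erl K)"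
  proof (rule nn_integral_cong_AE, rule eventually_mono[OF AE_erl_pos])
    fix v :: real assume v: "0 < v"
    \<comment> \<open>Positivity of \<open>t\<close> and \<open>v\<close>, which holds almost
      surely, is what lets \<open>ennreal\<close> split over the product.\<close>
    have "ennreal ((t / (t + v)) ^ k) = ennreal (t ^ k) * ?g (t + v)" if "0 < t" for t
    proof -
      have "(t / (t + v)) ^ k = t ^ k * inverse ((t + v) ^ k)"
        by (simp add: power_mult_distrib power_inverse divide_inverse)
      then show ?thesis using that v by (simp add: ennreal_mult)
    qed
    then show "(\<integral>\<^sup>+t. ennreal ((t / (t + v)) ^ k) \<partial>erl (N - 1)) = (\<integral>\<^sup>+t. ennreal (t ^ k) * ?g (t + v) \<partial>erl (N - 1))"
      by (intro nn_integral_cong_AE eventually_mono[OF AE_erl_pos])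
  qed
  also have "\<dots> = (\<integral>\<^sup>+v. ennreal (fact (N - 1 + k) / fact (N - 1)) * (\<integral>\<^sup>+t. ?g (t + v) \<partial>erl (N - 1 + k)) \<partial>erl K)"
  proof (rule nn_integral_cong)
    fix v :: real
    show "(\<integral>\<^sup>+t. ennreal (t ^ k) * ?g (t + v) \<partial>erl (N - 1)) = ennreal (fact (N - 1 + k) / fact (N - 1)) * (\<integral>\<^sup>+t. ?g (t + v) \<partial>erl (N - 1 + k))"
      by (rule nn_integral_erl_power) measurable
  qed
  also have "\<dots> = ennreal (fact (N - 1 + k) / fact (N - 1)) * (\<integral>\<^sup>+v. (\<integral>\<^sup>+t. ?g (t + v) \<partial>erl (N - 1 + k)) \<partial>erl K)"
    by (rule nn_integral_cmult) measurable
  also have "(\<integral>\<^sup>+v. (\<integral>\<^sup>+t. ?g (t + v) \<partial>erl (N - 1 + k)) \<partial>erl K) = (\<integral>\<^sup>+s. ?g s \<partial>erl (N - 1 + k + K + 1))"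
    by (rule nn_integral_erl_add[where f = ?g]) measurable
  also have "N - 1 + k + K + 1 = ?m + k" using N by simp
  also have "ennreal (fact (N - 1 + k) / fact (N - 1)) * (\<integral>\<^sup>+s. ?g s \<partial>erl (?m + k)) =
      ennreal (pochhammer (real N) k / pochhammer (real (N + K + 1)) k)"
  proof -
    have "pochhammer (real N) k = fact (N - 1 + k) / fact (N - 1)"
      using N pochhammer_of_nat_fact[of N k, where ?'a = real] by simp
    moreover have "pochhammer (real (N + K + 1)) k = fact (?m + k) / fact ?m"
      using pochhammer_of_nat_fact[of "N + K + 1" k, where ?'a = real] by simp
    ultimately show ?thesis
      unfolding g by (simp add: ennreal_mult[symmetric])
  qed
  finally show ?thesis .
qed


lemma exp_partial_sum_bound: "norm (\<Sum>i<n. z ^ i / fact i) \<le> exp (norm z)" for z :: complex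
proof -
  have e: "(\<lambda>i. norm z ^ i / fact i) sums exp (norm z)"
    using exp_converges[of "norm z"] by (simp add: divide_inverse mult.commute)
  have "norm (\<Sum>i<n. z ^ i / fact i) \<le> (\<Sum>i<n. norm z ^ i / fact i)"
    by (rule order_trans[OF norm_sum]) (simp add: norm_divide norm_power)
  also have "\<dots> \<le> (\<Sum>i. norm z ^ i / fact i)"
    using e by (intro sum_le_suminf) (auto simp: sums_iff)
  also have "\<dots> = exp (norm z)" using e by (simp add: sums_iff)
  finally show ?thesis .
qed

lemma AE_erl_ratio: "AE p in erl K \<Otimes>\<^sub>M erl L. 0 < fst p \<and> 0 < snd p"
proof -
  interpret pair_prob_space "erl K" "erl L" ..
  show ?thesis
  proof (rule AE_pair_measure)
    show "AE x in erl K. AE y in erl L. 0 < fst (x, y) \<and> 0 < snd (x, y)"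
      using AE_erl_pos[of K] by eventually_elim (use AE_erl_pos[of L] in auto)
  qed measurable
qed

lemma ratio_bounds: "0 < t \<Longrightarrow> 0 < v \<Longrightarrow> 0 \<le> t / (t + v) \<and> t / (t + v) \<le> (1::real)"
  by (simp add: field_simps)

lemma norm_exp_ratio_le:
  assumes "0 < t" "0 < v"
  shows "norm (exp (\<theta> * complex_of_real (t / (t + v)))) \<le> exp (norm \<theta>)"
proof -
  have "norm (exp (\<theta> * complex_of_real (t / (t + v)))) \<le> exp (norm (\<theta> * complex_of_real (t / (t + v))))"
    by (rule norm_exp)
  also have "norm (\<theta> * complex_of_real (t / (t + v))) \<le> norm \<theta>"
    using ratio_bounds[OF assms] unfolding norm_mult norm_of_real by (intro mult_left_le) (simp_all only: abs_of_nonneg norm_ge_zero)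
  finally show ?thesis by simp
qed

text \<open>The ratio lies in the unit interval almost surely, so the partial sums of the
  exponential are dominated by the constant \<open>exp (norm \<theta>)\<close>. Their integrals are
  the partial sums of the series defining \<open>hyp1F1\<close>, whose convergence is thereby
  obtained as well.\<close>

lemma integral_exp_erl_ratio:
  assumes N: "1 \<le> N"
  shows "(\<integral>v. (\<integral>t. exp (\<theta> * complex_of_real (t / (t + v))) \<partial>erl (N - 1)) \<partial>erl K)
    = hyp1F1 (of_nat N) (of_nat (N + K + 1)) \<theta>"
proof -
  interpret pair_prob_space "erl K" "erl (N - 1)" ..
  let ?P = "erl K \<Otimes>\<^sub>M erl (N - 1)"
  let ?B = "\<lambda>p::real \<times> real. snd p / (snd p + fst p)"
  let ?c = "\<lambda>k. pochhammer (real N) k / pochhammer (real (N + K + 1)) k"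
  note AEP = AE_erl_ratio[of K "N - 1"]
  have B: "AE p in ?P. 0 \<le> ?B p \<and> ?B p \<le> 1"
    using AEP by eventually_elim (use ratio_bounds in auto)
  have int_exp: "integrable ?P (\<lambda>p. exp (\<theta> * complex_of_real (?B p)))"
  proof (rule Bochner_Integration.integrable_bound[where f = "\<lambda>_. exp (norm \<theta>)"])
    show "integrable ?P (\<lambda>_. exp (norm \<theta>))" by (rule P.integrable_const)
    show "AE p in ?P. norm (exp (\<theta> * complex_of_real (?B p))) \<le> norm (exp (norm \<theta>))"
      using AEP by eventually_elim (use norm_exp_ratio_le[of _ _ \<theta>] in auto)
  qed auto
  have mom: "integrable ?P (\<lambda>p. ?B p ^ k)" "(\<integral>p. ?B p ^ k \<partial>?P) = ?c k" for k
  proof -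
    have "(\<integral>\<^sup>+p. ennreal (?B p ^ k) \<partial>?P) = (\<integral>\<^sup>+v. (\<integral>\<^sup>+t. ennreal ((t / (t + v)) ^ k) \<partial>erl (N - 1)) \<partial>erl K)"
      by (subst erl.nn_integral_fst[symmetric]) auto
    also have "\<dots> = ennreal (?c k)" by (rule erl_ratio_moment[OF N])
    finally have *: "(\<integral>\<^sup>+p. ennreal (?B p ^ k) \<partial>?P) = ennreal (?c k)" .
    have nn: "AE p in ?P. 0 \<le> ?B p ^ k"
      using B by eventually_elim auto
    show "integrable ?P (\<lambda>p. ?B p ^ k)"
      by (rule integrableI_nn_integral_finite[OF _ nn *]) measurable
    have "0 \<le> ?c k"
      using N by (intro divide_nonneg_nonneg pochhammer_nonneg) auto
    then show "(\<integral>p. ?B p ^ k \<partial>?P) = ?c k"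
      by (subst integral_eq_nn_integral[OF _ nn], measurable) (simp only: * enn2real_ennreal)
  qed
  let ?s = "\<lambda>n p. \<Sum>k<n. (\<theta> * complex_of_real (?B p)) ^ k / fact k"
  have "(\<lambda>n. \<integral>p. ?s n p \<partial>?P) \<longlonglongrightarrow> (\<integral>p. exp (\<theta> * complex_of_real (?B p)) \<partial>?P)"
  proof (rule integral_dominated_convergence[where w = "\<lambda>_. exp (norm \<theta>)"])
    show "integrable ?P (\<lambda>_. exp (norm \<theta>))" by (rule P.integrable_const)
    show "AE p in ?P. (\<lambda>n. ?s n p) \<longlonglongrightarrow> exp (\<theta> * complex_of_real (?B p))"
    proof (rule AE_I2)
      have "(\<lambda>k. z ^ k / fact k) sums exp z" for z :: complex
        using exp_converges[of z] by (simp add: scaleR_conv_of_real field_simps)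
      then show "(\<lambda>n. ?s n p) \<longlonglongrightarrow> exp (\<theta> * complex_of_real (?B p))" for p
        by (simp only: sums_def)
    qed
    fix n
    show "AE p in ?P. norm (?s n p) \<le> exp (norm \<theta>)"
      using B
    proof eventually_elim
      case (elim p)
      have "norm (?s n p) \<le> exp (norm (\<theta> * complex_of_real (?B p)))"
        by (rule exp_partial_sum_bound)
      also have "norm (\<theta> * complex_of_real (?B p)) \<le> norm \<theta>"
        using elim unfolding norm_mult norm_of_real by (intro mult_left_le) (simp_all only: abs_of_nonneg norm_ge_zero)
      finally show ?case by simp
    qed
  qed auto
  moreover have "(\<integral>p. ?s n p \<partial>?P) = (\<Sum>k<n. pochhammer (of_nat N) k / pochhammer (of_nat (N + K + 1)) k * (\<theta> ^ k / fact k))" for n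
  proof -
    have "(\<integral>p. ?s n p \<partial>?P) = (\<integral>p. (\<Sum>k<n. complex_of_real (?B p ^ k) * (\<theta> ^ k / fact k)) \<partial>?P)"
    proof -
      have "(\<theta> * complex_of_real b) ^ k / fact k = complex_of_real (b ^ k) * (\<theta> ^ k / fact k)" for b k
        by (simp add: power_mult_distrib)
      then show ?thesis by (simp only:)
    qed
    also have "\<dots> = (\<Sum>k<n. (\<integral>p. complex_of_real (?B p ^ k) * (\<theta> ^ k / fact k) \<partial>?P))"
      by (intro Bochner_Integration.integral_sum integrable_mult_left integrable_of_real mom)
    also have "\<dots> = (\<Sum>k<n. complex_of_real (?c k) * (\<theta> ^ k / fact k))"
      by (simp only: integral_mult_left_zero integral_complex_of_real mom)
    also have "\<dots> = (\<Sum>k<n. pochhammer (of_nat N) k / pochhammer (of_nat (N + K + 1)) k * (\<theta> ^ k / fact k))"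
      by (simp only: of_real_divide pochhammer_of_real[symmetric] of_real_of_nat_eq)
    finally show ?thesis .
  qed
  ultimately have "(\<lambda>k. pochhammer (of_nat N) k / pochhammer (of_nat (N + K + 1)) k * (\<theta> ^ k / fact k)) sums
      (\<integral>p. exp (\<theta> * complex_of_real (?B p)) \<partial>?P)"
    by (simp only: sums_def)
  then have "hyp1F1 (of_nat N) (of_nat (N + K + 1)) \<theta> = (\<integral>p. exp (\<theta> * complex_of_real (?B p)) \<partial>?P)"
    unfolding hyp1F1_def by (rule sums_unique[symmetric])
  also have "\<dots> = (\<integral>v. (\<integral>t. exp (\<theta> * complex_of_real (t / (t + v))) \<partial>erl (N - 1)) \<partial>erl K)"
    using integral_fst'[OF int_exp] by simp
  finally show ?thesis by simp
qed

lemma AE_nce_ratio: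
  assumes "0 \<le> x"
  shows "AE p in nce m x \<Otimes>\<^sub>M erl L. 0 < fst p \<and> 0 < snd p"
proof -
  interpret n: prob_space "nce m x" by (rule prob_space_nce[OF assms])
  interpret pair_prob_space "nce m x" "erl L" ..
  show ?thesis
  proof (rule AE_pair_measure)
    show "AE x in nce m x. AE y in erl L. 0 < fst (x, y) \<and> 0 < snd (x, y)"
      using AE_nce_pos[OF assms, of m] by eventually_elim (use AE_erl_pos[of L] in auto)
  qed measurable
qed

text \<open>Given the Poisson index \<open>n\<close>, the first variable is Erlang of index
  \<open>m - 1 + n\<close>, and the previous result applies. The inner integrals are bounded by
  \<open>exp (norm \<theta>)\<close>, so the Poisson weights alone ensure summability.\<close>

lemma integral_exp_nce_ratio:
  assumes N: "1 \<le> N" and m: "1 \<le> m" and x: "0 \<le> x"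
  shows "(\<lambda>n. complex_of_real (poisson_weight x n) * hyp1F1 (of_nat N) (of_nat (n + (N + m))) \<theta>) sums
    (\<integral>p. exp (\<theta> * complex_of_real (snd p / (snd p + fst p))) \<partial>(nce m x \<Otimes>\<^sub>M erl (N - 1)))"
proof -
  interpret n: prob_space "nce m x" by (rule prob_space_nce[OF x])
  interpret pair_prob_space "nce m x" "erl (N - 1)" ..
  let ?P = "nce m x \<Otimes>\<^sub>M erl (N - 1)"
  let ?h = "\<lambda>v. (\<integral>t. exp (\<theta> * complex_of_real (t / (t + v))) \<partial>erl (N - 1))"
  have int_exp: "integrable ?P (\<lambda>p. exp (\<theta> * complex_of_real (snd p / (snd p + fst p))))"
  proof (rule Bochner_Integration.integrable_bound[where f = "\<lambda>_. exp (norm \<theta>)"])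
    show "integrable ?P (\<lambda>_. exp (norm \<theta>))" by (rule P.integrable_const)
    show "AE p in ?P. norm (exp (\<theta> * complex_of_real (snd p / (snd p + fst p)))) \<le> norm (exp (norm \<theta>))"
      using AE_nce_ratio[OF x, of m "N - 1"] by eventually_elim (use norm_exp_ratio_le[of _ _ \<theta>] in auto)
  qed auto
  have mh: "?h \<in> borel_measurable borel" by measurable
  have bound: "norm (?h v) \<le> exp (norm \<theta>)" if v: "0 < v" for v
  proof -
    have AE: "AE t in erl (N - 1). norm (exp (\<theta> * complex_of_real (t / (t + v)))) \<le> exp (norm \<theta>)"
      by (rule eventually_mono[OF AE_erl_pos]) (rule norm_exp_ratio_le[OF _ v])
    have int: "integrable (erl (N - 1)) (\<lambda>t. exp (\<theta> * complex_of_real (t / (t + v))))"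
      by (rule Bochner_Integration.integrable_bound[where f = "\<lambda>_. exp (norm \<theta>)"]) (use AE in auto)
    have "norm (?h v) \<le> (\<integral>t. norm (exp (\<theta> * complex_of_real (t / (t + v)))) \<partial>erl (N - 1))"
      by (rule integral_norm_bound)
    also have "\<dots> \<le> (\<integral>t. exp (norm \<theta>) \<partial>erl (N - 1))"
      by (rule integral_mono_AE[OF integrable_norm[OF int] _ AE]) simp
    finally show ?thesis using erl.prob_space by simp
  qed
  have AEb: "AE v in erl k. norm (?h v) \<le> exp (norm \<theta>)" for k
    using AE_erl_pos[of k] by (rule eventually_mono) (rule bound)
  have inth: "integrable (erl k) ?h" for k
    by (rule Bochner_Integration.integrable_bound[where f = "\<lambda>_. exp (norm \<theta>)"]) (use AEb mh in auto)
  have summ: "summable (\<lambda>n. poisson_weight x n * (\<integral>v. norm (?h v) \<partial>erl (m - 1 + n)))"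
  proof (rule summable_comparison_test')
    show "summable (\<lambda>n. poisson_weight x n * exp (norm \<theta>))"
      by (intro summable_mult2 sums_summable[OF poisson_weight_sums])
    fix n :: nat
    have "(\<integral>v. norm (?h v) \<partial>erl (m - 1 + n)) \<le> (\<integral>v. exp (norm \<theta>) \<partial>erl (m - 1 + n))"
      by (rule integral_mono_AE) (use inth AEb in auto)
    then show "norm (poisson_weight x n * (\<integral>v. norm (?h v) \<partial>erl (m - 1 + n))) \<le> poisson_weight x n * exp (norm \<theta>)"
      using x erl.prob_space by (simp add: abs_mult mult_left_mono)
  qed
  have "(\<lambda>n. poisson_weight x n *\<^sub>R (\<integral>v. ?h v \<partial>erl (m - 1 + n))) sums (\<integral>v. ?h v \<partial>nce m x)"
    by (rule integral_nce_sums(2)[OF x mh inth summ])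
  also have "(\<integral>v. ?h v \<partial>nce m x) = (\<integral>p. exp (\<theta> * complex_of_real (snd p / (snd p + fst p))) \<partial>?P)"
    using integral_fst'[OF int_exp] by simp
  also have "(\<lambda>n. poisson_weight x n *\<^sub>R (\<integral>v. ?h v \<partial>erl (m - 1 + n))) =
      (\<lambda>n. complex_of_real (poisson_weight x n) * hyp1F1 (of_nat N) (of_nat (n + (N + m))) \<theta>)"
  proof
    fix n
    have "N + (m - 1 + n) + 1 = n + (N + m)" using m by simp
    then show "poisson_weight x n *\<^sub>R (\<integral>v. ?h v \<partial>erl (m - 1 + n)) =
      complex_of_real (poisson_weight x n) * hyp1F1 (of_nat N) (of_nat (n + (N + m))) \<theta>"
      unfolding integral_exp_erl_ratio[OF N] by (simp only: scaleR_conv_of_real)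
  qed
  finally show ?thesis .
qed

section \<open>Distance to the span of columns\<close>

text \<open>The Gram--Schmidt recursion for the sesquilinear form on the orthogonal complement of some columns.
  Since \<open>x / 0 = 0\<close>, a column depending linearly on the others is skipped.\<close>
fun schur :: "'i set \<Rightarrow> ('j \<Rightarrow> 'i \<Rightarrow> complex) \<Rightarrow> 'j list \<Rightarrow> ('i \<Rightarrow> complex) \<Rightarrow> ('i \<Rightarrow> complex) \<Rightarrow> complex" where
  "schur I A [] y z = (\<Sum>i\<in>I. cnj (y i) * z i)"
| "schur I A (j # js) y z = schur I A js y z - schur I A js y (A j) * schur I A js (A j) z / schur I A js (A j) (A j)"

text \<open>The squared distance from \<open>z\<close> to the span of the listed columns. The
  recursion uses only arithmetic and conjugation, so joint measurability in columns and vector is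
  immediate.\<close>

definition dist2 :: "'i set \<Rightarrow> ('j \<Rightarrow> 'i \<Rightarrow> complex) \<Rightarrow> 'j list \<Rightarrow> ('i \<Rightarrow> complex) \<Rightarrow> real" where
  "dist2 I A js z = Re (schur I A js z z)"

text \<open>The component of \<open>z\<close> orthogonal to the columns, described as a relation:
  the coefficients \<open>x\<close> are left unspecified because dependent columns do not determine
  them.\<close>

definition is_resid :: "'i set \<Rightarrow> ('j \<Rightarrow> 'i \<Rightarrow> complex) \<Rightarrow> 'j set \<Rightarrow> ('i \<Rightarrow> complex) \<Rightarrow> ('i \<Rightarrow> complex) \<Rightarrow> bool" where
  "is_resid I A J z r \<longleftrightarrow> (\<exists>x. \<forall>i\<in>I. r i = z i - (\<Sum>j\<in>J. x j * A j i)) \<and>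
     (\<forall>j\<in>J. (\<Sum>i\<in>I. cnj (A j i) * r i) = 0)"

lemma sum_cnj_sq: "(\<Sum>i\<in>I. cnj (r i) * r i) = complex_of_real (\<Sum>i\<in>I. (cmod (r i))\<^sup>2)"
  unfolding of_real_sum complex_norm_square by (simp add: mult.commute)

lemma sum_cnj_commute: "(\<Sum>i\<in>I. cnj (y i) * z i) = cnj (\<Sum>i\<in>I. cnj (z i) * y i)"
  by (simp add: mult.commute)

text \<open>\<open>z\<close> and \<open>r\<close> differ by an element of the span, which is
  invisible to \<open>q\<close>.\<close>

lemma is_resid_orth:
  assumes "is_resid I A J z r" and orth: "\<forall>j\<in>J. (\<Sum>i\<in>I. cnj (A j i) * q i) = 0"
  shows "(\<Sum>i\<in>I. cnj (q i) * z i) = (\<Sum>i\<in>I. cnj (q i) * r i)"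
proof -
  from assms obtain x where x: "\<forall>i\<in>I. r i = z i - (\<Sum>j\<in>J. x j * A j i)"
    by (auto simp: is_resid_def)
  have orth': "(\<Sum>i\<in>I. cnj (q i) * A j i) = 0" if "j \<in> J" for j
    using orth that by (subst sum_cnj_commute) simp
  have "(\<Sum>i\<in>I. cnj (q i) * r i) = (\<Sum>i\<in>I. cnj (q i) * z i - (\<Sum>j\<in>J. x j * (cnj (q i) * A j i)))"
  proof (intro sum.cong refl)
    fix i assume i: "i \<in> I"
    show "cnj (q i) * r i = cnj (q i) * z i - (\<Sum>j\<in>J. x j * (cnj (q i) * A j i))"
      unfolding bspec[OF x i] by (simp add: right_diff_distrib sum_distrib_left mult.left_commute)
  qed
  also have "\<dots> = (\<Sum>i\<in>I. cnj (q i) * z i) - (\<Sum>j\<in>J. x j * (\<Sum>i\<in>I. cnj (q i) * A j i))"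
    unfolding sum_subtractf by (subst sum.swap) (simp add: sum_distrib_left)
  finally show ?thesis using orth' by simp
qed

text \<open>Each step removes from the current residual its component along \<open>p\<close>, the
  residual of the new column. If \<open>p\<close> is zero on \<open>I\<close>, the new column
  already lies in the span; division by zero gives the coefficient zero, and the step rightly
  changes nothing.\<close>

lemma schur_resid:
  assumes "finite I" "distinct js"
  shows "\<exists>R. (\<forall>z. is_resid I A (set js) z (R z)) \<and> (\<forall>y z. schur I A js y z = (\<Sum>i\<in>I. cnj (R y i) * R z i))"
  using assms(2)
proof (induction js)
  case Nil
  then show ?case by (intro exI[of _ "\<lambda>z. z"]) (auto simp: is_resid_def)
next
  case (Cons j js)
  then obtain R where R: "\<forall>z. is_resid I A (set js) z (R z)"
      "\<forall>y z. schur I A js y z = (\<Sum>i\<in>I. cnj (R y i) * R z i)" by auto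
  have j: "j \<notin> set js" using Cons by simp
  define p where "p = R (A j)"
  define N where "N = (\<Sum>i\<in>I. cnj (p i) * p i)"
  have N_real: "cnj N = N" by (simp add: N_def sum_cnj_sq)
  have p_0: "p i = 0" if "N = 0" "i \<in> I" for i
  proof -
    have "(\<Sum>i\<in>I. (cmod (p i))\<^sup>2) = 0" using that(1) unfolding N_def sum_cnj_sq by (simp only: of_real_eq_0_iff)
    then show ?thesis using that(2) assms(1) by (simp add: sum_nonneg_eq_0_iff)
  qed
  define c where "c z = (\<Sum>i\<in>I. cnj (p i) * R z i) / N" for z
  \<comment> \<open>Valid also for \<open>N = 0\<close>, when \<open>p\<close> vanishes on
    \<open>I\<close> and both sides are zero.\<close>
  have cN: "c z * N = (\<Sum>i\<in>I. cnj (p i) * R z i)" for z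
    using p_0 by (cases "N = 0") (auto simp: c_def)
  define R' where "R' z = (\<lambda>i. R z i - c z * p i)" for z
  obtain xp where xp: "\<forall>i\<in>I. p i = A j i - (\<Sum>k\<in>set js. xp k * A k i)"
    using R(1) unfolding is_resid_def p_def by blast
  have orthp: "(\<Sum>i\<in>I. cnj (A k i) * p i) = 0" if "k \<in> set js" for k
    using R(1) that unfolding is_resid_def p_def by blast
  have orthR: "(\<Sum>i\<in>I. cnj (A k i) * R z i) = 0" if "k \<in> set js" for k z
    using R(1) that unfolding is_resid_def by blast
  have pR': "(\<Sum>i\<in>I. cnj (p i) * R' z i) = 0" for z
  proof -
    have "(\<Sum>i\<in>I. cnj (p i) * R' z i) = (\<Sum>i\<in>I. cnj (p i) * R z i) - c z * N"
      by (simp add: R'_def N_def algebra_simps sum_subtractf sum_distrib_left)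
    then show ?thesis by (simp add: cN)
  qed
  have orthR': "(\<Sum>i\<in>I. cnj (A k i) * R' z i) = 0" if "k \<in> set js" for k z
  proof -
    have "(\<Sum>i\<in>I. cnj (A k i) * R' z i) = (\<Sum>i\<in>I. cnj (A k i) * R z i) - c z * (\<Sum>i\<in>I. cnj (A k i) * p i)"
      by (simp add: R'_def algebra_simps sum_subtractf sum_distrib_left)
    then show ?thesis using that by (simp add: orthp orthR)
  qed
  have "is_resid I A (set (j # js)) z (R' z)" for z
  proof -
    obtain x where x: "\<forall>i\<in>I. R z i = z i - (\<Sum>k\<in>set js. x k * A k i)"
      using R(1) unfolding is_resid_def by blast
    \<comment> \<open>Subtracting \<open>c z * p\<close> subtracts \<open>c z\<close> times column
      \<open>j\<close> and returns the earlier columns contained in \<open>p\<close>.\<close>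
    define y where "y k = (if k = j then c z else x k - c z * xp k)" for k
    have "R' z i = z i - (\<Sum>k\<in>set (j # js). y k * A k i)" if "i \<in> I" for i
    proof -
      have "(\<Sum>k\<in>set (j # js). y k * A k i) = c z * A j i + (\<Sum>k\<in>set js. (x k - c z * xp k) * A k i)"
        using j by (auto simp: y_def intro!: sum.cong)
      also have "\<dots> = c z * A j i + ((\<Sum>k\<in>set js. x k * A k i) - c z * (\<Sum>k\<in>set js. xp k * A k i))"
        by (simp add: left_diff_distrib sum_subtractf sum_distrib_left mult.assoc)
      finally show ?thesis
        using bspec[OF x that] bspec[OF xp that] by (simp only: R'_def right_diff_distrib) simp
    qed
    moreover have "(\<Sum>i\<in>I. cnj (A k i) * R' z i) = 0" if "k \<in> set (j # js)" for k
    proof (cases "k = j")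
      case False
      then show ?thesis using that orthR' by simp
    next
      case True
      have "(\<Sum>i\<in>I. cnj (R' z i) * A j i) = (\<Sum>i\<in>I. cnj (R' z i) * p i)"
        using R(1) orthR' unfolding p_def by (intro is_resid_orth[of I A "set js"]) auto
      then have "(\<Sum>i\<in>I. cnj (A j i) * R' z i) = (\<Sum>i\<in>I. cnj (p i) * R' z i)"
        by (subst (1 2) sum_cnj_commute) simp
      then show ?thesis using True by (simp add: pR')
    qed
    ultimately show ?thesis unfolding is_resid_def by blast
  qed
  moreover have "schur I A (j # js) y z = (\<Sum>i\<in>I. cnj (R' y i) * R' z i)" for y z
  proof -
    have 1: "(\<Sum>i\<in>I. cnj (R' y i) * R' z i) = (\<Sum>i\<in>I. cnj (R y i) * R' z i)"
    proof -
      have "(\<Sum>i\<in>I. cnj (R' y i) * R' z i) = (\<Sum>i\<in>I. cnj (R y i) * R' z i) - cnj (c y) * (\<Sum>i\<in>I. cnj (p i) * R' z i)"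
        by (simp add: R'_def[of y] algebra_simps sum_subtractf sum_distrib_left)
      then show ?thesis by (simp add: pR')
    qed
    also have "\<dots> = (\<Sum>i\<in>I. cnj (R y i) * R z i) - (\<Sum>i\<in>I. cnj (R y i) * p i) * c z"
      by (simp add: R'_def algebra_simps sum_subtractf sum_distrib_left)
    also have "\<dots> = schur I A (j # js) y z"
      by (simp add: R(2) c_def N_def flip: p_def)
    finally show ?thesis by simp
  qed
  ultimately show ?case by blast
qed

text \<open>Two residuals of one vector have the same norm, since against any residual either may be
  exchanged for \<open>z\<close>. Every geometric property of \<open>dist2\<close> below is
  therefore proved by exhibiting a single residual.\<close>

lemma dist2_eqI:
  assumes "finite I" "distinct js" and r: "is_resid I A (set js) z r"
  shows "dist2 I A js z = (\<Sum>i\<in>I. (cmod (r i))\<^sup>2)"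
proof -
  obtain R where R: "\<forall>z. is_resid I A (set js) z (R z)" "\<forall>y z. schur I A js y z = (\<Sum>i\<in>I. cnj (R y i) * R z i)"
    using schur_resid[OF assms(1,2), of A] by blast
  have Rz: "is_resid I A (set js) z (R z)" using R(1) by blast
  have o: "\<forall>j\<in>set js. (\<Sum>i\<in>I. cnj (A j i) * r i) = 0" "\<forall>j\<in>set js. (\<Sum>i\<in>I. cnj (A j i) * R z i) = 0"
    using r Rz by (auto simp: is_resid_def)
  have "(\<Sum>i\<in>I. cnj (R z i) * R z i) = (\<Sum>i\<in>I. cnj (R z i) * z i)"
    using is_resid_orth[OF Rz o(2)] by simp
  also have "\<dots> = (\<Sum>i\<in>I. cnj (R z i) * r i)"
    using is_resid_orth[OF r o(2)] by simp
  also have "\<dots> = cnj (\<Sum>i\<in>I. cnj (r i) * R z i)"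
    by (rule sum_cnj_commute)
  also have "(\<Sum>i\<in>I. cnj (r i) * R z i) = (\<Sum>i\<in>I. cnj (r i) * r i)"
    using is_resid_orth[OF r o(1)] is_resid_orth[OF Rz o(1)] by simp
  finally have "schur I A js z z = cnj (\<Sum>i\<in>I. cnj (r i) * r i)" using R(2) by simp
  then show ?thesis unfolding sum_cnj_sq dist2_def by (simp only: complex_cnj_complex_of_real Re_complex_of_real)
qed

lemma is_resid_exists:
  assumes "finite I" "distinct js"
  obtains r where "is_resid I A (set js) z r"
  using schur_resid[OF assms, of A] that by blast

lemma dist2_nonneg:
  assumes "finite I" "distinct js"
  shows "0 \<le> dist2 I A js z"
proof -
  obtain r where "is_resid I A (set js) z r" by (rule is_resid_exists[OF assms])
  then show ?thesis using dist2_eqI[OF assms] by (simp add: sum_nonneg)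
qed

text \<open>Pythagoras: the squared norm of \<open>z - r\<close> is the difference of the squared
  norms of \<open>z\<close> and \<open>r\<close>.\<close>

lemma dist2_le:
  assumes "finite I" "distinct js"
  shows "dist2 I A js z \<le> (\<Sum>i\<in>I. (cmod (z i))\<^sup>2)"
proof -
  obtain r where r: "is_resid I A (set js) z r" by (rule is_resid_exists[OF assms])
  then obtain x where x: "\<forall>i\<in>I. r i = z i - (\<Sum>j\<in>set js. x j * A j i)" and
    o: "\<forall>j\<in>set js. (\<Sum>i\<in>I. cnj (A j i) * r i) = 0" unfolding is_resid_def by blast
  have zr: "(\<Sum>i\<in>I. cnj (r i) * z i) = (\<Sum>i\<in>I. cnj (r i) * r i)" by (rule is_resid_orth[OF r o])
  have "complex_of_real (\<Sum>i\<in>I. (cmod (z i - r i))\<^sup>2) = (\<Sum>i\<in>I. cnj (z i - r i) * (z i - r i))"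
    by (rule sum_cnj_sq[symmetric])
  also have "\<dots> = (\<Sum>i\<in>I. cnj (z i) * z i) - (\<Sum>i\<in>I. cnj (z i) * r i) - (\<Sum>i\<in>I. cnj (r i) * z i) + (\<Sum>i\<in>I. cnj (r i) * r i)"
    by (simp add: algebra_simps sum.distrib sum_subtractf)
  also have "(\<Sum>i\<in>I. cnj (z i) * r i) = (\<Sum>i\<in>I. cnj (r i) * r i)"
    by (subst sum_cnj_commute) (simp only: zr sum_cnj_sq complex_cnj_complex_of_real)
  finally have "complex_of_real (\<Sum>i\<in>I. (cmod (z i - r i))\<^sup>2) = complex_of_real ((\<Sum>i\<in>I. (cmod (z i))\<^sup>2) - (\<Sum>i\<in>I. (cmod (r i))\<^sup>2))"
    unfolding zr by (simp add: sum_cnj_sq)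
  then have "(\<Sum>i\<in>I. (cmod (z i - r i))\<^sup>2) = (\<Sum>i\<in>I. (cmod (z i))\<^sup>2) - (\<Sum>i\<in>I. (cmod (r i))\<^sup>2)"
    by (simp only: of_real_eq_iff)
  moreover have "0 \<le> (\<Sum>i\<in>I. (cmod (z i - r i))\<^sup>2)" by (simp add: sum_nonneg)
  ultimately show ?thesis using dist2_eqI[OF assms r] by simp
qed

lemma dist2_cong:
  assumes "finite I" "distinct js" "\<And>j i. j \<in> set js \<Longrightarrow> i \<in> I \<Longrightarrow> A j i = B j i" "\<And>i. i \<in> I \<Longrightarrow> y i = z i"
  shows "dist2 I A js y = dist2 I B js z"
proof -
  obtain r where r: "is_resid I A (set js) y r" by (rule is_resid_exists[OF assms(1,2)])
  have "is_resid I A (set js) y r \<longleftrightarrow> is_resid I B (set js) z r"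
    unfolding is_resid_def using assms(3,4) by (simp cong: sum.cong)
  then show ?thesis using dist2_eqI[OF assms(1,2)] r by metis
qed

lemma dist2_scale:
  assumes "finite I" "distinct js"
  shows "dist2 I A js (\<lambda>i. c * z i) = (cmod c)\<^sup>2 * dist2 I A js z"
proof -
  obtain r where r: "is_resid I A (set js) z r" by (rule is_resid_exists[OF assms])
  then obtain x where x: "\<forall>i\<in>I. r i = z i - (\<Sum>j\<in>set js. x j * A j i)" and
    o: "\<forall>j\<in>set js. (\<Sum>i\<in>I. cnj (A j i) * r i) = 0" unfolding is_resid_def by blast
  have "(\<Sum>i\<in>I. cnj (A j i) * (c * r i)) = c * (\<Sum>i\<in>I. cnj (A j i) * r i)" for j
    by (simp add: sum_distrib_left mult_ac)
  then have "is_resid I A (set js) (\<lambda>i. c * z i) (\<lambda>i. c * r i)"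
    unfolding is_resid_def
  proof (intro conjI exI[of _ "\<lambda>j. c * x j"] ballI)
    fix i assume i: "i \<in> I"
    show "c * r i = c * z i - (\<Sum>j\<in>set js. c * x j * A j i)"
      unfolding bspec[OF x i] by (simp add: right_diff_distrib sum_distrib_left mult.assoc)
  qed (use o in simp)
  from dist2_eqI[OF assms this] dist2_eqI[OF assms r] show ?thesis
    by (simp add: norm_mult power_mult_distrib sum_distrib_left)
qed

lemma dist2_rot:
  assumes "finite I" "distinct js" and T: "rot I T"
  shows "dist2 I (\<lambda>j. T (A j)) js (T z) = dist2 I A js z"
proof -
  obtain r where r: "is_resid I A (set js) z r" by (rule is_resid_exists[OF assms(1,2)])
  then obtain x where x: "\<forall>i\<in>I. r i = z i - (\<Sum>j\<in>set js. x j * A j i)" and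
    o: "\<forall>j\<in>set js. (\<Sum>i\<in>I. cnj (A j i) * r i) = 0" unfolding is_resid_def by blast
  have "\<forall>i\<in>I. T r i = T (\<lambda>i. z i - (\<Sum>j\<in>set js. x j * A j i)) i"
    by (rule rot_cong[OF T x])
  then have "is_resid I (\<lambda>j. T (A j)) (set js) (T z) (T r)"
    unfolding is_resid_def
  proof (intro conjI exI[of _ x] ballI)
    fix j assume "j \<in> set js"
    then show "(\<Sum>i\<in>I. cnj (T (A j) i) * T r i) = 0"
      using o by (simp add: rot_inner[OF T assms(1)])
  qed (simp add: rot_diff[OF T] rot_sum[OF T])
  from dist2_eqI[OF assms(1,2) this] dist2_eqI[OF assms(1,2) r] show ?thesis
    by (simp add: rot_norm[OF T assms(1)])
qed

text \<open>Orthogonality to a family is orthogonality to its span, so one residual serves both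
  families. Both a change of the spanning columns and a shift of the vector within the span are
  covered.\<close>

lemma dist2_span:
  assumes I: "finite I" and js: "distinct js" and ks: "distinct ks"
    and AB: "\<And>j. j \<in> set js \<Longrightarrow> \<exists>x. \<forall>i\<in>I. A j i = (\<Sum>k\<in>set ks. x k * B k i)"
    and BA: "\<And>k. k \<in> set ks \<Longrightarrow> \<exists>x. \<forall>i\<in>I. B k i = (\<Sum>j\<in>set js. x j * A j i)"
    and yz: "\<exists>x. \<forall>i\<in>I. y i = z i + (\<Sum>j\<in>set js. x j * A j i)"
  shows "dist2 I A js y = dist2 I B ks z"
proof -
  obtain r where r: "is_resid I A (set js) y r" by (rule is_resid_exists[OF I js])
  then obtain x where x: "\<forall>i\<in>I. r i = y i - (\<Sum>j\<in>set js. x j * A j i)" and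
    o: "\<forall>j\<in>set js. (\<Sum>i\<in>I. cnj (A j i) * r i) = 0" unfolding is_resid_def by blast
  obtain c where c: "\<And>j i. j \<in> set js \<Longrightarrow> i \<in> I \<Longrightarrow> A j i = (\<Sum>k\<in>set ks. c j k * B k i)"
    using AB by metis
  obtain d where d: "\<And>k i. k \<in> set ks \<Longrightarrow> i \<in> I \<Longrightarrow> B k i = (\<Sum>j\<in>set js. d k j * A j i)"
    using BA by metis
  obtain w where w: "\<forall>i\<in>I. y i = z i + (\<Sum>j\<in>set js. w j * A j i)" using yz by blast
  \<comment> \<open>From \<open>r = y - x A\<close> and \<open>y = z + w A\<close> one has
    \<open>r = z - (x - w) A\<close>; the coefficients \<open>x - w\<close> are then rewritten in
    terms of \<open>B\<close> by means of \<open>c\<close>.\<close>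
  have "is_resid I B (set ks) z r"
    unfolding is_resid_def
  proof (intro conjI exI[of _ "\<lambda>k. \<Sum>j\<in>set js. (x j - w j) * c j k"] ballI)
    fix i assume i: "i \<in> I"
    have "(\<Sum>k\<in>set ks. (\<Sum>j\<in>set js. (x j - w j) * c j k) * B k i) = (\<Sum>k\<in>set ks. \<Sum>j\<in>set js. (x j - w j) * (c j k * B k i))"
      by (simp add: sum_distrib_right mult.assoc)
    also have "\<dots> = (\<Sum>j\<in>set js. \<Sum>k\<in>set ks. (x j - w j) * (c j k * B k i))"
      by (rule sum.swap)
    also have "\<dots> = (\<Sum>j\<in>set js. (x j - w j) * A j i)"
      using i by (intro sum.cong refl) (simp add: c sum_distrib_left)
    finally have "(\<Sum>k\<in>set ks. (\<Sum>j\<in>set js. (x j - w j) * c j k) * B k i) = (\<Sum>j\<in>set js. (x j - w j) * A j i)" .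
    then show "r i = z i - (\<Sum>k\<in>set ks. (\<Sum>j\<in>set js. (x j - w j) * c j k) * B k i)"
      using bspec[OF x i] bspec[OF w i] by (simp only: left_diff_distrib sum_subtractf) simp
  next
    fix k assume k: "k \<in> set ks"
    have "(\<Sum>i\<in>I. cnj (B k i) * r i) = (\<Sum>i\<in>I. (\<Sum>j\<in>set js. cnj (d k j) * (cnj (A j i) * r i)))"
      using d[OF k] by (intro sum.cong refl) (simp add: sum_distrib_right mult.assoc)
    also have "\<dots> = (\<Sum>j\<in>set js. cnj (d k j) * (\<Sum>i\<in>I. cnj (A j i) * r i))"
      by (subst sum.swap) (simp add: sum_distrib_left)
    also have "\<dots> = 0" using o by simp
    finally show "(\<Sum>i\<in>I. cnj (B k i) * r i) = 0" .
  qed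
  from dist2_eqI[OF I ks this] dist2_eqI[OF I js r] show ?thesis by simp
qed

section \<open>Linear independence, elimination of a coordinate, measurability\<close>

definition indep_cols :: "'i set \<Rightarrow> ('j \<Rightarrow> 'i \<Rightarrow> complex) \<Rightarrow> 'j set \<Rightarrow> bool" where
  "indep_cols I A J \<longleftrightarrow> (\<forall>x. (\<forall>i\<in>I. (\<Sum>j\<in>J. x j * A j i) = 0) \<longrightarrow> (\<forall>j\<in>J. x j = 0))"

lemma indep_cols_cong:
  assumes "\<And>j i. j \<in> J \<Longrightarrow> i \<in> I \<Longrightarrow> A j i = B j i"
  shows "indep_cols I A J \<longleftrightarrow> indep_cols I B J"
proof -
  have "(\<Sum>j\<in>J. x j * A j i) = (\<Sum>j\<in>J. x j * B j i)" if "i \<in> I" for x i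
    using assms that by (intro sum.cong) auto
  then show ?thesis by (simp add: indep_cols_def)
qed

text \<open>A relation with \<open>x j\<close> nonzero would put column \<open>j\<close> into the
  span of the others; the zero vector would then be its residual and its distance zero.\<close>

lemma indep_cols_insert:
  assumes I: "finite I" and js: "distinct (j # js)"
    and ind: "indep_cols I A (set js)" and D: "dist2 I A js (A j) \<noteq> 0"
  shows "indep_cols I A (set (j # js))"
  unfolding indep_cols_def
proof (intro allI impI)
  fix x assume x: "\<forall>i\<in>I. (\<Sum>k\<in>set (j # js). x k * A k i) = 0"
  have xs: "\<forall>i\<in>I. x j * A j i + (\<Sum>k\<in>set js. x k * A k i) = 0" using x js by simp
  have "x j = 0"
  proof (rule ccontr)
    assume xj: "x j \<noteq> 0"
    have "0 = A j i - (\<Sum>k\<in>set js. (- x k / x j) * A k i)" if "i \<in> I" for i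
    proof -
      have "x j * A j i = - (\<Sum>k\<in>set js. x k * A k i)" using xs that by (simp add: eq_neg_iff_add_eq_0)
      then have "A j i = - (\<Sum>k\<in>set js. x k * A k i) / x j" using xj by (simp add: field_simps)
      then show ?thesis by (simp add: sum_divide_distrib sum_negf)
    qed
    then have "is_resid I A (set js) (A j) (\<lambda>i. 0)"
      unfolding is_resid_def by (auto intro!: exI[of _ "\<lambda>k. - x k / x j"])
    from dist2_eqI[OF I _ this] js D show False by simp
  qed
  moreover from this xs ind have "\<forall>k\<in>set js. x k = 0" unfolding indep_cols_def by simp
  ultimately show "\<forall>k\<in>set (j # js). x k = 0" by simp
qed

text \<open>Column \<open>j\<close> is a nonzero multiple of a coordinate vector, so projecting it
  away amounts to forgetting coordinate \<open>l\<close>.\<close>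

lemma dist2_remove:
  assumes I: "finite I" "l \<in> I" and js: "distinct (j # js)"
    and Aj: "\<forall>i\<in>I - {l}. A j i = 0" "A j l \<noteq> 0"
  shows "dist2 I A (j # js) z = dist2 (I - {l}) A js z"
proof -
  have fI: "finite (I - {l})" and djs: "distinct js" using I js by auto
  obtain r where r: "is_resid (I - {l}) A (set js) z r" by (rule is_resid_exists[OF fI djs])
  then obtain x where x: "\<forall>i\<in>I - {l}. r i = z i - (\<Sum>k\<in>set js. x k * A k i)" and
    o: "\<forall>k\<in>set js. (\<Sum>i\<in>I - {l}. cnj (A k i) * r i) = 0" unfolding is_resid_def by blast
  define r' where "r' = r(l := 0)"
  \<comment> \<open>The coefficient of column \<open>j\<close> is the one that annihilates
    coordinate \<open>l\<close>.\<close>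
  define x' where "x' = x(j := (z l - (\<Sum>k\<in>set js. x k * A k l)) / A j l)"
  have sum': "(\<Sum>i\<in>I. h i) = h l + (\<Sum>i\<in>I - {l}. h i)" for h :: "'a \<Rightarrow> complex"
    using I by (simp add: sum.remove)
  have sumr: "(\<Sum>i\<in>I. h i * r' i) = (\<Sum>i\<in>I - {l}. h i * r i)" for h :: "'a \<Rightarrow> complex"
    unfolding sum' by (simp add: r'_def)
  have "r' i = z i - (\<Sum>k\<in>set (j # js). x' k * A k i)" if "i \<in> I" for i
  proof -
    have "(\<Sum>k\<in>set js. x' k * A k i) = (\<Sum>k\<in>set js. x k * A k i)"
      using js by (intro sum.cong) (auto simp: x'_def)
    then have "(\<Sum>k\<in>set (j # js). x' k * A k i) = x' j * A j i + (\<Sum>k\<in>set js. x k * A k i)"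
      using js by simp
    then show ?thesis using x Aj that by (auto simp: x'_def r'_def)
  qed
  moreover have "(\<Sum>i\<in>I. cnj (A k i) * r' i) = 0" if "k \<in> set (j # js)" for k
    unfolding sumr using that o Aj by auto
  ultimately have "is_resid I A (set (j # js)) z r'" unfolding is_resid_def by blast
  from dist2_eqI[OF I(1) js this] have "dist2 I A (j # js) z = (\<Sum>i\<in>I. (cmod (r' i))\<^sup>2)" .
  also have "\<dots> = (\<Sum>i\<in>I - {l}. (cmod (r' i))\<^sup>2)"
    using I by (subst sum.remove[of I l]) (auto simp: r'_def)
  also have "\<dots> = (\<Sum>i\<in>I - {l}. (cmod (r i))\<^sup>2)"
    by (intro sum.cong) (auto simp: r'_def)
  also have "\<dots> = dist2 (I - {l}) A js z" by (rule dist2_eqI[OF fI djs r, symmetric])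
  finally show ?thesis .
qed

lemma indep_cols_remove:
  assumes l: "l \<in> I" and js: "distinct (j # js)"
    and Aj: "\<forall>i\<in>I - {l}. A j i = 0" "A j l \<noteq> 0" and ind: "indep_cols I A (set (j # js))"
  shows "indep_cols (I - {l}) A (set js)"
  unfolding indep_cols_def
proof (intro allI impI)
  fix x assume x: "\<forall>i\<in>I - {l}. (\<Sum>k\<in>set js. x k * A k i) = 0"
  define x' where "x' = x(j := - (\<Sum>k\<in>set js. x k * A k l) / A j l)"
  have "(\<Sum>k\<in>set (j # js). x' k * A k i) = 0" if "i \<in> I" for i
  proof -
    have "(\<Sum>k\<in>set js. x' k * A k i) = (\<Sum>k\<in>set js. x k * A k i)"
      using js by (intro sum.cong) (auto simp: x'_def)
    then have "(\<Sum>k\<in>set (j # js). x' k * A k i) = x' j * A j i + (\<Sum>k\<in>set js. x k * A k i)"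
      using js by simp
    also have "x' j * A j i + (\<Sum>k\<in>set js. x k * A k i) = 0"
      using x Aj that by (cases "i = l") (auto simp: x'_def)
    finally show ?thesis .
  qed
  then have "\<forall>k\<in>set (j # js). x' k = 0" using ind unfolding indep_cols_def by blast
  then show "\<forall>k\<in>set js. x k = 0" using js by (auto simp: x'_def split: if_splits)
qed

lemma indep_cols_rot:
  assumes I: "finite I" and T: "rot I T" and ind: "indep_cols I A J"
  shows "indep_cols I (\<lambda>j. T (A j)) J"
  unfolding indep_cols_def
proof (intro allI impI)
  fix x assume x: "\<forall>i\<in>I. (\<Sum>j\<in>J. x j * T (A j) i) = 0"
  let ?s = "\<lambda>i. \<Sum>j\<in>J. x j * A j i"
  have "(\<Sum>i\<in>I. (cmod (?s i))\<^sup>2) = (\<Sum>i\<in>I. (cmod (T ?s i))\<^sup>2)"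
    by (rule rot_norm[OF T I, symmetric])
  also have "\<dots> = 0" using x by (simp add: rot_sum[OF T])
  finally have "\<forall>i\<in>I. ?s i = 0" using I by (simp add: sum_nonneg_eq_0_iff)
  then show "\<forall>j\<in>J. x j = 0" using ind unfolding indep_cols_def by blast
qed

lemma measurable_schur:
  assumes "\<And>j i. j \<in> set js \<Longrightarrow> i \<in> I \<Longrightarrow> (\<lambda>w. A w j i) \<in> borel_measurable M"
    and "\<And>i. i \<in> I \<Longrightarrow> (\<lambda>w. y w i) \<in> borel_measurable M" and "\<And>i. i \<in> I \<Longrightarrow> (\<lambda>w. z w i) \<in> borel_measurable M"
  shows "(\<lambda>w. schur I (A w) js (y w) (z w)) \<in> borel_measurable M"
  using assms
proof (induction js arbitrary: y z)
  case Nil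
  have "(\<lambda>w. cnj (y w i) * z w i) \<in> borel_measurable M" if "i \<in> I" for i
    using measurable_compose[OF Nil(2)[OF that], of cnj borel] Nil(3)[OF that]
    by (intro borel_measurable_times) (auto intro: borel_measurable_continuous_onI continuous_intros)
  then show ?case by (simp add: borel_measurable_sum)
next
  case (Cons j js)
  have m: "(\<lambda>w. schur I (A w) js (y w) (z w)) \<in> borel_measurable M"
    if "\<And>i. i \<in> I \<Longrightarrow> (\<lambda>w. y w i) \<in> borel_measurable M" "\<And>i. i \<in> I \<Longrightarrow> (\<lambda>w. z w i) \<in> borel_measurable M" for y z
    using Cons.prems(1) by (intro Cons.IH that) auto
  show ?case
    unfolding schur.simps
    by (intro borel_measurable_diff borel_measurable_divide borel_measurable_times m) (use Cons.prems in auto)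
qed

lemma measurable_dist2:
  assumes "\<And>j i. j \<in> set js \<Longrightarrow> i \<in> I \<Longrightarrow> (\<lambda>w. A w j i) \<in> borel_measurable M"
    and "\<And>i. i \<in> I \<Longrightarrow> (\<lambda>w. z w i) \<in> borel_measurable M"
  shows "(\<lambda>w. dist2 I (A w) js (z w)) \<in> borel_measurable M"
proof -
  have "(\<lambda>w. schur I (A w) js (z w) (z w)) \<in> borel_measurable M"
    by (rule measurable_schur) (use assms in auto)
  then show ?thesis unfolding dist2_def by measurable
qed

section \<open>Distance from a Gaussian vector to a span\<close>

lemma measure_eqI_nn_integral:
  assumes sets: "sets A = sets B"
    and eq: "\<And>f. f \<in> borel_measurable A \<Longrightarrow> (\<integral>\<^sup>+x. f x \<partial>A) = (\<integral>\<^sup>+x. f x \<partial>B)"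
  shows "A = B"
proof (rule measure_eqI[OF sets])
  fix X assume X: "X \<in> sets A"
  then show "emeasure A X = emeasure B X"
    using eq[of "indicator X"] sets by simp
qed

lemma distr_cgauss_vec_restrict:
  assumes "K \<subseteq> I"
  shows "distr (cgauss_vec I) (cgauss_vec K) (\<lambda>z. restrict z K) = cgauss_vec K"
  using distr_PiM_reindex[of I "\<lambda>_. cgauss" "\<lambda>x. x" K] prob_space_cgauss assms by (auto simp: restrict_def)

lemma measurable_cgauss_vec_split:
  assumes "\<phi> ` K \<subseteq> X" "L \<subseteq> X"
  shows "(\<lambda>z. (restrict z L, \<lambda>k\<in>K. z (\<phi> k))) \<in> cgauss_vec X \<rightarrow>\<^sub>M cgauss_vec L \<Otimes>\<^sub>M cgauss_vec K"
proof (rule measurable_Pair)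
  show "(\<lambda>z. restrict z L) \<in> cgauss_vec X \<rightarrow>\<^sub>M cgauss_vec L"
    using assms by (intro measurable_restrict_subset)
  show "(\<lambda>z. \<lambda>k\<in>K. z (\<phi> k)) \<in> cgauss_vec X \<rightarrow>\<^sub>M cgauss_vec K"
    using assms by (intro measurable_restrict measurable_component_singleton) auto
qed

text \<open>Independence of disjoint groups of coordinates. The reindexing \<phi> turns one row or
  column of a matrix into a vector with its own index set, so that the laws of Gaussian vectors
  apply to it.\<close>

lemma distr_cgauss_vec_split:
  assumes fin: "finite K" "finite L" and inj: "inj_on \<phi> K" and disj: "\<phi> ` K \<inter> L = {}" and X: "X = \<phi> ` K \<union> L"
  shows "distr (cgauss_vec X) (cgauss_vec L \<Otimes>\<^sub>M cgauss_vec K) (\<lambda>z. (restrict z L, \<lambda>k\<in>K. z (\<phi> k)))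
    = cgauss_vec L \<Otimes>\<^sub>M cgauss_vec K"
proof -
  let ?A = "\<phi> ` K"
  let ?h = "\<lambda>z. \<lambda>k\<in>K. z (\<phi> k)"
  have X': "X = L \<union> ?A" using X by auto
  have hm: "?h \<in> cgauss_vec ?A \<rightarrow>\<^sub>M cgauss_vec K"
    by (intro measurable_restrict measurable_component_singleton) auto
  have h: "distr (cgauss_vec ?A) (cgauss_vec K) ?h = cgauss_vec K"
    using distr_PiM_reindex[of ?A "\<lambda>_. cgauss" \<phi> K] prob_space_cgauss inj by auto
  have "distr (cgauss_vec X) (cgauss_vec L \<Otimes>\<^sub>M cgauss_vec K) (\<lambda>z. (restrict z L, ?h z))
    = distr (distr (cgauss_vec L \<Otimes>\<^sub>M cgauss_vec ?A) (cgauss_vec X) (merge L ?A)) (cgauss_vec L \<Otimes>\<^sub>M cgauss_vec K) (\<lambda>z. (restrict z L, ?h z))"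
    unfolding X' using disj fin by (subst cgauss_prod.distr_merge) auto
  also have "\<dots> = distr (cgauss_vec L \<Otimes>\<^sub>M cgauss_vec ?A) (cgauss_vec L \<Otimes>\<^sub>M cgauss_vec K) (\<lambda>p. (restrict (merge L ?A p) L, ?h (merge L ?A p)))"
    by (subst distr_distr[OF measurable_cgauss_vec_split]) (auto simp: X' comp_def)
  also have "\<dots> = distr (cgauss_vec L \<Otimes>\<^sub>M cgauss_vec ?A) (cgauss_vec L \<Otimes>\<^sub>M cgauss_vec K) (\<lambda>(x, y). (x, ?h y))"
  proof (intro distr_cong refl)
    fix p assume "p \<in> space (cgauss_vec L \<Otimes>\<^sub>M cgauss_vec ?A)"
    then obtain x y where p: "p = (x, y)" "x \<in> space (cgauss_vec L)" by (auto simp: space_pair_measure)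
    have "restrict (merge L ?A p) L = x"
      using p by (auto simp: space_PiM PiE_def extensional_def merge_def restrict_def fun_eq_iff)
    moreover have "?h (merge L ?A p) = ?h y"
      using p disj by (auto simp: merge_def restrict_def fun_eq_iff)
    ultimately show "(restrict (merge L ?A p) L, ?h (merge L ?A p)) = (case p of (x, y) \<Rightarrow> (x, ?h y))"
      using p by simp
  qed
  also have "\<dots> = distr (cgauss_vec L) (cgauss_vec L) (\<lambda>x. x) \<Otimes>\<^sub>M distr (cgauss_vec ?A) (cgauss_vec K) ?h"
  proof (rule pair_measure_distr[symmetric, OF _ hm])
    show "sigma_finite_measure (distr (cgauss_vec ?A) (cgauss_vec K) ?h)"
      unfolding h using prob_space_cgauss_vec prob_space_imp_sigma_finite by blast
  qed simp
  finally show ?thesis unfolding h by (simp add: distr_id)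
qed

text \<open>A rotation makes the first listed column a multiple of a coordinate vector; dropping
  that coordinate costs one column and one dimension. After all columns are used up, the squared
  norm of a Gaussian vector remains, and its mean has been projected along the way.\<close>

lemma distr_dist2:
  assumes "finite I" "distinct js" "length js < card I" "indep_cols I A (set js)"
  shows "distr (cgauss_vec I) borel (\<lambda>z. dist2 I A js (\<lambda>i. z i + \<alpha> i)) = nce (card I - length js) (dist2 I A js \<alpha>)"
  using assms
proof (induction js arbitrary: I A \<alpha>)
  case Nil
  have d: "dist2 I A [] z = (\<Sum>i\<in>I. (cmod (z i))\<^sup>2)" for z
    by (simp add: dist2_def sum_cnj_sq)
  have "I \<noteq> {}" using Nil by auto
  then show ?case unfolding d using distr_cgauss_vec_sqnorm[of I \<alpha>] Nil by simp
next
  case (Cons j js)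
  have "card I > 0" using Cons.prems by simp
  then obtain l where l: "l \<in> I" by (metis card_gt_0_iff ex_in_conv)
  obtain T where T: "rot I T" "\<forall>k\<in>I - {l}. T (A j) k = 0" by (rule rot_exists[OF Cons.prems(1) l])
  define B where "B k = T (A k)" for k
  have indB: "indep_cols I B (set (j # js))"
    unfolding B_def by (rule indep_cols_rot[OF Cons.prems(1) T(1) Cons.prems(4)])
  have Bj: "\<forall>i\<in>I - {l}. B j i = 0" using T(2) by (simp add: B_def)
  \<comment> \<open>Otherwise the whole column would vanish on \<open>I\<close>, against
    independence.\<close>
  have Bjl: "B j l \<noteq> 0"
  proof
    assume 0: "B j l = 0"
    have "(\<Sum>k\<in>set (j # js). (if k = j then 1 else 0) * B k i) = 0" if "i \<in> I" for i
    proof -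
      have "(\<Sum>k\<in>set (j # js). (if k = j then 1 else 0) * B k i) = B j i"
        by (subst sum.remove[of _ j]) (auto intro!: sum.neutral)
      then show ?thesis using 0 Bj that by (cases "i = l") auto
    qed
    moreover have "(\<forall>i\<in>I. (\<Sum>k\<in>set (j # js). (if k = j then 1 else 0) * B k i) = 0) \<longrightarrow>
        (\<forall>k\<in>set (j # js). (if k = j then 1 else 0 :: complex) = 0)"
      using indB unfolding indep_cols_def by (rule spec)
    ultimately have "\<forall>k\<in>set (j # js). (if k = j then 1 else 0 :: complex) = 0" by blast
    from bspec[OF this, of j] show False by simp
  qed
  let ?F = "\<lambda>y. dist2 (I - {l}) B js (\<lambda>i. y i + T \<alpha> i)"
  have eq: "dist2 I A (j # js) (\<lambda>i. z i + \<alpha> i) = ?F (T z)" for z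
  proof -
    have "dist2 I A (j # js) (\<lambda>i. z i + \<alpha> i) = dist2 I B (j # js) (T (\<lambda>i. z i + \<alpha> i))"
      unfolding B_def by (rule dist2_rot[symmetric, OF Cons.prems(1,2) T(1)])
    also have "\<dots> = dist2 (I - {l}) B js (T (\<lambda>i. z i + \<alpha> i))"
      by (rule dist2_remove[where A = B and j = j and I = I and l = l, OF Cons.prems(1) l Cons.prems(2) Bj Bjl])
    finally show ?thesis by (simp add: rot_add[OF T(1)])
  qed
  have eq\<alpha>: "dist2 I A (j # js) \<alpha> = dist2 (I - {l}) B js (T \<alpha>)"
    using dist2_rot[OF Cons.prems(1,2) T(1), of A \<alpha>] dist2_remove[where A = B and j = j and I = I and l = l and z = "T \<alpha>", OF Cons.prems(1) l Cons.prems(2) Bj Bjl]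
    by (simp add: B_def[abs_def])
  have fin: "finite (I - {l})" using Cons.prems by simp
  have card: "card (I - {l}) = card I - 1" using l Cons.prems by simp
  have mF: "?F \<in> borel_measurable (cgauss_vec J)" if "I - {l} \<subseteq> J" for J
    by (rule measurable_dist2) (use that in \<open>auto intro!: borel_measurable_add\<close>)
  have Fr: "?F (restrict y (I - {l})) = ?F y" for y
    using Cons.prems by (intro dist2_cong) auto
  have "distr (cgauss_vec I) borel (\<lambda>z. dist2 I A (j # js) (\<lambda>i. z i + \<alpha> i)) = distr (cgauss_vec I) borel (\<lambda>z. ?F (T z))"
    by (simp only: eq)
  also have "\<dots> = distr (distr (cgauss_vec I) (cgauss_vec I) T) borel ?F"
    by (subst distr_distr[OF mF measurable_rot[OF T(1)]]) (auto simp: comp_def)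
  also have "\<dots> = distr (cgauss_vec I) borel (\<lambda>y. ?F (restrict y (I - {l})))"
    by (simp only: distr_rot[OF T(1) Cons.prems(1)] Fr)
  also have "\<dots> = distr (distr (cgauss_vec I) (cgauss_vec (I - {l})) (\<lambda>z. restrict z (I - {l}))) borel ?F"
    by (subst distr_distr[OF mF measurable_restrict_subset]) (auto simp: comp_def)
  also have "\<dots> = distr (cgauss_vec (I - {l})) borel ?F"
    by (subst distr_cgauss_vec_restrict) auto
  also have "\<dots> = nce (card (I - {l}) - length js) (dist2 (I - {l}) B js (T \<alpha>))"
    using Cons.prems l indep_cols_remove[where A = B and j = j and I = I and l = l, OF l Cons.prems(2) Bj Bjl indB] by (intro Cons.IH) auto
  also have "card (I - {l}) - length js = card I - length (j # js)"
    using card by simp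
  finally show ?case by (simp only: eq\<alpha>)
qed

text \<open>A criterion for independence that is visibly measurable and admits one column at a time,
  as conditioning requires.\<close>

fun pivots :: "'i set \<Rightarrow> ('j \<Rightarrow> 'i \<Rightarrow> complex) \<Rightarrow> 'j list \<Rightarrow> bool" where
  "pivots I A [] \<longleftrightarrow> True"
| "pivots I A (j # js) \<longleftrightarrow> pivots I A js \<and> dist2 I A js (A j) \<noteq> 0"

lemma indep_cols_pivots:
  assumes "finite I" "distinct js" "pivots I A js"
  shows "indep_cols I A (set js)"
  using assms by (induction js) (auto simp: indep_cols_def[of _ _ "{}"] intro!: indep_cols_insert simp del: set_simps(2))

lemma pivots_cong:
  assumes "finite I" "distinct js" "\<And>j i. j \<in> set js \<Longrightarrow> i \<in> I \<Longrightarrow> A j i = B j i"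
  shows "pivots I A js \<longleftrightarrow> pivots I B js"
  using assms
proof (induction js)
  case (Cons j js)
  then show ?case using dist2_cong[of I js A B "A j" "B j"] by auto
qed simp

lemma measurable_pivots:
  assumes "\<And>j i. j \<in> set js \<Longrightarrow> i \<in> I \<Longrightarrow> (\<lambda>w. A w j i) \<in> borel_measurable M"
  shows "Measurable.pred M (\<lambda>w. pivots I (A w) js)"
  using assms
proof (induction js)
  case (Cons j js)
  have [measurable]: "Measurable.pred M (\<lambda>w. pivots I (A w) js)" using Cons by auto
  have [measurable]: "(\<lambda>w. dist2 I (A w) js (A w j)) \<in> borel_measurable M"
    by (rule measurable_dist2) (use Cons.prems in auto)
  show ?case by simp measurable
qed simp

text \<open>Given the earlier columns, the squared distance of the next one to their span has a law
  concentrated on the positive half-line, whatever the mean \<open>C\<close>; so it is almost surely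
  nonzero.\<close>

lemma AE_pivots:
  assumes "finite I" "distinct js" "length js \<le> card I"
  shows "AE z in cgauss_vec (I \<times> set js). pivots I (\<lambda>j i. z (i, j) + C i j) js"
  using assms
proof (induction js)
  case (Cons j js)
  let ?L = "I \<times> set js" and ?X = "I \<times> set (j # js)"
  let ?A = "\<lambda>w j i. w (i, j) + C i j"
  interpret L: prob_space "cgauss_vec ?L" by (rule prob_space_cgauss_vec)
  interpret K: prob_space "cgauss_vec I" by (rule prob_space_cgauss_vec)
  interpret pair_prob_space "cgauss_vec ?L" "cgauss_vec I" ..
  have js: "distinct js" "j \<notin> set js" using Cons.prems by auto
  have s: "distr (cgauss_vec ?X) (cgauss_vec ?L \<Otimes>\<^sub>M cgauss_vec I) (\<lambda>z. (restrict z ?L, \<lambda>i\<in>I. z (i, j))) = cgauss_vec ?L \<Otimes>\<^sub>M cgauss_vec I"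
    using Cons.prems by (intro distr_cgauss_vec_split) (auto simp: inj_on_def)
  let ?Q = "\<lambda>p. pivots I (?A (fst p)) js \<and> dist2 I (?A (fst p)) js (\<lambda>i. snd p i + C i j) \<noteq> 0"
  have comp1: "(\<lambda>p. fst p (i, k)) \<in> borel_measurable (cgauss_vec ?L \<Otimes>\<^sub>M cgauss_vec I)" if "i \<in> I" "k \<in> set js" for i k
    using that by (intro measurable_compose[OF measurable_fst] measurable_cgauss_vec_component) auto
  have comp2: "(\<lambda>p. snd p i) \<in> borel_measurable (cgauss_vec ?L \<Otimes>\<^sub>M cgauss_vec I)" if "i \<in> I" for i
    using that by (intro measurable_compose[OF measurable_snd] measurable_cgauss_vec_component) auto
  have [measurable]: "Measurable.pred (cgauss_vec ?L \<Otimes>\<^sub>M cgauss_vec I) (\<lambda>p. pivots I (?A (fst p)) js)"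
    by (rule measurable_pivots) (auto intro!: borel_measurable_add comp1)
  have [measurable]: "(\<lambda>p. dist2 I (?A (fst p)) js (\<lambda>i. snd p i + C i j)) \<in> borel_measurable (cgauss_vec ?L \<Otimes>\<^sub>M cgauss_vec I)"
    by (rule measurable_dist2) (auto intro!: borel_measurable_add comp1 comp2)
  have "AE p in cgauss_vec ?L \<Otimes>\<^sub>M cgauss_vec I. ?Q p"
  proof (rule AE_pair_measure)
    show "{p \<in> space (cgauss_vec ?L \<Otimes>\<^sub>M cgauss_vec I). ?Q p} \<in> sets (cgauss_vec ?L \<Otimes>\<^sub>M cgauss_vec I)"
      by measurable
    have "AE w in cgauss_vec ?L. pivots I (?A w) js" using Cons by simp
    then show "AE w in cgauss_vec ?L. AE y in cgauss_vec I. ?Q (w, y)"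
    proof eventually_elim
      case (elim w)
      have d: "distr (cgauss_vec I) borel (\<lambda>z. dist2 I (?A w) js (\<lambda>i. z i + C i j)) = nce (card I - length js) (dist2 I (?A w) js (\<lambda>i. C i j))"
        using Cons.prems indep_cols_pivots[OF _ _ elim] by (intro distr_dist2) auto
      have "AE t in distr (cgauss_vec I) borel (\<lambda>z. dist2 I (?A w) js (\<lambda>i. z i + C i j)). 0 < t"
        unfolding d using Cons.prems by (intro AE_nce_pos dist2_nonneg) auto
      moreover have "(\<lambda>z. dist2 I (?A w) js (\<lambda>i. z i + C i j)) \<in> borel_measurable (cgauss_vec I)"
        by (rule measurable_dist2) (auto intro!: borel_measurable_add)
      ultimately have "AE y in cgauss_vec I. 0 < dist2 I (?A w) js (\<lambda>i. y i + C i j)"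
        by (rule AE_distrD[rotated])
      then show ?case using elim by auto
    qed
  qed
  then have "AE p in distr (cgauss_vec ?X) (cgauss_vec ?L \<Otimes>\<^sub>M cgauss_vec I) (\<lambda>z. (restrict z ?L, \<lambda>i\<in>I. z (i, j))). ?Q p"
    by (simp only: s)
  then have "AE z in cgauss_vec ?X. ?Q (restrict z ?L, \<lambda>i\<in>I. z (i, j))"
    by (rule AE_distrD[OF measurable_cgauss_vec_split, rotated 2]) auto
  then show ?case
  proof eventually_elim
    case (elim z)
    have "pivots I (?A (restrict z ?L)) js \<longleftrightarrow> pivots I (?A z) js"
      using Cons.prems by (intro pivots_cong) auto
    moreover have "dist2 I (?A (restrict z ?L)) js (\<lambda>i. (\<lambda>i\<in>I. z (i, j)) i + C i j) = dist2 I (?A z) js (?A z j)"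
      using Cons.prems by (intro dist2_cong) auto
    ultimately show ?case using elim by simp
  qed
qed simp

section \<open>Distance from the mean direction to a Gaussian span\<close>

lemma distr_rot_lift:
  assumes T: "rot X T'" "finite X" and G: "G \<in> borel_measurable (cgauss_vec X)"
  shows "distr (cgauss_vec X) borel (\<lambda>w. G (T' w)) = distr (cgauss_vec X) borel G"
proof -
  have "distr (cgauss_vec X) borel (\<lambda>w. G (T' w)) = distr (distr (cgauss_vec X) (cgauss_vec X) T') borel G"
    by (subst distr_distr[OF G measurable_rot[OF T(1)]]) (simp add: comp_def)
  then show ?thesis by (simp only: distr_rot[OF T])
qed

text \<open>The rows are transformed by \<open>T\<close>, which does not change the span of the columns.\<close>
lemma dist2_rot_columns:
  assumes I: "finite I" and js: "distinct js" and T: "rot (set js) T"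
  shows "dist2 I (\<lambda>j i. T (\<lambda>k. A k i) j) js z = dist2 I A js z"
proof (rule dist2_span[OF I js js])
  let ?e = "\<lambda>k l. if l = k then 1 else 0 :: complex"
  let ?J = "set js"
  have e: "(\<Sum>k\<in>?J. y k * ?e k l) = y l" if "l \<in> ?J" for y l
    using that by (subst sum.remove[of _ l]) (auto intro!: sum.neutral split: if_splits)
  have T1: "T y l = (\<Sum>k\<in>?J. T (?e k) l * y k)" if l: "l \<in> ?J" for y l
  proof -
    have "\<forall>l\<in>?J. T y l = T (\<lambda>l. \<Sum>k\<in>?J. y k * ?e k l) l"
      by (rule rot_cong[OF T]) (rule ballI, erule e[symmetric])
    then show ?thesis using l by (simp add: rot_sum[OF T] mult.commute)
  qed
  have T2: "y k = (\<Sum>l\<in>?J. cnj (T (?e k) l) * T y l)" if k: "k \<in> ?J" for y k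
  proof -
    have "(\<Sum>l\<in>?J. cnj (T (?e k) l) * T y l) = (\<Sum>l\<in>?J. cnj (?e k l) * y l)"
      by (rule rot_inner[OF T]) simp
    also have "\<dots> = y k"
      using k by (subst sum.remove[of _ k]) (auto intro!: sum.neutral split: if_splits)
    finally show ?thesis by simp
  qed
  show "\<exists>x. \<forall>i\<in>I. T (\<lambda>k. A k i) j = (\<Sum>k\<in>?J. x k * A k i)" if "j \<in> ?J" for j
  proof (intro exI ballI)
    show "T (\<lambda>k. A k i) j = (\<Sum>k\<in>?J. T (?e k) j * A k i)" for i
      using T1[OF that, of "\<lambda>k. A k i"] by simp
  qed
  show "\<exists>x. \<forall>i\<in>I. A k i = (\<Sum>j\<in>?J. x j * T (\<lambda>k. A k i) j)" if "k \<in> ?J" for k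
  proof (intro exI ballI)
    show "A k i = (\<Sum>j\<in>?J. cnj (T (?e k) j) * T (\<lambda>k. A k i) j)" for i
      using T2[OF that, of "\<lambda>k. A k i"] by simp
  qed
  show "\<exists>x. \<forall>i\<in>I. z i = z i + (\<Sum>j\<in>?J. x j * T (\<lambda>k. A k i) j)"
    by (intro exI[of _ "\<lambda>_. 0"]) simp
qed

text \<open>In row \<open>i0\<close> only column \<open>j\<close> is nonzero. After projecting away
  the other columns, the error of approximating the unit vector by \<open>y\<close> times column
  \<open>j\<close> is the squared modulus of \<open>1 - y * \<mu>\<close> plus \<open>D\<close>
  times that of \<open>y\<close>; its minimum is the stated quotient.\<close>

lemma dist2_arrow:
  assumes I: "finite I" "i0 \<in> I" and js: "distinct (j # js)"
    and u: "\<forall>k\<in>set js. A k i0 = 0"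
    and D: "D = dist2 (I - {i0}) A js (A j)" "0 < D"
  shows "dist2 I A (j # js) (\<lambda>i. if i = i0 then 1 else 0) = D / (D + (cmod (A j i0))\<^sup>2)"
proof -
  have fI: "finite (I - {i0})" and djs: "distinct js" using I js by auto
  obtain r where r: "is_resid (I - {i0}) A (set js) (A j) r" by (rule is_resid_exists[OF fI djs])
  then obtain x where x: "\<forall>i\<in>I - {i0}. r i = A j i - (\<Sum>k\<in>set js. x k * A k i)" and
    o: "\<forall>k\<in>set js. (\<Sum>i\<in>I - {i0}. cnj (A k i) * r i) = 0" unfolding is_resid_def by blast
  define \<mu> where "\<mu> = A j i0"
  define S where "S = D + (cmod \<mu>)\<^sup>2"
  \<comment> \<open>The minimiser of this quadratic error in \<open>y\<close>.\<close>
  define y where "y = cnj \<mu> / of_real S"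
  have S: "0 < S" using D by (simp add: S_def add_pos_nonneg)
  have Dr: "D = (\<Sum>i\<in>I - {i0}. (cmod (r i))\<^sup>2)"
    unfolding D(1) by (rule dist2_eqI[OF fI djs r])
  have y\<mu>: "1 - y * \<mu> = of_real (D / S)"
  proof -
    have "y * \<mu> = of_real ((cmod \<mu>)\<^sup>2 / S)"
      by (simp add: y_def mult.commute flip: complex_norm_square)
    also have "1 - of_real ((cmod \<mu>)\<^sup>2 / S) = complex_of_real (1 - (cmod \<mu>)\<^sup>2 / S)" by simp
    also have "1 - (cmod \<mu>)\<^sup>2 / S = D / S" using S by (simp add: S_def field_simps)
    finally show ?thesis .
  qed
  have Ajr: "(\<Sum>i\<in>I - {i0}. cnj (A j i) * r i) = of_real D"
  proof -
    have "(\<Sum>i\<in>I - {i0}. cnj (r i) * A j i) = (\<Sum>i\<in>I - {i0}. cnj (r i) * r i)"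
      by (rule is_resid_orth[OF r o])
    then show ?thesis by (subst sum_cnj_commute) (simp add: sum_cnj_sq Dr)
  qed
  define r' where "r' i = (if i = i0 then of_real (D / S) else - y * r i)" for i
  have sum': "(\<Sum>i\<in>I. h i) = h i0 + (\<Sum>i\<in>I - {i0}. h i)" for h :: "'a \<Rightarrow> complex"
    using I by (simp add: sum.remove)
  have sumr: "(\<Sum>i\<in>I. h i * r' i) = h i0 * of_real (D / S) - y * (\<Sum>i\<in>I - {i0}. h i * r i)" for h :: "'a \<Rightarrow> complex"
  proof -
    have "(\<Sum>i\<in>I - {i0}. h i * r' i) = - y * (\<Sum>i\<in>I - {i0}. h i * r i)"
      unfolding sum_distrib_left by (intro sum.cong) (auto simp: r'_def)
    then show ?thesis unfolding sum' by (simp add: r'_def)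
  qed
  have "is_resid I A (set (j # js)) (\<lambda>i. if i = i0 then 1 else 0) r'"
    unfolding is_resid_def
  proof (intro conjI exI[of _ "\<lambda>k. if k = j then y else - y * x k"] ballI)
    fix i assume i: "i \<in> I"
    have "(\<Sum>k\<in>set js. (if k = j then y else - y * x k) * A k i) = - y * (\<Sum>k\<in>set js. x k * A k i)"
      unfolding sum_distrib_left using js by (intro sum.cong) auto
    then have s: "(\<Sum>k\<in>set (j # js). (if k = j then y else - y * x k) * A k i) = y * A j i - y * (\<Sum>k\<in>set js. x k * A k i)"
      using js by simp
    show "r' i = (if i = i0 then 1 else 0) - (\<Sum>k\<in>set (j # js). (if k = j then y else - y * x k) * A k i)"
    proof (cases "i = i0")
      case True
      then show ?thesis unfolding s using u y\<mu> by (simp add: r'_def \<mu>_def)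
    next
      case False
      then have "r i = A j i - (\<Sum>k\<in>set js. x k * A k i)" using x i by simp
      then show ?thesis unfolding s using False by (simp add: r'_def right_diff_distrib)
    qed
  next
    fix k assume k: "k \<in> set (j # js)"
    show "(\<Sum>i\<in>I. cnj (A k i) * r' i) = 0"
    proof (cases "k = j")
      case True
      have "cnj \<mu> * of_real (D / S) - y * of_real D = 0" by (simp add: y_def)
      then show ?thesis unfolding sumr True Ajr by (simp add: \<mu>_def)
    next
      case False
      then have "k \<in> set js" using k by simp
      then show ?thesis unfolding sumr using u o by simp
    qed
  qed
  from dist2_eqI[OF I(1) js this]
  have "dist2 I A (j # js) (\<lambda>i. if i = i0 then 1 else 0) = (\<Sum>i\<in>I. (cmod (r' i))\<^sup>2)" .
  also have "\<dots> = (D / S)\<^sup>2 + (\<Sum>i\<in>I - {i0}. (cmod (r' i))\<^sup>2)"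
    using I S D by (subst sum.remove[of I i0]) (auto simp: r'_def norm_divide)
  also have "(\<Sum>i\<in>I - {i0}. (cmod (r' i))\<^sup>2) = (cmod y)\<^sup>2 * D"
    unfolding Dr sum_distrib_left by (intro sum.cong) (auto simp: r'_def norm_mult power_mult_distrib)
  also have "(cmod y)\<^sup>2 = (cmod \<mu>)\<^sup>2 / S\<^sup>2"
    using S by (simp add: y_def norm_divide power_divide)
  also have "(D / S)\<^sup>2 + (cmod \<mu>)\<^sup>2 / S\<^sup>2 * D = D * S / S\<^sup>2"
    by (simp add: S_def power2_eq_square add_divide_distrib algebra_simps)
  also have "\<dots> = D / S" using S by (simp add: power2_eq_square)
  finally show ?thesis by (simp add: S_def \<mu>_def)
qed

text \<open>With mean zero the conditional law given the other columns does not depend on their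
  span, so averaging over them changes nothing.\<close>

lemma distr_dist2_columns:
  assumes I: "finite I" and js: "distinct (j # js)" and len: "length js < card I"
  shows "distr (cgauss_vec (I \<times> set (j # js))) borel (\<lambda>u. dist2 I (\<lambda>k i. u (i, k)) js (\<lambda>i. u (i, j))) = erl (card I - length js - 1)"
proof (rule measure_eqI_nn_integral)
  let ?L = "I \<times> set js" and ?X = "I \<times> set (j # js)"
  let ?D = "\<lambda>u. dist2 I (\<lambda>k i. u (i, k)) js (\<lambda>i. u (i, j))"
  let ?D' = "\<lambda>p. dist2 I (\<lambda>k i. fst p (i, k)) js (snd p)"
  interpret L: prob_space "cgauss_vec ?L" by (rule prob_space_cgauss_vec)
  interpret K: prob_space "cgauss_vec I" by (rule prob_space_cgauss_vec)
  interpret pair_prob_space "cgauss_vec ?L" "cgauss_vec I" ..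
  fix f :: "real \<Rightarrow> ennreal" assume "f \<in> borel_measurable (distr (cgauss_vec ?X) borel ?D)"
  then have f: "f \<in> borel_measurable borel" by simp
  have s: "distr (cgauss_vec ?X) (cgauss_vec ?L \<Otimes>\<^sub>M cgauss_vec I) (\<lambda>z. (restrict z ?L, \<lambda>i\<in>I. z (i, j))) = cgauss_vec ?L \<Otimes>\<^sub>M cgauss_vec I"
    using js I by (intro distr_cgauss_vec_split) (auto simp: inj_on_def)
  have m: "?D \<in> borel_measurable (cgauss_vec ?X)"
    by (rule measurable_dist2) auto
  have m': "?D' \<in> borel_measurable (cgauss_vec ?L \<Otimes>\<^sub>M cgauss_vec I)"
    by (rule measurable_dist2)
      (auto intro!: measurable_compose[OF measurable_fst] measurable_compose[OF measurable_snd] measurable_cgauss_vec_component)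
  have fm': "(\<lambda>p. f (?D' p)) \<in> borel_measurable (cgauss_vec ?L \<Otimes>\<^sub>M cgauss_vec I)"
    by (rule measurable_compose[OF m' f])
  have "(\<integral>\<^sup>+t. f t \<partial>distr (cgauss_vec ?X) borel ?D) = (\<integral>\<^sup>+u. f (?D u) \<partial>cgauss_vec ?X)"
    by (rule nn_integral_distr[OF m]) (simp add: f)
  also have "\<dots> = (\<integral>\<^sup>+u. f (?D' (restrict u ?L, \<lambda>i\<in>I. u (i, j))) \<partial>cgauss_vec ?X)"
    by (intro nn_integral_cong arg_cong[where f = f] dist2_cong) (use I js in auto)
  also have "\<dots> = (\<integral>\<^sup>+p. f (?D' p) \<partial>distr (cgauss_vec ?X) (cgauss_vec ?L \<Otimes>\<^sub>M cgauss_vec I) (\<lambda>z. (restrict z ?L, \<lambda>i\<in>I. z (i, j))))"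
    by (rule nn_integral_distr[symmetric, OF measurable_cgauss_vec_split]) (use fm' in auto)
  also have "\<dots> = (\<integral>\<^sup>+p. f (?D' p) \<partial>(cgauss_vec ?L \<Otimes>\<^sub>M cgauss_vec I))" by (simp only: s)
  also have "\<dots> = (\<integral>\<^sup>+w. (\<integral>\<^sup>+y. f (?D' (w, y)) \<partial>cgauss_vec I) \<partial>cgauss_vec ?L)"
    by (rule K.nn_integral_fst[symmetric, OF fm'])
  also have "\<dots> = (\<integral>\<^sup>+w. (\<integral>\<^sup>+t. f t \<partial>erl (card I - length js - 1)) \<partial>cgauss_vec ?L)"
  proof (rule nn_integral_cong_AE)
    have "AE w in cgauss_vec ?L. pivots I (\<lambda>j i. w (i, j) + 0) js"
      using I js len by (intro AE_pivots[where C = "\<lambda>_ _. 0"]) auto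
    then show "AE w in cgauss_vec ?L. (\<integral>\<^sup>+y. f (?D' (w, y)) \<partial>cgauss_vec I) = (\<integral>\<^sup>+t. f t \<partial>erl (card I - length js - 1))"
    proof eventually_elim
      case (elim w)
      let ?A = "\<lambda>j i. w (i, j)"
      have "distr (cgauss_vec I) borel (\<lambda>z. dist2 I ?A js (\<lambda>i. z i + 0)) = nce (card I - length js) (dist2 I ?A js (\<lambda>_. 0))"
        using js I len indep_cols_pivots[of I js ?A] elim by (intro distr_dist2) auto
      moreover have "dist2 I ?A js (\<lambda>_. 0) = 0"
        using dist2_scale[of I js ?A 0 "\<lambda>_. 0"] I js by simp
      ultimately have d: "distr (cgauss_vec I) borel (dist2 I ?A js) = erl (card I - length js - 1)"
        by (simp add: nce_0)
      have "dist2 I ?A js \<in> borel_measurable (cgauss_vec I)"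
        by (rule measurable_dist2) auto
      then have "(\<integral>\<^sup>+y. f (dist2 I ?A js y) \<partial>cgauss_vec I) = (\<integral>\<^sup>+t. f t \<partial>distr (cgauss_vec I) borel (dist2 I ?A js))"
        by (rule nn_integral_distr[symmetric]) (use f in auto)
      then show ?case unfolding d by simp
    qed
  qed
  also have "\<dots> = (\<integral>\<^sup>+t. f t \<partial>erl (card I - length js - 1))"
    by (simp add: L.emeasure_space_1)
  finally show "(\<integral>\<^sup>+t. f t \<partial>distr (cgauss_vec ?X) borel ?D) = (\<integral>\<^sup>+t. f t \<partial>erl (card I - length js - 1))" .
qed simp

text \<open>One rotation of the column index, applied in every row, concentrates the fixed row in
  its entry \<open>j1\<close> while keeping the span and the law of the other rows. The matrix is
  then of the arrow shape, with the squared norm of \<open>v\<close> in place of that of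
  \<mu>.\<close>

lemma distr_dist2_fixed_row:
  assumes I: "finite I" "i0 \<in> I" and js: "distinct js" "js \<noteq> []" and len: "length js < card I"
  shows "distr (cgauss_vec ((I - {i0}) \<times> set js)) borel
      (\<lambda>w. dist2 I (\<lambda>j i. if i = i0 then v j else w (i, j)) js (\<lambda>i. if i = i0 then 1 else 0))
    = distr (erl (card I - length js - 1)) borel (\<lambda>t. t / (t + (\<Sum>j\<in>set js. (cmod (v j))\<^sup>2)))"
proof -
  obtain j1 js' where jseq: "js = j1 # js'" using js by (cases js) auto
  let ?I' = "I - {i0}"
  let ?L = "?I' \<times> set js" and ?e = "\<lambda>i. if i = i0 then 1 else 0 :: complex"
  obtain T where T: "rot (set js) T" "\<forall>k\<in>set js - {j1}. T v k = 0"
    by (rule rot_exists[of "set js" j1 v]) (auto simp: jseq)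
  obtain T' where T': "rot ?L T'" "\<And>z r k. r \<in> ?I' \<Longrightarrow> k \<in> set js \<Longrightarrow> T' z (r, k) = T (\<lambda>k. z (r, k)) k"
    by (rule rot_lift[OF T(1), of ?I' Pair ?L]) (use I in auto)
  let ?G = "\<lambda>u. dist2 I (\<lambda>j i. if i = i0 then T v j else u (i, j)) js ?e"
  let ?D = "\<lambda>u. dist2 ?I' (\<lambda>k i. u (i, k)) js' (\<lambda>i. u (i, j1))"
  define x where "x = (\<Sum>j\<in>set js. (cmod (v j))\<^sup>2)"
  have x: "x = (cmod (T v j1))\<^sup>2"
  proof -
    have "x = (\<Sum>j\<in>set js. (cmod (T v j))\<^sup>2)" unfolding x_def by (rule rot_norm[OF T(1), symmetric]) simp
    also have "\<dots> = (cmod (T v j1))\<^sup>2"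
      using T(2) by (subst sum.remove[of _ j1]) (auto simp: jseq intro!: sum.neutral)
    finally show ?thesis .
  qed
  have mG: "?G \<in> borel_measurable (cgauss_vec ?L)"
  proof (rule measurable_dist2)
    fix j i assume "j \<in> set js" "i \<in> I"
    then show "(\<lambda>u. if i = i0 then T v j else u (i, j)) \<in> borel_measurable (cgauss_vec ?L)"
      by (cases "i = i0") auto
  qed auto
  have mD: "?D \<in> borel_measurable (cgauss_vec ?L)"
    by (rule measurable_dist2) (auto simp: jseq)
  have card: "card ?I' = card I - 1" using I by simp
  \<comment> \<open>Row \<open>i0\<close> and column \<open>j1\<close> both drop out, and the two
    losses cancel.\<close>
  have N: "card ?I' - length js' - 1 = card I - length js - 1" using len jseq card by simp
  have D: "distr (cgauss_vec ?L) borel ?D = erl (card I - length js - 1)"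
    using distr_dist2_columns[of ?I' j1 js'] I js len card by (simp only: jseq[symmetric] N) (simp add: jseq)
  have "distr (cgauss_vec ?L) borel (\<lambda>w. dist2 I (\<lambda>j i. if i = i0 then v j else w (i, j)) js ?e)
      = distr (cgauss_vec ?L) borel (\<lambda>w. ?G (T' w))"
  proof (intro distr_cong refl)
    fix w :: "'a \<times> 'b \<Rightarrow> complex"
    have "dist2 I (\<lambda>j i. if i = i0 then v j else w (i, j)) js ?e
      = dist2 I (\<lambda>j i. T (\<lambda>k. if i = i0 then v k else w (i, k)) j) js ?e"
      by (rule dist2_rot_columns[symmetric, OF I(1) js(1) T(1)])
    also have "\<dots> = ?G (T' w)"
      using T'(2) by (intro dist2_cong[OF I(1) js(1)]) auto
    finally show "dist2 I (\<lambda>j i. if i = i0 then v j else w (i, j)) js ?e = ?G (T' w)" .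
  qed
  also have "\<dots> = distr (cgauss_vec ?L) borel ?G"
    using I by (intro distr_rot_lift[OF T'(1) _ mG]) auto
  also have "\<dots> = distr (cgauss_vec ?L) borel (\<lambda>u. ?D u / (?D u + x))"
  proof (rule distr_cong_AE)
    have "AE t in distr (cgauss_vec ?L) borel ?D. 0 < t"
      unfolding D by (rule AE_erl_pos)
    then have "AE u in cgauss_vec ?L. 0 < ?D u"
      by (rule AE_distrD[OF mD])
    then show "AE u in cgauss_vec ?L. ?G u = ?D u / (?D u + x)"
    proof eventually_elim
      case (elim u)
      let ?A = "\<lambda>j i. if i = i0 then T v j else u (i, j)"
      have "?D u = dist2 ?I' ?A js' (?A j1)"
        by (rule dist2_cong) (use I js jseq in auto)
      then have "dist2 I ?A (j1 # js') ?e = ?D u / (?D u + (cmod (?A j1 i0))\<^sup>2)"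
        using elim T(2) js I by (intro dist2_arrow) (auto simp: jseq)
      then show ?case by (simp add: x jseq)
    qed
  qed (use mG mD in \<open>auto intro!: borel_measurable_divide borel_measurable_add\<close>)
  also have "\<dots> = distr (distr (cgauss_vec ?L) borel ?D) borel (\<lambda>t. t / (t + x))"
    by (subst distr_distr[OF _ mD]) (auto simp: comp_def)
  finally show ?thesis unfolding D x_def .
qed

text \<open>Row \<open>i0\<close> is independent of the other rows and enters only through its
  squared norm, which has a noncentral law because this row alone carries a mean.\<close>

lemma distr_dist2_unit:
  assumes I: "finite I" "i0 \<in> I" and js: "distinct js" "js \<noteq> []" and len: "length js < card I"
  shows "distr (cgauss_vec (I \<times> set js)) borel
      (\<lambda>w. dist2 I (\<lambda>j i. w (i, j) + (if i = i0 then c j else 0)) js (\<lambda>i. if i = i0 then 1 else 0))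
    = distr (nce (length js) (\<Sum>j\<in>set js. (cmod (c j))\<^sup>2) \<Otimes>\<^sub>M erl (card I - length js - 1)) borel
        (\<lambda>p. snd p / (snd p + fst p))"
proof (rule measure_eqI_nn_integral)
  let ?J = "set js" and ?e = "\<lambda>i. if i = i0 then 1 else 0 :: complex"
  let ?L = "(I - {i0}) \<times> ?J" and ?X = "I \<times> ?J"
  let ?D = "\<lambda>w. dist2 I (\<lambda>j i. w (i, j) + (if i = i0 then c j else 0)) js ?e"
  let ?D' = "\<lambda>p. dist2 I (\<lambda>j i. if i = i0 then snd p j + c j else fst p (i, j)) js ?e"
  define x where "x = (\<Sum>j\<in>?J. (cmod (c j))\<^sup>2)"
  define N where "N = card I - length js - 1"
  have x: "0 \<le> x" by (simp add: x_def sum_nonneg)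
  interpret n: prob_space "nce (length js) x" by (rule prob_space_nce[OF x])
  interpret L: prob_space "cgauss_vec ?L" by (rule prob_space_cgauss_vec)
  interpret K: prob_space "cgauss_vec ?J" by (rule prob_space_cgauss_vec)
  interpret pair_prob_space "cgauss_vec ?L" "cgauss_vec ?J" ..
  fix f :: "real \<Rightarrow> ennreal" assume "f \<in> borel_measurable (distr (cgauss_vec ?X) borel ?D)"
  then have f [measurable]: "f \<in> borel_measurable borel" by simp
  have s: "distr (cgauss_vec ?X) (cgauss_vec ?L \<Otimes>\<^sub>M cgauss_vec ?J) (\<lambda>z. (restrict z ?L, \<lambda>j\<in>?J. z (i0, j))) = cgauss_vec ?L \<Otimes>\<^sub>M cgauss_vec ?J"
    using js I by (intro distr_cgauss_vec_split) (auto simp: inj_on_def)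
  have m: "?D \<in> borel_measurable (cgauss_vec ?X)"
    by (rule measurable_dist2) (auto intro!: borel_measurable_add)
  have m': "?D' \<in> borel_measurable (cgauss_vec ?L \<Otimes>\<^sub>M cgauss_vec ?J)"
  proof (rule measurable_dist2)
    fix j i assume ji: "j \<in> set js" "i \<in> I"
    have 1: "(\<lambda>p. snd p j + c j) \<in> borel_measurable (cgauss_vec ?L \<Otimes>\<^sub>M cgauss_vec ?J)"
      using ji by (intro borel_measurable_add measurable_compose[OF measurable_snd] measurable_cgauss_vec_component) auto
    have 2: "i \<noteq> i0 \<Longrightarrow> (\<lambda>p. fst p (i, j)) \<in> borel_measurable (cgauss_vec ?L \<Otimes>\<^sub>M cgauss_vec ?J)"
      using ji by (intro measurable_compose[OF measurable_fst] measurable_cgauss_vec_component) auto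
    show "(\<lambda>p. if i = i0 then snd p j + c j else fst p (i, j)) \<in> borel_measurable (cgauss_vec ?L \<Otimes>\<^sub>M cgauss_vec ?J)"
      using 1 2 by (cases "i = i0") auto
  qed auto
  have fm': "(\<lambda>p. f (?D' p)) \<in> borel_measurable (cgauss_vec ?L \<Otimes>\<^sub>M cgauss_vec ?J)"
    by (rule measurable_compose[OF m' f])
  let ?h = "\<lambda>v. \<integral>\<^sup>+t. f (t / (t + v)) \<partial>erl N"
  have h: "?h \<in> borel_measurable borel" by measurable
  have "(\<integral>\<^sup>+t. f t \<partial>distr (cgauss_vec ?X) borel ?D) = (\<integral>\<^sup>+u. f (?D u) \<partial>cgauss_vec ?X)"
    by (rule nn_integral_distr[OF m]) (simp add: f)
  also have "\<dots> = (\<integral>\<^sup>+u. f (?D' (restrict u ?L, \<lambda>j\<in>?J. u (i0, j))) \<partial>cgauss_vec ?X)"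
    by (intro nn_integral_cong arg_cong[where f = f] dist2_cong) (use I js in auto)
  also have "\<dots> = (\<integral>\<^sup>+p. f (?D' p) \<partial>distr (cgauss_vec ?X) (cgauss_vec ?L \<Otimes>\<^sub>M cgauss_vec ?J) (\<lambda>z. (restrict z ?L, \<lambda>j\<in>?J. z (i0, j))))"
    by (rule nn_integral_distr[symmetric, OF measurable_cgauss_vec_split]) (use fm' I in auto)
  also have "\<dots> = (\<integral>\<^sup>+p. f (?D' p) \<partial>(cgauss_vec ?L \<Otimes>\<^sub>M cgauss_vec ?J))" by (simp only: s)
  also have "\<dots> = (\<integral>\<^sup>+y. (\<integral>\<^sup>+w. f (?D' (w, y)) \<partial>cgauss_vec ?L) \<partial>cgauss_vec ?J)"
    by (rule nn_integral_snd[symmetric]) (use fm' in \<open>simp add: case_prod_beta\<close>)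
  also have "\<dots> = (\<integral>\<^sup>+y. ?h (\<Sum>j\<in>?J. (cmod (y j + c j))\<^sup>2) \<partial>cgauss_vec ?J)"
  proof (rule nn_integral_cong)
    fix y
    let ?G = "\<lambda>w. dist2 I (\<lambda>j i. if i = i0 then y j + c j else w (i, j)) js ?e"
    let ?v = "\<Sum>j\<in>?J. (cmod (y j + c j))\<^sup>2"
    have "?G \<in> borel_measurable (cgauss_vec ?L)"
    proof (rule measurable_dist2)
      fix j i assume "j \<in> set js" "i \<in> I"
      then show "(\<lambda>u. if i = i0 then y j + c j else u (i, j)) \<in> borel_measurable (cgauss_vec ?L)"
        by (cases "i = i0") auto
    qed auto
    then have "(\<integral>\<^sup>+w. f (?G w) \<partial>cgauss_vec ?L) = (\<integral>\<^sup>+t. f t \<partial>distr (cgauss_vec ?L) borel ?G)"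
      by (rule nn_integral_distr[symmetric]) (simp add: f)
    also have "\<dots> = (\<integral>\<^sup>+t. f t \<partial>distr (erl N) borel (\<lambda>t. t / (t + ?v)))"
      unfolding N_def by (simp only: distr_dist2_fixed_row[OF I js len])
    also have "\<dots> = ?h ?v"
      by (rule nn_integral_distr) (auto simp: f)
    finally show "(\<integral>\<^sup>+w. f (?D' (w, y)) \<partial>cgauss_vec ?L) = ?h ?v" by (simp only: fst_conv snd_conv)
  qed
  also have "\<dots> = (\<integral>\<^sup>+v. ?h v \<partial>nce (length js) x)"
    unfolding x_def distinct_card[OF js(1), symmetric]
    using js h by (intro nn_integral_cgauss_vec_sqnorm[where f = ?h]) auto
  also have "\<dots> = (\<integral>\<^sup>+p. f (snd p / (snd p + fst p)) \<partial>(nce (length js) x \<Otimes>\<^sub>M erl N))"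
    by (subst erl.nn_integral_fst[symmetric]) auto
  also have "\<dots> = (\<integral>\<^sup>+t. f t \<partial>distr (nce (length js) x \<Otimes>\<^sub>M erl N) borel (\<lambda>p. snd p / (snd p + fst p)))"
    by (rule nn_integral_distr[symmetric]) auto
  finally show "(\<integral>\<^sup>+t. f t \<partial>distr (cgauss_vec ?X) borel ?D) = (\<integral>\<^sup>+t. f t \<partial>distr (nce (length js) x \<Otimes>\<^sub>M erl N) borel (\<lambda>p. snd p / (snd p + fst p)))" .
qed simp

text \<open>A rotation of the row index sends \<open>a\<close> to a phase \<open>l\<close> times a
  coordinate vector. The phase is absorbed into \<open>c\<close> and disappears from all
  norms.\<close>

lemma distr_dist2_mean:
  assumes I: "finite I" and js: "distinct js" "js \<noteq> []" and len: "length js < card I"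
    and a: "(\<Sum>i\<in>I. (cmod (a i))\<^sup>2) = 1"
  shows "distr (cgauss_vec (I \<times> set js)) borel (\<lambda>w. dist2 I (\<lambda>j i. w (i, j) + a i * c j) js a)
    = distr (nce (length js) (\<Sum>j\<in>set js. (cmod (c j))\<^sup>2) \<Otimes>\<^sub>M erl (card I - length js - 1)) borel
        (\<lambda>p. snd p / (snd p + fst p))"
proof -
  let ?X = "I \<times> set js"
  have "card I > 0" using len by simp
  then obtain i0 where i0: "i0 \<in> I" by (metis card_gt_0_iff ex_in_conv)
  obtain T where T: "rot I T" "\<forall>k\<in>I - {i0}. T a k = 0" by (rule rot_exists[OF I i0])
  obtain T' where T': "rot ?X T'" "\<And>z r k. r \<in> set js \<Longrightarrow> k \<in> I \<Longrightarrow> T' z (k, r) = T (\<lambda>k. z (k, r)) k"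
    by (rule rot_lift[OF T(1), of "set js" "\<lambda>r k. (k, r)" ?X]) auto
  define l where "l = T a i0"
  have "1 = (\<Sum>i\<in>I. (cmod (T a i))\<^sup>2)" unfolding a[symmetric] by (rule rot_norm[OF T(1) I, symmetric])
  also have "\<dots> = (cmod l)\<^sup>2"
    using T(2) I i0 by (subst sum.remove[of _ i0]) (auto simp: l_def intro!: sum.neutral)
  finally have l: "(cmod l)\<^sup>2 = 1" by simp
  have Ta: "T a i = l * (if i = i0 then 1 else 0)" if "i \<in> I" for i
    using T(2) that by (auto simp: l_def)
  let ?G = "\<lambda>w. dist2 I (\<lambda>j i. w (i, j) + (if i = i0 then l * c j else 0)) js (\<lambda>i. if i = i0 then 1 else 0)"
  have "dist2 I (\<lambda>j i. w (i, j) + a i * c j) js a = ?G (T' w)" for w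
  proof -
    have "dist2 I (\<lambda>j i. w (i, j) + a i * c j) js a = dist2 I (\<lambda>j. T (\<lambda>i. w (i, j) + a i * c j)) js (T a)"
      by (rule dist2_rot[symmetric, OF I js(1) T(1)])
    also have "\<dots> = dist2 I (\<lambda>j i. T' w (i, j) + (if i = i0 then l * c j else 0)) js (\<lambda>i. l * (if i = i0 then 1 else 0))"
    proof (rule dist2_cong[OF I js(1)])
      fix j i assume ji: "j \<in> set js" "i \<in> I"
      have "T (\<lambda>i. w (i, j) + a i * c j) i = T (\<lambda>i. w (i, j)) i + c j * T a i"
        using rot_add[OF T(1), of "\<lambda>i. w (i, j)" "\<lambda>i. c j * a i"] rot_scale[OF T(1), of "c j" a] by (simp add: mult.commute)
      then show "T (\<lambda>i. w (i, j) + a i * c j) i = T' w (i, j) + (if i = i0 then l * c j else 0)"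
        using T'(2) ji Ta by simp
    qed (rule Ta)
    also have "\<dots> = ?G (T' w)"
      unfolding dist2_scale[OF I js(1)] by (simp add: l)
    finally show ?thesis .
  qed
  then have "distr (cgauss_vec ?X) borel (\<lambda>w. dist2 I (\<lambda>j i. w (i, j) + a i * c j) js a) = distr (cgauss_vec ?X) borel (\<lambda>w. ?G (T' w))"
    by simp
  also have "\<dots> = distr (cgauss_vec ?X) borel ?G"
    by (rule distr_rot_lift[OF T'(1)]) (use I in \<open>auto intro!: measurable_dist2 borel_measurable_add\<close>)
  also have "\<dots> = distr (nce (length js) (\<Sum>j\<in>set js. (cmod (l * c j))\<^sup>2) \<Otimes>\<^sub>M erl (card I - length js - 1)) borel
        (\<lambda>p. snd p / (snd p + fst p))"
    by (rule distr_dist2_unit[OF I i0 js len])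
  finally show ?thesis by (simp add: norm_mult power_mult_distrib l)
qed

text \<open>Column \<open>j0\<close> is independent of the columns in \<open>js\<close>. Given
  these, its mean \<open>c j0 * a\<close> has squared distance \<open>y * B w\<close> to their span,
  so the conditional transform is \<open>exp\<close> of
  \<open>\<tau> / (1 - \<tau>) * y * B w\<close> up to a constant factor, and the law of
  \<open>B\<close> finishes the average.\<close>

lemma dist2_mgf:
  fixes a :: "'i \<Rightarrow> complex" and c :: "'j \<Rightarrow> complex"
  assumes I: "finite I" and js: "distinct (j0 # js)" "js \<noteq> []" and len: "length js < card I"
    and a: "(\<Sum>i\<in>I. (cmod (a i))\<^sup>2) = 1" and \<tau>: "Re \<tau> < 1"
  defines "D \<equiv> \<lambda>z. dist2 I (\<lambda>j i. z (i, j) + a i * c j) js (\<lambda>i. z (i, j0) + a i * c j0)"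
    and "N \<equiv> card I - length js"
  shows "integrable (cgauss_vec (I \<times> set (j0 # js))) (\<lambda>z. exp (\<tau> * complex_of_real (D z)))"
    and "(\<lambda>n. complex_of_real (poisson_weight (\<Sum>j\<in>set js. (cmod (c j))\<^sup>2) n) *
        hyp1F1 (of_nat N) (of_nat (n + card I)) (\<tau> / (1 - \<tau>) * complex_of_real ((cmod (c j0))\<^sup>2))) sums
      ((1 - \<tau>) ^ N * (\<integral>z. exp (\<tau> * complex_of_real (D z)) \<partial>cgauss_vec (I \<times> set (j0 # js))))"
proof -
  let ?J = "set js"
  let ?L = "I \<times> ?J" and ?X = "I \<times> set (j0 # js)"
  let ?A = "\<lambda>w j i. w (i, j) + a i * c j"
  let ?D' = "\<lambda>p. dist2 I (?A (fst p)) js (\<lambda>i. snd p i + a i * c j0)"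
  let ?S = "\<lambda>z. (restrict z ?L, \<lambda>i\<in>I. z (i, j0))"
  let ?Q = "cgauss_vec ?L \<Otimes>\<^sub>M cgauss_vec I"
  let ?F = "\<lambda>p. exp (\<tau> * complex_of_real (?D' p))"
  define x where "x = (\<Sum>j\<in>?J. (cmod (c j))\<^sup>2)"
  define y where "y = (cmod (c j0))\<^sup>2"
  define B where "B w = dist2 I (?A w) js a" for w
  have x: "0 \<le> x" by (simp add: x_def sum_nonneg)
  have y: "0 \<le> y" by (simp add: y_def)
  have N: "1 \<le> N" using len by (simp add: N_def)
  have djs: "distinct js" using js by simp
  interpret L: prob_space "cgauss_vec ?L" by (rule prob_space_cgauss_vec)
  interpret K: prob_space "cgauss_vec I" by (rule prob_space_cgauss_vec)
  interpret pair_prob_space "cgauss_vec ?L" "cgauss_vec I" ..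
  have s: "distr (cgauss_vec ?X) ?Q ?S = ?Q"
    using js I by (intro distr_cgauss_vec_split) (auto simp: inj_on_def)
  have mS: "?S \<in> cgauss_vec ?X \<rightarrow>\<^sub>M ?Q"
    by (rule measurable_cgauss_vec_split) auto
  have m': "?D' \<in> borel_measurable ?Q"
    by (rule measurable_dist2)
      (auto intro!: borel_measurable_add measurable_compose[OF measurable_fst] measurable_compose[OF measurable_snd] measurable_cgauss_vec_component)
  have mF: "?F \<in> borel_measurable ?Q" using m' by measurable
  have mB: "B \<in> borel_measurable (cgauss_vec ?L)"
    unfolding B_def by (rule measurable_dist2) (auto intro!: borel_measurable_add)
  have B01: "0 \<le> B w" "B w \<le> 1" for w
    unfolding B_def using dist2_nonneg[OF I djs] dist2_le[OF I djs, of "?A w" a] a by auto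
  have DS: "D z = ?D' (?S z)" for z
    unfolding D_def using I djs by (intro dist2_cong) auto
  have law: "AE w in cgauss_vec ?L. distr (cgauss_vec I) borel (\<lambda>v. ?D' (w, v)) = nce N (y * B w)"
  proof -
    have "AE w in cgauss_vec ?L. pivots I (?A w) js"
      using I djs len by (intro AE_pivots[where C = "\<lambda>i j. a i * c j"]) auto
    then show ?thesis
    proof eventually_elim
      case (elim w)
      have "distr (cgauss_vec I) borel (\<lambda>v. dist2 I (?A w) js (\<lambda>i. v i + a i * c j0)) = nce (card I - length js) (dist2 I (?A w) js (\<lambda>i. a i * c j0))"
        using indep_cols_pivots[OF I djs elim] by (intro distr_dist2[OF I djs len])
      also have "(\<lambda>i. a i * c j0) = (\<lambda>i. c j0 * a i)" by (simp add: mult.commute)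
      also have "dist2 I (?A w) js (\<lambda>i. c j0 * a i) = y * B w"
        unfolding y_def B_def by (rule dist2_scale[OF I djs])
      finally show ?case by (simp add: N_def mult.commute[of "c j0"])
    qed
  qed
  have m2: "(\<lambda>v. ?D' (w, v)) \<in> borel_measurable (cgauss_vec I)" for w
    using measurable_dist2[of js I "\<lambda>_. ?A w" "cgauss_vec I" "\<lambda>v i. v i + a i * c j0"] by (auto intro!: borel_measurable_add)
  have inner: "AE w in cgauss_vec ?L. integrable (cgauss_vec I) (\<lambda>v. exp (\<sigma> * complex_of_real (?D' (w, v)))) \<and>
      (\<integral>v. exp (\<sigma> * complex_of_real (?D' (w, v))) \<partial>cgauss_vec I) = 1 / (1 - \<sigma>) ^ N * exp (\<sigma> / (1 - \<sigma>) * of_real (y * B w))"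
    if \<sigma>: "Re \<sigma> < 1" for \<sigma>
    using law
  proof eventually_elim
    case (elim w)
    have yB: "0 \<le> y * B w" using y B01 by simp
    let ?e = "\<lambda>t. exp (\<sigma> * complex_of_real t)"
    have e: "?e \<in> borel_measurable borel" by measurable
    have "integrable (cgauss_vec I) (\<lambda>v. ?e (?D' (w, v))) \<longleftrightarrow> integrable (distr (cgauss_vec I) borel (\<lambda>v. ?D' (w, v))) ?e"
      by (rule integrable_distr_eq[symmetric, OF m2 e])
    moreover have "(\<integral>v. ?e (?D' (w, v)) \<partial>cgauss_vec I) = (\<integral>t. ?e t \<partial>distr (cgauss_vec I) borel (\<lambda>v. ?D' (w, v)))"
      by (rule integral_distr[symmetric, OF m2 e])
    ultimately show ?case
      unfolding elim using nce_laplace[OF yB N \<sigma>] by simp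
  qed
  \<comment> \<open>The norm of the integrand is the same exponential with \<open>r\<close> for
    \<tau>, so the conditional transform at a real point gives the absolute integrability for
    Fubini; \<open>B\<close> being at most one makes the bound uniform.\<close>
  define r where "r = Re \<tau>"
  have r: "r < 1" "Re (complex_of_real r) < 1" using \<tau> by (auto simp: r_def)
  have norm_inner: "AE w in cgauss_vec ?L. (\<integral>v. norm (?F (w, v)) \<partial>cgauss_vec I) = 1 / (1 - r) ^ N * exp (r / (1 - r) * (y * B w))"
    using inner[OF r(2)]
  proof eventually_elim
    case (elim w)
    have nF: "norm (?F (w, v)) = exp (r * ?D' (w, v))" for v
      by (simp add: r_def)
    have "complex_of_real (\<integral>v. norm (?F (w, v)) \<partial>cgauss_vec I) = (\<integral>v. exp (complex_of_real r * complex_of_real (?D' (w, v))) \<partial>cgauss_vec I)"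
      unfolding integral_complex_of_real[symmetric] nF exp_of_real[symmetric] by simp
    also have "\<dots> = complex_of_real (1 / (1 - r) ^ N * exp (r / (1 - r) * (y * B w)))"
      using elim by (simp flip: exp_of_real)
    finally show ?case by (simp only: of_real_eq_iff)
  qed
  have intQ: "integrable ?Q ?F"
  proof (rule Fubini_integrable[OF mF])
    show "integrable (cgauss_vec ?L) (\<lambda>w. \<integral>v. norm (?F (w, v)) \<partial>cgauss_vec I)"
    proof (rule L.integrable_const_bound[where B = "1 / (1 - r) ^ N * exp (\<bar>r / (1 - r)\<bar> * y)"])
      have "(\<lambda>p. norm (?F p)) \<in> borel_measurable ?Q" using mF by measurable
      then show "(\<lambda>w. \<integral>v. norm (?F (w, v)) \<partial>cgauss_vec I) \<in> borel_measurable (cgauss_vec ?L)"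
        by (intro K.borel_measurable_lebesgue_integral) (simp only: split_beta' fst_conv snd_conv)
      show "AE w in cgauss_vec ?L. norm (\<integral>v. norm (?F (w, v)) \<partial>cgauss_vec I) \<le> 1 / (1 - r) ^ N * exp (\<bar>r / (1 - r)\<bar> * y)"
        using norm_inner
      proof eventually_elim
        case (elim w)
        have "r / (1 - r) * (y * B w) \<le> \<bar>r / (1 - r)\<bar> * (y * B w)"
          using y B01 by (intro mult_right_mono abs_ge_self mult_nonneg_nonneg) auto
        also have "\<dots> \<le> \<bar>r / (1 - r)\<bar> * y"
          using y B01 by (intro mult_left_mono mult_left_le) auto
        finally show ?case unfolding elim using r by (simp add: abs_mult divide_right_mono)
      qed
    qed
    show "AE w in cgauss_vec ?L. integrable (cgauss_vec I) (\<lambda>v. ?F (w, v))"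
      using inner[OF \<tau>] by eventually_elim simp
  qed
  have "integrable (distr (cgauss_vec ?X) ?Q ?S) ?F" using intQ by (simp only: s)
  then show "integrable (cgauss_vec ?X) (\<lambda>z. exp (\<tau> * complex_of_real (D z)))"
    unfolding DS by (rule integrable_distr[OF mS])
  let ?\<theta> = "\<tau> / (1 - \<tau>) * complex_of_real y"
  have "(\<integral>z. exp (\<tau> * complex_of_real (D z)) \<partial>cgauss_vec ?X) = (\<integral>p. ?F p \<partial>distr (cgauss_vec ?X) ?Q ?S)"
    unfolding DS by (rule integral_distr[symmetric, OF mS mF])
  also have "\<dots> = (\<integral>p. ?F p \<partial>?Q)" by (simp only: s)
  also have "\<dots> = (\<integral>w. (\<integral>v. ?F (w, v) \<partial>cgauss_vec I) \<partial>cgauss_vec ?L)"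
    by (rule integral_fst'[symmetric, OF intQ])
  also have "\<dots> = (\<integral>w. 1 / (1 - \<tau>) ^ N * exp (?\<theta> * complex_of_real (B w)) \<partial>cgauss_vec ?L)"
  proof (rule integral_cong_AE)
    show "(\<lambda>w. \<integral>v. ?F (w, v) \<partial>cgauss_vec I) \<in> borel_measurable (cgauss_vec ?L)"
      using mF by (intro K.borel_measurable_lebesgue_integral) (simp add: case_prod_beta)
    show "(\<lambda>w. 1 / (1 - \<tau>) ^ N * exp (?\<theta> * complex_of_real (B w))) \<in> borel_measurable (cgauss_vec ?L)"
      using mB by measurable
    show "AE w in cgauss_vec ?L. (\<integral>v. ?F (w, v) \<partial>cgauss_vec I) = 1 / (1 - \<tau>) ^ N * exp (?\<theta> * complex_of_real (B w))"
      using inner[OF \<tau>] by eventually_elim (simp add: mult.assoc)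
  qed
  also have "\<dots> = 1 / (1 - \<tau>) ^ N * (\<integral>w. exp (?\<theta> * complex_of_real (B w)) \<partial>cgauss_vec ?L)"
    by simp
  also have "(\<integral>w. exp (?\<theta> * complex_of_real (B w)) \<partial>cgauss_vec ?L) = (\<integral>b. exp (?\<theta> * complex_of_real b) \<partial>distr (cgauss_vec ?L) borel B)"
    by (rule integral_distr[symmetric, OF mB]) measurable
  also have "distr (cgauss_vec ?L) borel B = distr (nce (length js) x \<Otimes>\<^sub>M erl (N - 1)) borel (\<lambda>p. snd p / (snd p + fst p))"
    unfolding B_def x_def N_def by (rule distr_dist2_mean[OF I djs js(2) len a])
  also have "(\<integral>b. exp (?\<theta> * complex_of_real b) \<partial>distr (nce (length js) x \<Otimes>\<^sub>M erl (N - 1)) borel (\<lambda>p. snd p / (snd p + fst p)))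
     = (\<integral>p. exp (?\<theta> * complex_of_real (snd p / (snd p + fst p))) \<partial>(nce (length js) x \<Otimes>\<^sub>M erl (N - 1)))"
    by (rule integral_distr) auto
  finally have I_eq: "(\<integral>z. exp (\<tau> * complex_of_real (D z)) \<partial>cgauss_vec ?X) = 1 / (1 - \<tau>) ^ N *
     (\<integral>p. exp (?\<theta> * complex_of_real (snd p / (snd p + fst p))) \<partial>(nce (length js) x \<Otimes>\<^sub>M erl (N - 1)))" .
  have "1 - \<tau> \<noteq> 0" using \<tau> by auto
  then have I_eq': "(1 - \<tau>) ^ N * (\<integral>z. exp (\<tau> * complex_of_real (D z)) \<partial>cgauss_vec ?X) =
     (\<integral>p. exp (?\<theta> * complex_of_real (snd p / (snd p + fst p))) \<partial>(nce (length js) x \<Otimes>\<^sub>M erl (N - 1)))"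
    unfolding I_eq by simp
  \<comment> \<open>The shape \<open>N\<close> and the number of columns in \<open>js\<close> add up
    to the number of rows, which becomes the offset in the second hypergeometric parameter.\<close>
  have Nm: "N + length js = card I" using len by (simp add: N_def)
  have "1 \<le> length js" using js(2) by (cases js) auto
  from integral_exp_nce_ratio[OF N this x, of ?\<theta>]
  show "(\<lambda>n. complex_of_real (poisson_weight (\<Sum>j\<in>set js. (cmod (c j))\<^sup>2) n) *
        hyp1F1 (of_nat N) (of_nat (n + card I)) (\<tau> / (1 - \<tau>) * complex_of_real ((cmod (c j0))\<^sup>2))) sums
      ((1 - \<tau>) ^ N * (\<integral>z. exp (\<tau> * complex_of_real (D z)) \<partial>cgauss_vec ?X))"
    unfolding I_eq' Nm x_def[symmetric] y_def[symmetric] .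
qed

section \<open>Whitening the columns\<close>

text \<open>\<open>S\<close> is a Hermitian square root of \<open>R\<close>, and \<open>u\<close> is the multiple of the first column of the inverse of \<open>R\<close>
  whose first entry is one.\<close>
locale whitening =
  fixes n :: nat and S R :: "nat \<Rightarrow> nat \<Rightarrow> complex" and u w b :: "nat \<Rightarrow> complex" and t :: real
  assumes n: "0 < n"
    and herm: "\<And>i j. i < n \<Longrightarrow> j < n \<Longrightarrow> cnj (S i j) = S j i"
    and SS: "\<And>i j. i < n \<Longrightarrow> j < n \<Longrightarrow> (\<Sum>k<n. S i k * S k j) = R i j"
    and inj: "\<And>x. (\<And>i. i < n \<Longrightarrow> (\<Sum>j<n. S i j * x j) = 0) \<Longrightarrow> (\<And>j. j < n \<Longrightarrow> x j = 0)"
    and surj: "\<And>z. \<exists>q. \<forall>i<n. (\<Sum>j<n. S i j * q j) = z i"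
    and u0: "u 0 = 1" and t: "0 < t"
    and Ru: "\<And>i. i < n \<Longrightarrow> (\<Sum>j<n. R i j * u j) = (if i = 0 then of_real t else 0)"
    and Rw: "\<And>i. i < n \<Longrightarrow> (\<Sum>j<n. R i j * w j) = b i"
begin

definition app :: "(nat \<Rightarrow> complex) \<Rightarrow> nat \<Rightarrow> complex" where
  "app x i = (\<Sum>j<n. S i j * x j)"

lemma app_app: "i < n \<Longrightarrow> app (app x) i = (\<Sum>j<n. R i j * x j)"
proof -
  assume i: "i < n"
  have "app (app x) i = (\<Sum>k<n. \<Sum>j<n. S i k * S k j * x j)"
    by (simp add: app_def sum_distrib_left mult.assoc)
  also have "\<dots> = (\<Sum>j<n. \<Sum>k<n. S i k * S k j * x j)" by (rule sum.swap)
  also have "\<dots> = (\<Sum>j<n. R i j * x j)"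
    using i by (intro sum.cong refl) (simp add: SS flip: sum_distrib_right)
  finally show ?thesis .
qed

lemma app_adjoint: "(\<Sum>i<n. cnj (app x i) * z i) = (\<Sum>i<n. cnj (x i) * app z i)"
proof -
  have "(\<Sum>i<n. cnj (app x i) * z i) = (\<Sum>i<n. \<Sum>j<n. cnj (x j) * (S j i * z i))"
    by (simp add: app_def sum_distrib_right sum_distrib_left herm mult_ac)
  also have "\<dots> = (\<Sum>j<n. \<Sum>i<n. cnj (x j) * (S j i * z i))" by (rule sum.swap)
  also have "\<dots> = (\<Sum>j<n. cnj (x j) * app z j)" by (simp add: app_def sum_distrib_left)
  finally show ?thesis .
qed

lemma app_inj: "(\<And>i. i < n \<Longrightarrow> app x i = 0) \<Longrightarrow> j < n \<Longrightarrow> x j = 0"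
  unfolding app_def by (rule inj)

lemma app_surj: "\<exists>q. \<forall>i<n. app q i = z i"
  unfolding app_def by (rule surj)

definition v :: "nat \<Rightarrow> complex" where "v = app u"

lemma app_v: "i < n \<Longrightarrow> app v i = (if i = 0 then of_real t else 0)"
  unfolding v_def by (simp add: app_app Ru)

lemma sum_first: "(\<Sum>i<n. (if i = 0 then c else 0) * f i) = c * f 0" for c :: complex
  using n by (subst sum.remove[of _ 0]) (auto intro!: sum.neutral)

text \<open>\<open>S\<close> is Hermitian and maps \<open>v\<close> to \<open>t\<close> times the
  first unit vector. Hence \<open>v\<close> is orthogonal to the image of every vector with
  vanishing first entry, which is what separates the first column from the others.\<close>

lemma v_inner: "(\<Sum>i<n. cnj (v i) * app x i) = of_real t * x 0"
proof -
  have "(\<Sum>i<n. cnj (v i) * app x i) = (\<Sum>i<n. cnj (app v i) * x i)" by (rule app_adjoint[symmetric])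
  also have "\<dots> = (\<Sum>i<n. (if i = 0 then of_real t else 0) * x i)"
    by (intro sum.cong refl) (simp add: app_v)
  finally show ?thesis by (simp only: sum_first)
qed

lemma v_norm: "(\<Sum>i<n. (cmod (v i))\<^sup>2) = t"
proof -
  have "complex_of_real (\<Sum>i<n. (cmod (v i))\<^sup>2) = (\<Sum>i<n. cnj (v i) * v i)" by (rule sum_cnj_sq[symmetric])
  also have "\<dots> = of_real t" unfolding v_def using v_inner[of u] by (simp add: v_def u0)
  finally show ?thesis by (simp only: of_real_eq_iff)
qed

text \<open>The row with \<open>y S\<close> equal to the conjugate transpose of \<open>b\<close>: it
  expresses the mean of the channel as a mean of the white matrix.\<close>

definition y :: "nat \<Rightarrow> complex" where "y l = cnj (app w l)"

lemma y_S: "j < n \<Longrightarrow> (\<Sum>l<n. y l * S l j) = cnj (b j)"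
proof -
  assume j: "j < n"
  have "(\<Sum>l<n. y l * S l j) = cnj (\<Sum>l<n. S j l * app w l)"
    using j by (simp add: y_def herm mult.commute)
  also have "(\<Sum>l<n. S j l * app w l) = app (app w) j" by (simp add: app_def)
  finally show ?thesis using j by (simp add: app_app Rw)
qed

lemma y_norm: "complex_of_real (\<Sum>l<n. (cmod (y l))\<^sup>2) = (\<Sum>j<n. w j * cnj (b j))"
proof -
  have "complex_of_real (\<Sum>l<n. (cmod (y l))\<^sup>2) = (\<Sum>l<n. cnj (app w l) * app w l)"
    unfolding sum_cnj_sq by (simp add: y_def)
  also have "\<dots> = cnj (\<Sum>l<n. cnj (app w l) * app w l)" by (simp add: mult.commute)
  also have "(\<Sum>l<n. cnj (app w l) * app w l) = (\<Sum>j<n. cnj (w j) * app (app w) j)" by (rule app_adjoint)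
  also have "\<dots> = (\<Sum>j<n. cnj (w j) * b j)" by (intro sum.cong refl) (simp add: app_app Rw)
  finally show ?thesis by simp
qed

lemma v_y: "(\<Sum>l<n. v l * y l) = (\<Sum>j<n. u j * cnj (b j))"
proof -
  have "(\<Sum>l<n. v l * y l) = (\<Sum>l<n. \<Sum>j<n. u j * (y l * S l j))"
    by (simp add: v_def app_def sum_distrib_left sum_distrib_right mult_ac)
  also have "\<dots> = (\<Sum>j<n. \<Sum>l<n. u j * (y l * S l j))" by (rule sum.swap)
  also have "\<dots> = (\<Sum>j<n. u j * cnj (b j))"
    by (intro sum.cong refl) (simp add: y_S flip: sum_distrib_left)
  finally show ?thesis .
qed

text \<open>The conjugate of \<open>v\<close> is sent to the first axis because rows are paired with
  \<open>v\<close> bilinearly: the sum of \<open>v l * x l\<close> is the inner product of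
  \<open>x\<close> with the conjugate of \<open>v\<close>.\<close>

definition T :: "(nat \<Rightarrow> complex) \<Rightarrow> nat \<Rightarrow> complex" where
  "T = (SOME T. rot {..<n} T \<and> (\<forall>k\<in>{..<n} - {0}. T (\<lambda>l. cnj (v l)) k = 0))"

lemma T: "rot {..<n} T" "k < n \<Longrightarrow> k \<noteq> 0 \<Longrightarrow> T (\<lambda>l. cnj (v l)) k = 0"
proof -
  have "\<exists>T. rot {..<n} T \<and> (\<forall>k\<in>{..<n} - {0}. T (\<lambda>l. cnj (v l)) k = 0)"
    by (rule rot_exists[of "{..<n}" 0 "\<lambda>l. cnj (v l)"]) (use n in auto)
  from someI_ex[OF this, folded T_def] show "rot {..<n} T" "k < n \<Longrightarrow> k \<noteq> 0 \<Longrightarrow> T (\<lambda>l. cnj (v l)) k = 0"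
    by auto
qed

definition \<mu> :: complex where "\<mu> = T (\<lambda>l. cnj (v l)) 0"

lemma T_v: "k < n \<Longrightarrow> T (\<lambda>l. cnj (v l)) k = (if k = 0 then \<mu> else 0)"
  using T(2) by (simp add: \<mu>_def)

lemma T_inner: "(\<Sum>k<n. cnj (T p k) * T q k) = (\<Sum>k<n. cnj (p k) * q k)"
  by (rule rot_inner[OF T(1)]) simp

lemma T_v_inner: "cnj \<mu> * T x 0 = (\<Sum>l<n. v l * x l)"
proof -
  have "(\<Sum>l<n. v l * x l) = (\<Sum>k<n. cnj (T (\<lambda>l. cnj (v l)) k) * T x k)"
    by (simp add: T_inner)
  also have "\<dots> = (\<Sum>k<n. (if k = 0 then cnj \<mu> else 0) * T x k)"
    by (intro sum.cong refl) (simp add: T_v)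
  finally show ?thesis by (simp only: sum_first)
qed

lemma \<mu>_norm: "(cmod \<mu>)\<^sup>2 = t"
proof -
  have "t = (\<Sum>k<n. (cmod (T (\<lambda>l. cnj (v l)) k))\<^sup>2)"
    using rot_norm[OF T(1), of "\<lambda>l. cnj (v l)"] v_norm by simp
  also have "\<dots> = (\<Sum>k<n. if k = 0 then (cmod \<mu>)\<^sup>2 else 0)"
    by (intro sum.cong refl) (simp add: T_v)
  finally show ?thesis using n by simp
qed

lemma \<mu>_nz: "\<mu> \<noteq> 0" using \<mu>_norm t by auto

lemma T_y_first: "(cmod (T y 0))\<^sup>2 = (cmod (\<Sum>j<n. u j * cnj (b j)))\<^sup>2 / t"
proof -
  have "cnj \<mu> * T y 0 = (\<Sum>j<n. u j * cnj (b j))" unfolding T_v_inner v_y ..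
  then have "(cmod (\<Sum>j<n. u j * cnj (b j)))\<^sup>2 = t * (cmod (T y 0))\<^sup>2"
    by (metis \<mu>_norm complex_mod_cnj norm_mult power_mult_distrib)
  then show ?thesis using t by simp
qed

lemma sum_split_first: "(\<Sum>i<n. f i) = f 0 + (\<Sum>i\<in>{1..<n}. f i)" for f :: "nat \<Rightarrow> 'a::comm_monoid_add"
proof -
  have "{..<n} = insert 0 {1..<n}" using n by auto
  then show ?thesis by simp
qed

text \<open>Since \<open>R w = b\<close>, the squared norm of the mean row is the quadratic form of
  the inverse of \<open>R\<close> at \<open>b\<close>. Taking away its first rotated coordinate
  leaves the form of the inverse of the lower block, as \<open>pos_def_whitening\<close>
  shows.\<close>

lemma T_y_rest: "(\<Sum>k\<in>{1..<n}. (cmod (T y k))\<^sup>2) = Re (\<Sum>j<n. w j * cnj (b j)) - (cmod (\<Sum>j<n. u j * cnj (b j)))\<^sup>2 / t"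
proof -
  have "(\<Sum>k<n. (cmod (T y k))\<^sup>2) = (\<Sum>k<n. (cmod (y k))\<^sup>2)"
    by (rule rot_norm[OF T(1)]) simp
  also have "\<dots> = Re (\<Sum>j<n. w j * cnj (b j))" by (simp flip: y_norm)
  finally show ?thesis unfolding sum_split_first T_y_first by simp
qed

text \<open>Writing \<open>X\<close> for a row of the channel before colouring, \<open>X S\<close> is the channel row and \<open>T X\<close> the rotated one.\<close>
lemma colour:
  shows "(\<Sum>j<n. q j * (\<Sum>l<n. X l * S l j)) = (\<Sum>k<n. cnj (T (\<lambda>l. cnj (app q l)) k) * T X k)"
proof -
  have "(\<Sum>j<n. q j * (\<Sum>l<n. X l * S l j)) = (\<Sum>j<n. \<Sum>l<n. S l j * q j * X l)"
    by (simp add: sum_distrib_left mult_ac)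
  also have "\<dots> = (\<Sum>l<n. \<Sum>j<n. S l j * q j * X l)" by (rule sum.swap)
  also have "\<dots> = (\<Sum>l<n. app q l * X l)" by (simp add: app_def sum_distrib_right)
  finally show ?thesis by (simp add: T_inner)
qed

text \<open>The first rotated coefficient depends on \<open>q 0\<close> alone, so combinations of
  the later columns of the coloured matrix involve only the later rotated columns.\<close>

lemma colour_first: "T (\<lambda>l. cnj (app q l)) 0 = of_real t * cnj (q 0) / cnj \<mu>"
proof -
  have "cnj \<mu> * T (\<lambda>l. cnj (app q l)) 0 = cnj (\<Sum>l<n. cnj (v l) * app q l)"
    unfolding T_v_inner by simp
  also have "\<dots> = of_real t * cnj (q 0)" by (simp add: v_inner)
  finally show ?thesis using \<mu>_nz by (simp add: field_simps)
qed

lemma colour_rest: "q 0 = 0 \<Longrightarrow>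
  (\<Sum>j\<in>{1..<n}. q j * (\<Sum>l<n. X l * S l j)) = (\<Sum>k\<in>{1..<n}. cnj (T (\<lambda>l. cnj (app q l)) k) * T X k)"
  using colour[of q X] by (simp add: sum_split_first colour_first)

text \<open>The later columns of the coloured and of the rotated matrix span the same space. Modulo
  that space the combination with coefficients \<open>u\<close> identifies the first coloured column
  with \<open>cnj \<mu>\<close> times the first rotated one, and the squared modulus of \<mu> is
  \<open>t\<close>.\<close>

lemma dist2_colour:
  assumes I: "finite I"
  shows "dist2 I (\<lambda>j i. \<Sum>l<n. X i l * S l j) [1..<n] (\<lambda>i. \<Sum>l<n. X i l * S l 0)
    = t * dist2 I (\<lambda>k i. T (X i) k) [1..<n] (\<lambda>i. T (X i) 0)"
proof -
  let ?h = "\<lambda>j i. \<Sum>l<n. X i l * S l j" and ?g = "\<lambda>k i. T (X i) k"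
  have "dist2 I ?h [1..<n] (?h 0) = dist2 I ?g [1..<n] (\<lambda>i. cnj \<mu> * ?g 0 i)"
  proof (rule dist2_span[OF I])
    fix j assume "j \<in> set [1..<n]"
    then have j: "j < n" "j \<noteq> 0" by auto
    define q where "q k = (if k = j then 1 else 0 :: complex)" for k
    have q0: "q 0 = 0" using j by (simp add: q_def)
    have "(\<Sum>k\<in>{1..<n}. q k * ?h k i) = ?h j i" for i
      using j by (subst sum.remove[of _ j]) (auto simp: q_def intro!: sum.neutral)
    then have "?h j i = (\<Sum>k\<in>set [1..<n]. cnj (T (\<lambda>l. cnj (app q l)) k) * ?g k i)" for i
      using colour_rest[of q "X i", OF q0] by simp
    then show "\<exists>x. \<forall>i\<in>I. ?h j i = (\<Sum>k\<in>set [1..<n]. x k * ?g k i)"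
      by (intro exI ballI)
  next
    fix k assume "k \<in> set [1..<n]"
    then have k: "k < n" "k \<noteq> 0" by auto
    \<comment> \<open>Surjectivity of the rotation and of \<open>S\<close> yields coefficients
      \<open>q\<close> whose rotated form is this unit vector; its zero first entry forces
      \<open>q 0 = 0\<close>.\<close>
    define e where "e l = (if l = k then 1 else 0 :: complex)" for l
    obtain z where z: "T z = e" using rot_surj[OF T(1), where z = e and thesis = "\<exists>z. T z = e"] by auto
    obtain q where q: "\<forall>l<n. app q l = cnj (z l)" using app_surj[of "\<lambda>l. cnj (z l)"] by blast
    have Tq: "T (\<lambda>l. cnj (app q l)) l = e l" if "l < n" for l
      using rot_cong[OF T(1), of "\<lambda>l. cnj (app q l)" z] q that unfolding z by simp
    have q0: "q 0 = 0"
      using Tq[OF n] colour_first[of q] k t \<mu>_nz by (simp add: e_def)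
    have "?g k i = (\<Sum>l\<in>{1..<n}. cnj (T (\<lambda>l. cnj (app q l)) l) * ?g l i)" for i
      using k Tq by (subst sum.remove[of _ k]) (auto simp: e_def intro!: sum.neutral)
    then have "?g k i = (\<Sum>j\<in>set [1..<n]. q j * ?h j i)" for i
      using colour_rest[of q "X i", OF q0] by simp
    then show "\<exists>x. \<forall>i\<in>I. ?g k i = (\<Sum>j\<in>set [1..<n]. x j * ?h j i)"
      by (intro exI ballI)
  next
    have Tu: "T (\<lambda>l. cnj (app u l)) k = (if k = 0 then \<mu> else 0)" if "k < n" for k
      using T_v[OF that] by (simp add: v_def)
    have eqv: "(\<Sum>j<n. u j * ?h j i) = cnj \<mu> * ?g 0 i" for i
    proof -
      have "(\<Sum>j<n. u j * ?h j i) = (\<Sum>k<n. (if k = 0 then cnj \<mu> else 0) * T (X i) k)"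
        unfolding colour by (intro sum.cong refl) (simp add: Tu)
      then show ?thesis by (simp only: sum_first)
    qed
    have "u 0 * ?h 0 i + (\<Sum>j\<in>{1..<n}. u j * ?h j i) = cnj \<mu> * ?g 0 i" for i
      using eqv[of i] by (subst (asm) sum_split_first)
    then have "?h 0 i = cnj \<mu> * ?g 0 i + (\<Sum>j\<in>set [1..<n]. (- u j) * ?h j i)" for i
      by (simp add: u0 sum_negf eq_diff_eq)
    then show "\<exists>x. \<forall>i\<in>I. ?h 0 i = cnj \<mu> * ?g 0 i + (\<Sum>j\<in>set [1..<n]. x j * ?h j i)"
      by (intro exI ballI)
  qed auto
  also have "\<dots> = t * dist2 I ?g [1..<n] (?g 0)"
    by (subst dist2_scale[OF I]) (simp_all add: \<mu>_norm)
  finally show ?thesis .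
qed

lemma indep_cols_colour:
  assumes ind: "indep_cols I (\<lambda>k i. T (X i) k) {..<n}"
  shows "indep_cols I (\<lambda>j i. \<Sum>l<n. X i l * S l j) {..<n}"
  unfolding indep_cols_def
proof (intro allI impI)
  fix q assume "\<forall>i\<in>I. (\<Sum>j<n. q j * (\<Sum>l<n. X i l * S l j)) = 0"
  then have "\<forall>i\<in>I. (\<Sum>k<n. cnj (T (\<lambda>l. cnj (app q l)) k) * T (X i) k) = 0"
    by (simp only: colour)
  moreover have "(\<forall>i\<in>I. (\<Sum>k<n. cnj (T (\<lambda>l. cnj (app q l)) k) * T (X i) k) = 0) \<longrightarrow>
      (\<forall>k\<in>{..<n}. cnj (T (\<lambda>l. cnj (app q l)) k) = 0)"
    using ind unfolding indep_cols_def by (rule spec)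
  ultimately have "\<forall>k\<in>{..<n}. cnj (T (\<lambda>l. cnj (app q l)) k) = 0" by (rule rev_mp)
  then have "\<forall>k<n. T (\<lambda>l. cnj (app q l)) k = 0" by simp
  then have "(\<Sum>l<n. (cmod (cnj (app q l)))\<^sup>2) = 0"
    using rot_norm[OF T(1), of "\<lambda>l. cnj (app q l)"] by simp
  then have "\<forall>l<n. app q l = 0"
    by (simp add: sum_nonneg_eq_0_iff)
  then show "\<forall>j\<in>{..<n}. q j = 0" using app_inj by auto
qed

end

section \<open>Zero-forcing with matrices\<close>

lemma index_mult_mat_sum:
  assumes "A \<in> carrier_mat m n" "B \<in> carrier_mat n p" "i < m" "j < p"
  shows "(A * B) $$ (i, j) = (\<Sum>k<n. A $$ (i, k) * B $$ (k, j))"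
  using assms by (auto simp: scalar_prod_def atLeast0LessThan)

lemma index_mult_mat_vec_sum:
  assumes "A \<in> carrier_mat m n" "x \<in> carrier_vec n" "i < m"
  shows "(A *\<^sub>v x) $ i = (\<Sum>k<n. A $$ (i, k) * x $ k)"
  using assms by (auto simp: scalar_prod_def atLeast0LessThan)

lemma mat_adjoint_carrier: "A \<in> carrier_mat m n \<Longrightarrow> mat_adjoint A \<in> carrier_mat n m"
  by (auto simp: mat_adjoint_def)

lemma index_mat_adjoint:
  assumes "A \<in> carrier_mat m n" "i < n" "j < m"
  shows "mat_adjoint A $$ (i, j) = cnj (A $$ (j, i))"
  using assms by (auto simp: mat_adjoint_def mat_of_rows_index)

lemma cscalar_prod_sum:
  fixes x y :: "complex vec"
  assumes "x \<in> carrier_vec n" "y \<in> carrier_vec n"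
  shows "x \<bullet>c y = (\<Sum>i<n. x $ i * cnj (y $ i))"
  using assms by (auto simp: scalar_prod_def atLeast0LessThan)

lemma minv_inverse:
  assumes A: "A \<in> carrier_mat n n" and det: "det A \<noteq> 0"
  shows "A * minv A = 1\<^sub>m n" "minv A * A = 1\<^sub>m n" "minv A \<in> carrier_mat n n"
proof -
  have "A \<in> Units (ring_mat TYPE(complex) n ())" by (rule det_non_zero_imp_unit[OF A det])
  then obtain B where B: "mat_inverse A = Some B"
    using mat_inverse(1)[OF A, of "()"] by (cases "mat_inverse A") auto
  then show "A * minv A = 1\<^sub>m n" "minv A * A = 1\<^sub>m n" "minv A \<in> carrier_mat n n"
    using mat_inverse(2)[OF A B] by (auto simp: minv_def)
qed

lemma minv_mult_vec:
  assumes A: "A \<in> carrier_mat n n" and det: "det A \<noteq> 0" and x: "x \<in> carrier_vec n"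
  shows "A *\<^sub>v (minv A *\<^sub>v x) = x" "minv A *\<^sub>v (A *\<^sub>v x) = x"
  using minv_inverse[OF A det] A x
  by (simp_all add: assoc_mult_mat_vec[symmetric, of _ n n _ n])

text \<open>Holds also for singular \<open>A\<close>, where both sides are zero.\<close>
lemma minv_first_entry:
  assumes A: "A \<in> carrier_mat n n" and n: "0 < n"
  shows "minv A $$ (0, 0) = det (mat_delete A 0 0) / det A"
proof (cases "det A = 0")
  case True
  have "mat_inverse A = None"
  proof (rule ccontr)
    assume "mat_inverse A \<noteq> None"
    then obtain B where "mat_inverse A = Some B" by auto
    from mat_inverse(2)[OF A this] have B: "A * B = 1\<^sub>m n" "B \<in> carrier_mat n n" by auto
    have "det A * det B = 1"
      using det_mult[OF A B(2)] B(1) by simp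
    then show False using True by simp
  qed
  then show ?thesis using True A n by (simp add: minv_def)
next
  case False
  let ?B = "(1 / det A) \<cdot>\<^sub>m adj_mat A"
  note adj = adj_mat[OF A] and inv = minv_inverse[OF A False]
  have B: "?B \<in> carrier_mat n n" using adj(1) by simp
  have AB: "A * ?B = 1\<^sub>m n"
    unfolding mult_smult_distrib[OF A adj(1)] adj(2) using False by (intro eq_matI) auto
  have "minv A = minv A * (A * ?B)" using inv AB by simp
  also have "\<dots> = (minv A * A) * ?B" by (rule assoc_mult_mat[symmetric, OF inv(3) A B])
  also have "\<dots> = ?B" unfolding inv(2) by (rule left_mult_one_mat[OF B])
  finally show ?thesis
    using A n adj(1) by (simp add: adj_mat_def cofactor_def)
qed

lemma measurable_det:
  fixes A :: "'w \<Rightarrow> complex mat"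
  assumes A: "\<And>w. w \<in> space M \<Longrightarrow> A w \<in> carrier_mat n n"
    and m: "\<And>i j. i < n \<Longrightarrow> j < n \<Longrightarrow> (\<lambda>w. A w $$ (i, j)) \<in> borel_measurable M"
  shows "(\<lambda>w. det (A w)) \<in> borel_measurable M"
proof -
  have "(\<lambda>w. \<Sum>p\<in>{p. p permutes {0..<n}}. signof p * (\<Prod>i = 0..<n. A w $$ (i, p i))) \<in> borel_measurable M"
  proof (intro borel_measurable_sum borel_measurable_times borel_measurable_prod measurable_const)
    fix p i assume "p \<in> {p. p permutes {0..<n}}" and i: "i \<in> {0..<n}"
    then have "p permutes {0..<n}" by simp
    then have "p i \<in> {0..<n}" using i by (simp only: permutes_in_image)
    then show "(\<lambda>w. A w $$ (i, p i)) \<in> borel_measurable M" using i by (intro m) auto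
  qed simp
  then show ?thesis
    by (subst measurable_cong[OF det_def'[OF A]])
qed

lemma gram_entry:
  assumes H: "H \<in> carrier_mat m n" and jk: "j < n" "k < n"
  shows "(mat_adjoint H * H) $$ (j, k) = (\<Sum>i<m. cnj (H $$ (i, j)) * H $$ (i, k))"
  unfolding index_mult_mat_sum[OF mat_adjoint_carrier[OF H] H jk]
  using H jk by (intro sum.cong refl) (simp add: index_mat_adjoint)

lemma mat_delete_first_entry:
  assumes "A \<in> carrier_mat n n" "i < n - 1" "j < n - 1"
  shows "mat_delete A 0 0 $$ (i, j) = A $$ (Suc i, Suc j)"
  using assms by (auto simp: mat_delete_def)

text \<open>The entry of the inverse is a quotient of determinants at every sample point, singular
  Gram matrices included, so no exceptional set has to be handled.\<close>

lemma zf_snr_measurable: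
  assumes H: "\<And>w. w \<in> space M \<Longrightarrow> H w \<in> carrier_mat m n" and n: "0 < n"
    and meas: "\<And>i j. i < m \<Longrightarrow> j < n \<Longrightarrow> (\<lambda>w. H w $$ (i, j)) \<in> borel_measurable M"
  shows "(\<lambda>w. zf_snr g (H w)) \<in> borel_measurable M"
proof -
  let ?G = "\<lambda>w. mat_adjoint (H w) * H w"
  have G: "?G w \<in> carrier_mat n n" if "w \<in> space M" for w
    using H[OF that] mat_adjoint_carrier[OF H[OF that]] by auto
  have Gm: "(\<lambda>w. ?G w $$ (j, k)) \<in> borel_measurable M" if jk: "j < n" "k < n" for j k
  proof -
    have "(\<lambda>w. \<Sum>i<m. cnj (H w $$ (i, j)) * H w $$ (i, k)) \<in> borel_measurable M"
      using jk by (intro borel_measurable_sum borel_measurable_times measurable_compose[OF meas borel_measurable_cnj] meas) auto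
    then show ?thesis by (subst measurable_cong[OF gram_entry[OF H jk]])
  qed
  have D1: "(\<lambda>w. det (?G w)) \<in> borel_measurable M"
    by (rule measurable_det[OF G Gm])
  have D2: "(\<lambda>w. det (mat_delete (?G w) 0 0)) \<in> borel_measurable M"
  proof (rule measurable_det[where n = "n - 1"])
    fix w assume "w \<in> space M"
    then show "mat_delete (?G w) 0 0 \<in> carrier_mat (n - 1) (n - 1)" using G by (intro mat_delete_carrier)
  next
    fix i j assume ij: "i < n - 1" "j < n - 1"
    have "(\<lambda>w. ?G w $$ (Suc i, Suc j)) \<in> borel_measurable M" using ij by (intro Gm) auto
    moreover have "mat_delete (?G w) 0 0 $$ (i, j) = ?G w $$ (Suc i, Suc j)" if "w \<in> space M" for w
      by (rule mat_delete_first_entry[OF G[OF that] ij])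
    ultimately show "(\<lambda>w. mat_delete (?G w) 0 0 $$ (i, j)) \<in> borel_measurable M"
      by (subst measurable_cong)
  qed
  have "(\<lambda>w. g / Re (det (mat_delete (?G w) 0 0) / det (?G w))) \<in> borel_measurable M"
    using D1 D2 by measurable
  moreover have "zf_snr g (H w) = g / Re (det (mat_delete (?G w) 0 0) / det (?G w))" if "w \<in> space M" for w
    unfolding zf_snr_def by (simp only: minv_first_entry[OF G[OF that] n])
  ultimately show ?thesis by (subst measurable_cong)
qed

text \<open>The first column of the inverse Gram matrix yields, after normalisation, the residual of the first column
  of \<open>H\<close>.\<close>
lemma zf_snr_dist2:
  assumes H: "H \<in> carrier_mat m n" and n: "0 < n"
    and ind: "indep_cols {..<m} (\<lambda>j i. H $$ (i, j)) {..<n}"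
  shows "zf_snr g H = g * dist2 {..<m} (\<lambda>j i. H $$ (i, j)) [1..<n] (\<lambda>i. H $$ (i, 0))"
proof -
  let ?G = "mat_adjoint H * H"
  have G: "?G \<in> carrier_mat n n" using H mat_adjoint_carrier[OF H] by auto
  have Gx: "(\<Sum>k<n. ?G $$ (j, k) * x k) = (\<Sum>i<m. cnj (H $$ (i, j)) * (\<Sum>k<n. H $$ (i, k) * x k))" if j: "j < n" for j x
  proof -
    have "(\<Sum>k<n. ?G $$ (j, k) * x k) = (\<Sum>k<n. \<Sum>i<m. cnj (H $$ (i, j)) * (H $$ (i, k) * x k))"
      using j by (intro sum.cong refl) (simp add: gram_entry[OF H] sum_distrib_right mult.assoc del: index_mult_mat)
    also have "\<dots> = (\<Sum>i<m. \<Sum>k<n. cnj (H $$ (i, j)) * (H $$ (i, k) * x k))" by (rule sum.swap)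
    finally show ?thesis by (simp add: sum_distrib_left)
  qed
  have quad: "(\<Sum>j<n. cnj (x j) * (\<Sum>i<m. cnj (H $$ (i, j)) * r i)) = (\<Sum>i<m. cnj (\<Sum>j<n. H $$ (i, j) * x j) * r i)" for x r
  proof -
    have "(\<Sum>j<n. cnj (x j) * (\<Sum>i<m. cnj (H $$ (i, j)) * r i)) = (\<Sum>j<n. \<Sum>i<m. cnj (H $$ (i, j)) * cnj (x j) * r i)"
      by (simp add: sum_distrib_left mult_ac)
    also have "\<dots> = (\<Sum>i<m. \<Sum>j<n. cnj (H $$ (i, j)) * cnj (x j) * r i)" by (rule sum.swap)
    finally show ?thesis by (simp add: sum_distrib_right)
  qed
  \<comment> \<open>A vector in the kernel of the Gram matrix has zero quadratic form, so
    \<open>H\<close> maps it to zero.\<close>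
  have det: "det ?G \<noteq> 0"
  proof
    assume "det ?G = 0"
    then obtain v where v: "v \<in> carrier_vec n" "v \<noteq> 0\<^sub>v n" "?G *\<^sub>v v = 0\<^sub>v n"
      using det_0_iff_vec_prod_zero_field[OF G] by blast
    have "(\<Sum>k<n. ?G $$ (j, k) * v $ k) = 0" if "j < n" for j
      using index_mult_mat_vec_sum[OF G v(1) that] v(3) that by simp
    then have "(\<Sum>j<n. cnj (v $ j) * (\<Sum>i<m. cnj (H $$ (i, j)) * (\<Sum>k<n. H $$ (i, k) * v $ k))) = 0"
      using Gx[of _ "\<lambda>k. v $ k"] by simp
    then have "(\<Sum>i<m. cnj (\<Sum>j<n. H $$ (i, j) * v $ j) * (\<Sum>k<n. H $$ (i, k) * v $ k)) = 0"
      unfolding quad .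
    then have "(\<Sum>i<m. (cmod (\<Sum>j<n. H $$ (i, j) * v $ j))\<^sup>2) = 0"
      unfolding sum_cnj_sq by (simp only: of_real_eq_0_iff)
    then have "\<forall>i\<in>{..<m}. (\<Sum>j<n. v $ j * H $$ (i, j)) = 0"
      by (simp add: sum_nonneg_eq_0_iff mult.commute)
    then have "\<forall>j\<in>{..<n}. v $ j = 0" using ind unfolding indep_cols_def by blast
    then have "v = 0\<^sub>v n" using v(1) by (intro eq_vecI) auto
    then show False using v(2) by simp
  qed
  note inv = minv_inverse[OF G det]
  define q where "q k = minv ?G $$ (k, 0)" for k
  define r where "r i = (\<Sum>k<n. H $$ (i, k) * q k)" for i
  have orth: "(\<Sum>i<m. cnj (H $$ (i, j)) * r i) = (if j = 0 then 1 else 0)" if j: "j < n" for j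
  proof -
    have "(\<Sum>k<n. ?G $$ (j, k) * q k) = (?G * minv ?G) $$ (j, 0)"
      unfolding q_def by (rule index_mult_mat_sum[symmetric, OF G inv(3) j n])
    then show ?thesis using Gx[OF j, of q] j n unfolding inv(1) r_def by simp
  qed
  define \<rho> where "\<rho> = (\<Sum>i<m. (cmod (r i))\<^sup>2)"
  \<comment> \<open>Pairing \<open>r\<close> with itself and using that it is orthogonal to all
    columns but the first, with which it pairs to one, identifies the diagonal entry of the inverse
    with a squared norm.\<close>
  have q0: "q 0 = of_real \<rho>"
  proof -
    have "of_real \<rho> = (\<Sum>j<n. cnj (q j) * (\<Sum>i<m. cnj (H $$ (i, j)) * r i))"
      unfolding quad \<rho>_def sum_cnj_sq[symmetric] by (simp add: r_def)
    also have "\<dots> = (\<Sum>j<n. if j = 0 then cnj (q 0) else 0)"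
      by (intro sum.cong refl) (simp add: orth)
    also have "\<dots> = cnj (q 0)" using n by simp
    finally show ?thesis by (metis complex_cnj_cnj complex_cnj_complex_of_real)
  qed
  have \<rho>: "\<rho> \<noteq> 0"
  proof
    assume "\<rho> = 0"
    then have "\<forall>i<m. r i = 0" by (simp add: \<rho>_def sum_nonneg_eq_0_iff)
    then show False using orth[OF n] by simp
  qed
  have split: "(\<Sum>k<n. f k) = f 0 + (\<Sum>k\<in>{1..<n}. f k)" for f :: "nat \<Rightarrow> complex"
  proof -
    have "{..<n} = insert 0 {1..<n}" using n by auto
    then show ?thesis by simp
  qed
  have "is_resid {..<m} (\<lambda>j i. H $$ (i, j)) (set [1..<n]) (\<lambda>i. H $$ (i, 0)) (\<lambda>i. r i / q 0)"
    unfolding is_resid_def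
  proof (intro conjI exI[of _ "\<lambda>k. - q k / q 0"] ballI)
    fix i
    show "r i / q 0 = H $$ (i, 0) - (\<Sum>j\<in>set [1..<n]. - q j / q 0 * H $$ (i, j))"
      using \<rho> unfolding r_def split[of "\<lambda>k. H $$ (i, k) * q k"]
      by (simp add: q0 add_divide_distrib sum_divide_distrib sum_negf mult.commute)
  next
    fix j assume "j \<in> set [1..<n]"
    then have "(\<Sum>i<m. cnj (H $$ (i, j)) * r i) / q 0 = 0" by (simp add: orth)
    then show "(\<Sum>i<m. cnj (H $$ (i, j)) * (r i / q 0)) = 0" by (simp add: sum_divide_distrib)
  qed
  from dist2_eqI[OF _ _ this]
  have "dist2 {..<m} (\<lambda>j i. H $$ (i, j)) [1..<n] (\<lambda>i. H $$ (i, 0)) = (\<Sum>i<m. (cmod (r i / q 0))\<^sup>2)"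
    by simp
  also have "\<dots> = (\<Sum>i<m. (cmod (r i))\<^sup>2) / \<rho>\<^sup>2"
    unfolding q0 norm_divide power_divide norm_of_real power2_abs sum_divide_distrib ..
  also have "(\<Sum>i<m. (cmod (r i))\<^sup>2) = \<rho>" by (simp add: \<rho>_def)
  also have "\<rho> / \<rho>\<^sup>2 = 1 / \<rho>" using \<rho> by (simp add: power2_eq_square)
  finally show ?thesis
    unfolding zf_snr_def q_def[symmetric] by (simp add: q0)
qed

section \<open>Positive definite matrices and their blocks\<close>

lemma hermitian_mat_entry:
  assumes "hermitian_mat n A" "i < n" "j < n"
  shows "cnj (A $$ (i, j)) = A $$ (j, i)"
  using assms index_mat_adjoint[of A n n j i] by (simp add: hermitian_mat_def)

lemma hermitian_mat_carrier: "hermitian_mat n A \<Longrightarrow> A \<in> carrier_mat n n"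
  by (simp add: hermitian_mat_def)

lemma quadratic_form:
  assumes "A \<in> carrier_mat n n" "v \<in> carrier_vec n"
  shows "(A *\<^sub>v v) \<bullet>c v = (\<Sum>i<n. cnj (v $ i) * (\<Sum>j<n. A $$ (i, j) * v $ j))"
proof -
  have "(A *\<^sub>v v) \<bullet>c v = (\<Sum>i<n. (A *\<^sub>v v) $ i * cnj (v $ i))"
    using assms by (intro cscalar_prod_sum) auto
  also have "\<dots> = (\<Sum>i<n. cnj (v $ i) * (\<Sum>j<n. A $$ (i, j) * v $ j))"
    using assms by (intro sum.cong refl) (simp add: index_mult_mat_vec_sum mult.commute del: index_mult_mat_vec)
  finally show ?thesis .
qed

lemma hermitian_pos_defD:
  assumes R: "hermitian_pos_def n R" and x: "j < n" "x j \<noteq> 0"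
  shows "0 < Re (\<Sum>i<n. cnj (x i) * (\<Sum>j<n. R $$ (i, j) * x j))"
proof -
  have Rc: "R \<in> carrier_mat n n" using R by (simp add: hermitian_pos_def_def hermitian_mat_def)
  have "vec n x \<noteq> 0\<^sub>v n" using x by (metis index_vec index_zero_vec(1))
  then have "0 < Re ((R *\<^sub>v vec n x) \<bullet>c vec n x)"
    using R by (simp add: hermitian_pos_def_def)
  then show ?thesis by (simp add: quadratic_form[OF Rc])
qed

lemma hermitian_pos_def_det:
  assumes R: "hermitian_pos_def n R"
  shows "det R \<noteq> 0"
proof
  have Rc: "R \<in> carrier_mat n n" using R by (simp add: hermitian_pos_def_def hermitian_mat_def)
  assume "det R = 0"
  then obtain v where v: "v \<in> carrier_vec n" "v \<noteq> 0\<^sub>v n" "R *\<^sub>v v = 0\<^sub>v n"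
    using det_0_iff_vec_prod_zero_field[OF Rc] by blast
  have "0 < Re ((R *\<^sub>v v) \<bullet>c v)" using R v(1,2) unfolding hermitian_pos_def_def by blast
  moreover have "(R *\<^sub>v v) \<bullet>c v = 0"
    unfolding v(3) using v(1) by (subst cscalar_prod_sum[of _ n]) auto
  ultimately show False by simp
qed

lemma hermitian_pos_def_smult:
  assumes A: "hermitian_pos_def n A" and c: "0 < c"
  shows "hermitian_pos_def n (complex_of_real c \<cdot>\<^sub>m A)"
proof -
  have Ac: "A \<in> carrier_mat n n" using A by (simp add: hermitian_pos_def_def hermitian_mat_def)
  have herm: "hermitian_mat n A" using A by (simp add: hermitian_pos_def_def)
  have cA: "complex_of_real c \<cdot>\<^sub>m A \<in> carrier_mat n n" using Ac by simp
  have "mat_adjoint (complex_of_real c \<cdot>\<^sub>m A) = complex_of_real c \<cdot>\<^sub>m A"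
    using mat_adjoint_carrier[OF cA] Ac
    by (intro eq_matI) (auto simp: index_mat_adjoint[OF cA] hermitian_mat_entry[OF herm])
  moreover have "0 < Re (((complex_of_real c \<cdot>\<^sub>m A) *\<^sub>v v) \<bullet>c v)" if v: "v \<in> carrier_vec n" "v \<noteq> 0\<^sub>v n" for v
  proof -
    have "((complex_of_real c \<cdot>\<^sub>m A) *\<^sub>v v) \<bullet>c v = complex_of_real c * ((A *\<^sub>v v) \<bullet>c v)"
      unfolding quadratic_form[OF cA v(1)] quadratic_form[OF Ac v(1)] sum_distrib_left
      using Ac by (intro sum.cong refl) (simp add: mult_ac)
    moreover have "0 < Re ((A *\<^sub>v v) \<bullet>c v)" using A v by (simp add: hermitian_pos_def_def)
    ultimately show ?thesis using c by simp
  qed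
  ultimately show ?thesis using cA by (simp add: hermitian_pos_def_def hermitian_mat_def)
qed

lemma block22_entry:
  assumes "R \<in> carrier_mat (Suc m) (Suc m)" "i < m" "j < m"
  shows "block22 R $$ (i, j) = R $$ (Suc i, Suc j)"
  using assms mat_delete_first_entry[OF assms(1), of i j] by (simp add: block22_def)

lemma block22_carrier: "R \<in> carrier_mat (Suc m) (Suc m) \<Longrightarrow> block22 R \<in> carrier_mat m m"
  by (auto simp: block22_def mat_delete_def)

text \<open>The vector \<open>u\<close> with entries one and minus \<open>r21\<close> is mapped by
  \<open>R\<close> to \<open>t\<close> times the first unit vector, \<open>t\<close> being the Schur
  complement of the lower block; hence the first entry of the inverse is \<open>1 / t\<close>. Block
  elimination in \<open>R w = b\<close> splits the quadratic form of the inverse of \<open>R\<close>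
  at \<open>b\<close> into \<open>x2_param\<close> and the contribution of
  \<open>mu1\<close>.\<close>

lemma pos_def_whitening:
  assumes R: "hermitian_pos_def n R" and S: "is_hermitian_sqrt n S R" and n: "2 \<le> n" and b: "b \<in> carrier_vec n"
  obtains u w t where "whitening n (\<lambda>i j. S $$ (i, j)) (\<lambda>i j. R $$ (i, j)) u w (\<lambda>i. b $ i) t"
    and "Re (minv R $$ (0, 0)) = 1 / t"
    and "(\<Sum>j<n. u j * cnj (b $ j)) = mu1 R b"
    and "Re (\<Sum>j<n. w j * cnj (b $ j)) = x2_param R b + (cmod (mu1 R b))\<^sup>2 / t"
proof -
  obtain m where nm: "n = Suc m" using n by (cases n) auto
  have herm: "hermitian_mat n R" using R by (simp add: hermitian_pos_def_def)
  note Rc = hermitian_mat_carrier[OF herm] and Rherm = hermitian_mat_entry[OF herm]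
  have Rc': "R \<in> carrier_mat (Suc m) (Suc m)" using Rc nm by simp
  have Sherm: "hermitian_mat n S" and SS: "S * S = R"
    using S by (auto simp: is_hermitian_sqrt_def hermitian_pos_semidef_def)
  note Sc = hermitian_mat_carrier[OF Sherm]
  let ?C = "block22 R"
  have C: "?C \<in> carrier_mat m m" by (rule block22_carrier[OF Rc'])
  have detC: "det ?C \<noteq> 0"
  proof
    assume "det ?C = 0"
    then obtain v where v: "v \<in> carrier_vec m" "v \<noteq> 0\<^sub>v m" "?C *\<^sub>v v = 0\<^sub>v m"
      using det_0_iff_vec_prod_zero_field[OF C] by blast
    \<comment> \<open>Extended by zero, a kernel vector of the block has zero quadratic form under
      \<open>R\<close>, against positive definiteness.\<close>
    define x where "x i = (case i of 0 \<Rightarrow> 0 | Suc k \<Rightarrow> v $ k)" for i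
    obtain k where k: "k < m" "v $ k \<noteq> 0" using v by (metis eq_vecI carrier_vecD index_zero_vec)
    have "(\<Sum>j<m. R $$ (Suc i, Suc j) * v $ j) = 0" if "i < m" for i
    proof -
      have "(\<Sum>j<m. R $$ (Suc i, Suc j) * v $ j) = (?C *\<^sub>v v) $ i"
        unfolding index_mult_mat_vec_sum[OF C v(1) that] using that by (intro sum.cong refl) (simp add: block22_entry[OF Rc'])
      then show ?thesis using v(3) that by simp
    qed
    then have "(\<Sum>i<n. cnj (x i) * (\<Sum>j<n. R $$ (i, j) * x j)) = 0"
      unfolding nm sum.lessThan_Suc_shift x_def by simp
    then show False using hermitian_pos_defD[OF R, of "Suc k" x] k nm by (simp add: x_def)
  qed
  let ?r = "r21 R"
  define q where "q = minv ?C *\<^sub>v tail_vec b"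
  have rho: "block21 R \<in> carrier_vec m" "\<And>i. i < m \<Longrightarrow> block21 R $ i = R $$ (Suc i, 0)"
    using Rc' by (auto simp: block21_def vec_last_def)
  have tb: "tail_vec b \<in> carrier_vec m" "\<And>i. i < m \<Longrightarrow> tail_vec b $ i = b $ Suc i"
    using b nm by (auto simp: tail_vec_def vec_last_def)
  have rc: "?r \<in> carrier_vec m" and qc: "q \<in> carrier_vec m"
    using minv_inverse(3)[OF C detC] rho(1) tb(1) by (auto simp: r21_def q_def)
  have Cr: "(\<Sum>j<m. R $$ (Suc i, Suc j) * ?r $ j) = R $$ (Suc i, 0)" if i: "i < m" for i
  proof -
    have "(\<Sum>j<m. R $$ (Suc i, Suc j) * ?r $ j) = (?C *\<^sub>v ?r) $ i"
      unfolding index_mult_mat_vec_sum[OF C rc i] using i by (intro sum.cong refl) (simp add: block22_entry[OF Rc'])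
    also have "?C *\<^sub>v ?r = block21 R" unfolding r21_def by (rule minv_mult_vec(1)[OF C detC rho(1)])
    finally show ?thesis using rho(2)[OF i] by simp
  qed
  have Cq: "(\<Sum>j<m. R $$ (Suc i, Suc j) * q $ j) = b $ Suc i" if i: "i < m" for i
  proof -
    have "(\<Sum>j<m. R $$ (Suc i, Suc j) * q $ j) = (?C *\<^sub>v q) $ i"
      unfolding index_mult_mat_vec_sum[OF C qc i] using i by (intro sum.cong refl) (simp add: block22_entry[OF Rc'])
    also have "?C *\<^sub>v q = tail_vec b" unfolding q_def by (rule minv_mult_vec(1)[OF C detC tb(1)])
    finally show ?thesis using tb(2)[OF i] by simp
  qed
  define u where "u i = (case i of 0 \<Rightarrow> 1 | Suc k \<Rightarrow> - ?r $ k)" for i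
  define t where "t = Re (\<Sum>j<n. R $$ (0, j) * u j)"
  have adj: "(\<Sum>i<n. cnj (\<Sum>j<n. R $$ (i, j) * x j) * z i) = (\<Sum>i<n. cnj (x i) * (\<Sum>j<n. R $$ (i, j) * z j))" for x z
  proof -
    have "(\<Sum>i<n. cnj (\<Sum>j<n. R $$ (i, j) * x j) * z i) = (\<Sum>i<n. \<Sum>j<n. cnj (x j) * (R $$ (j, i) * z i))"
      by (simp add: sum_distrib_left sum_distrib_right Rherm mult_ac)
    also have "\<dots> = (\<Sum>j<n. \<Sum>i<n. cnj (x j) * (R $$ (j, i) * z i))" by (rule sum.swap)
    finally show ?thesis by (simp add: sum_distrib_left)
  qed
  have Ru_Suc: "(\<Sum>j<n. R $$ (i, j) * u j) = 0" if "i < n" "i \<noteq> 0" for i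
  proof -
    define k where "k = i - 1"
    have k: "i = Suc k" "k < m" using that nm by (auto simp: k_def)
    show ?thesis unfolding nm sum.lessThan_Suc_shift using Cr[OF k(2)] by (simp add: u_def k(1) sum_negf)
  qed
  have first: "(\<Sum>i<n. (if i = 0 then c else 0) * f i) = c * f 0" for c :: complex and f
    using n by (subst sum.remove[of _ 0]) (auto intro!: sum.neutral)
  have quad_u: "(\<Sum>i<n. cnj (u i) * (\<Sum>j<n. R $$ (i, j) * u j)) = (\<Sum>j<n. R $$ (0, j) * u j)"
  proof -
    have "(\<Sum>i<n. cnj (u i) * (\<Sum>j<n. R $$ (i, j) * u j)) = (\<Sum>i<n. if i = 0 then (\<Sum>j<n. R $$ (0, j) * u j) else 0)"
      using Ru_Suc by (intro sum.cong refl) (auto simp: u_def)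
    then show ?thesis using n by simp
  qed
  have t: "0 < t"
    unfolding t_def quad_u[symmetric] using n by (intro hermitian_pos_defD[OF R, of 0]) (auto simp: u_def)
  \<comment> \<open>The sum is the quadratic form of a Hermitian matrix at \<open>u\<close>, hence
    real, so that taking the real part in \<open>t\<close> loses nothing.\<close>
  have t_eq: "(\<Sum>j<n. R $$ (0, j) * u j) = of_real t"
  proof -
    let ?z = "\<Sum>i<n. cnj (u i) * (\<Sum>j<n. R $$ (i, j) * u j)"
    have "cnj ?z = (\<Sum>i<n. cnj (\<Sum>j<n. R $$ (i, j) * u j) * u i)" by (simp add: mult.commute)
    also have "\<dots> = ?z" by (rule adj)
    finally have "cnj ?z = ?z" .
    moreover have "cnj z = z \<Longrightarrow> z = of_real (Re z)" for z
      by (simp add: complex_eq_iff)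
    ultimately have "?z = of_real (Re ?z)" by blast
    then show ?thesis unfolding quad_u t_def .
  qed
  have Ru: "(\<Sum>j<n. R $$ (i, j) * u j) = (if i = 0 then of_real t else 0)" if "i < n" for i
    using Ru_Suc[OF that] t_eq by auto
  \<comment> \<open>\<open>q'\<close> solves all equations of \<open>R w = b\<close> but the first.
    Adding a multiple of \<open>u\<close> repairs that one and leaves the others intact.\<close>
  define q' where "q' i = (case i of 0 \<Rightarrow> 0 | Suc k \<Rightarrow> q $ k)" for i
  define \<beta> where "\<beta> = (b $ 0 - (\<Sum>j<n. R $$ (0, j) * q' j)) / of_real t"
  define w where "w i = q' i + \<beta> * u i" for i
  have Rw: "(\<Sum>j<n. R $$ (i, j) * w j) = b $ i" if i: "i < n" for i
  proof -
    have *: "(\<Sum>j<n. R $$ (i, j) * w j) = (\<Sum>j<n. R $$ (i, j) * q' j) + \<beta> * (\<Sum>j<n. R $$ (i, j) * u j)"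
      by (simp add: w_def distrib_left sum.distrib sum_distrib_left mult_ac)
    show ?thesis
    proof (cases i)
      case 0
      then show ?thesis unfolding * using Ru[OF i] t by (simp add: \<beta>_def)
    next
      case (Suc k)
      then have k: "k < m" using i nm by simp
      have "(\<Sum>j<n. R $$ (i, j) * q' j) = b $ i"
        unfolding nm sum.lessThan_Suc_shift Suc using Cq[OF k] by (simp add: q'_def)
      then show ?thesis unfolding * using Ru[OF i] Suc by simp
    qed
  qed
  have mu: "(\<Sum>j<n. u j * cnj (b $ j)) = mu1 R b"
    unfolding nm sum.lessThan_Suc_shift mu1_def cscalar_prod_sum[OF rc tb(1)]
    by (simp add: u_def tb(2) sum_negf)
  have \<beta>t: "of_real t * \<beta> = cnj (mu1 R b)"
  proof -
    \<comment> \<open>Pairing \<open>R w = b\<close> with \<open>u\<close> and moving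
      \<open>R\<close> to the other side leaves \<open>t * w 0\<close>, which evaluates
      \<beta>.\<close>
    have "cnj (mu1 R b) = (\<Sum>i<n. cnj (u i) * (\<Sum>j<n. R $$ (i, j) * w j))"
      unfolding mu[symmetric] by (simp add: Rw)
    also have "\<dots> = (\<Sum>i<n. (if i = 0 then of_real t else 0) * w i)"
      unfolding adj[symmetric] by (intro sum.cong refl) (simp add: Ru)
    also have "\<dots> = of_real t * w 0" by (rule first)
    finally show ?thesis by (simp add: w_def q'_def u_def)
  qed
  have "(\<Sum>j<n. w j * cnj (b $ j)) = (\<Sum>j<n. q' j * cnj (b $ j)) + \<beta> * mu1 R b"
    unfolding mu[symmetric] by (simp add: w_def ring_distribs sum.distrib sum_distrib_left mult_ac)
  also have "(\<Sum>j<n. q' j * cnj (b $ j)) = q \<bullet>c tail_vec b"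
    unfolding nm sum.lessThan_Suc_shift cscalar_prod_sum[OF qc tb(1)] by (simp add: q'_def tb(2))
  also have "\<beta> * mu1 R b = of_real ((cmod (mu1 R b))\<^sup>2 / t)"
  proof -
    have "\<beta> = cnj (mu1 R b) / of_real t" using \<beta>t t by (simp add: field_simps)
    then show ?thesis by (simp add: mult.commute flip: complex_norm_square)
  qed
  finally have x2: "Re (\<Sum>j<n. w j * cnj (b $ j)) = x2_param R b + (cmod (mu1 R b))\<^sup>2 / t"
    by (simp add: x2_param_def q_def)
  have detR: "det R \<noteq> 0" by (rule hermitian_pos_def_det[OF R])
  have minv00: "minv R $$ (0, 0) = of_real (1 / t)"
  proof -
    let ?u = "vec n u"
    note inv = minv_inverse[OF Rc detR]
    have "(R *\<^sub>v ?u) $ k = (if k = 0 then of_real t else 0)" if "k < n" for k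
      using index_mult_mat_vec_sum[OF Rc, of ?u k] that Ru[OF that] by (simp del: index_mult_mat_vec)
    then have "(\<Sum>k<n. minv R $$ (0, k) * (R *\<^sub>v ?u) $ k) = (\<Sum>k<n. (if k = 0 then of_real t else 0) * minv R $$ (0, k))"
      by (intro sum.cong refl) (simp add: mult.commute del: index_mult_mat_vec)
    also have "\<dots> = of_real t * minv R $$ (0, 0)" by (rule first)
    also have "(\<Sum>k<n. minv R $$ (0, k) * (R *\<^sub>v ?u) $ k) = (minv R *\<^sub>v (R *\<^sub>v ?u)) $ 0"
      using Rc n by (intro index_mult_mat_vec_sum[symmetric, OF inv(3)]) auto
    also have "minv R *\<^sub>v (R *\<^sub>v ?u) = ?u" by (rule minv_mult_vec(2)[OF Rc detR]) simp
    also have "?u $ 0 = 1" using n by (simp add: u_def)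
    finally show ?thesis using t by (simp add: field_simps)
  qed
  have SSe: "(\<Sum>k<n. S $$ (i, k) * S $$ (k, j)) = R $$ (i, j)" if "i < n" "j < n" for i j
    using index_mult_mat_sum[OF Sc Sc that] SS by simp
  have detS: "det S \<noteq> 0" using det_mult[OF Sc Sc] SS detR by auto
  have "whitening n (\<lambda>i j. S $$ (i, j)) (\<lambda>i j. R $$ (i, j)) u w (\<lambda>i. b $ i) t"
  proof
    show "0 < n" using n by simp
    show "u 0 = 1" by (simp add: u_def)
    fix x :: "nat \<Rightarrow> complex" and j
    assume x: "\<And>i. i < n \<Longrightarrow> (\<Sum>j<n. S $$ (i, j) * x j) = 0" and j: "j < n"
    have "S *\<^sub>v vec n x = 0\<^sub>v n"
      using x Sc index_mult_mat_vec_sum[OF Sc, of "vec n x"] by (intro eq_vecI) (auto simp del: index_mult_mat_vec)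
    then have "vec n x = 0\<^sub>v n"
      using det_0_iff_vec_prod_zero_field[OF Sc] detS by (metis vec_carrier)
    then show "x j = 0" using j by (metis index_vec index_zero_vec(1))
  next
    fix z :: "nat \<Rightarrow> complex"
    let ?q = "minv S *\<^sub>v vec n z"
    have q: "?q \<in> carrier_vec n" using minv_inverse(3)[OF Sc detS] by auto
    have "(\<Sum>j<n. S $$ (i, j) * ?q $ j) = z i" if "i < n" for i
      using index_mult_mat_vec_sum[OF Sc q that] minv_mult_vec(1)[OF Sc detS, of "vec n z"] that
      by (simp del: index_mult_mat_vec)
    then show "\<exists>q. \<forall>i<n. (\<Sum>j<n. S $$ (i, j) * q j) = z i" by (intro exI[of _ "\<lambda>j. ?q $ j"]) simp
  qed (use t Ru Rw SSe hermitian_mat_entry[OF Sherm] in auto)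
  then show thesis by (rule that[OF _ _ mu x2]) (simp add: minv00)
qed

text \<open>On a nonempty index set, independence says that the joint law is the product of the
  marginals; positive dimensions guarantee nonemptiness.\<close>

lemma distr_iid_std_cgauss_mat:
  assumes M: "prob_space M" and W: "iid_std_cgauss_mat M m n W" and mn: "0 < m" "0 < n"
  shows "(\<lambda>\<omega>. \<lambda>p\<in>{..<m} \<times> {..<n}. W \<omega> $$ p) \<in> M \<rightarrow>\<^sub>M cgauss_vec ({..<m} \<times> {..<n})"
    and "distr M (cgauss_vec ({..<m} \<times> {..<n})) (\<lambda>\<omega>. \<lambda>p\<in>{..<m} \<times> {..<n}. W \<omega> $$ p) = cgauss_vec ({..<m} \<times> {..<n})"
proof -
  interpret prob_space M by (rule M)
  let ?X = "{..<m} \<times> {..<n}"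
  have dist: "distributed M lborel (\<lambda>\<omega>. W \<omega> $$ p) (\<lambda>z. ennreal (std_cgauss_density z))" if "p \<in> ?X" for p
    using W that by (auto simp: iid_std_cgauss_mat_def)
  have rv: "(\<lambda>\<omega>. W \<omega> $$ p) \<in> borel_measurable M" if "p \<in> ?X" for p
    using distributed_measurable[OF dist[OF that]] by simp
  have law: "distr M borel (\<lambda>\<omega>. W \<omega> $$ p) = cgauss" if "p \<in> ?X" for p
  proof -
    have "distr M borel (\<lambda>\<omega>. W \<omega> $$ p) = distr M lborel (\<lambda>\<omega>. W \<omega> $$ p)"
      by (intro distr_cong) auto
    also have "\<dots> = cgauss" unfolding cgauss_def by (rule distributed_distr_eq_density[OF dist[OF that]])
    finally show ?thesis .
  qed
  have ind: "indep_vars (\<lambda>_. borel) (\<lambda>p \<omega>. W \<omega> $$ p) ?X"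
    using W by (simp add: iid_std_cgauss_mat_def case_prod_unfold)
  have ne: "?X \<noteq> {}" using mn by (auto simp: lessThan_empty_iff)
  have "distr M (Pi\<^sub>M ?X (\<lambda>_. borel)) (\<lambda>\<omega>. \<lambda>p\<in>?X. W \<omega> $$ p) = Pi\<^sub>M ?X (\<lambda>p. distr M borel (\<lambda>\<omega>. W \<omega> $$ p))"
    using indep_vars_iff_distr_eq_PiM'[where M' = "\<lambda>_. borel" and X = "\<lambda>p \<omega>. W \<omega> $$ p", OF ne] rv ind by simp
  also have "\<dots> = cgauss_vec ?X" by (intro PiM_cong refl) (simp add: law)
  finally have *: "distr M (Pi\<^sub>M ?X (\<lambda>_. borel)) (\<lambda>\<omega>. \<lambda>p\<in>?X. W \<omega> $$ p) = cgauss_vec ?X" .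
  have s: "sets (cgauss_vec ?X) = sets (Pi\<^sub>M ?X (\<lambda>_. borel))"
    by (intro sets_PiM_cong) auto
  have "distr M (cgauss_vec ?X) (\<lambda>\<omega>. \<lambda>p\<in>?X. W \<omega> $$ p) = distr M (Pi\<^sub>M ?X (\<lambda>_. borel)) (\<lambda>\<omega>. \<lambda>p\<in>?X. W \<omega> $$ p)"
    by (intro distr_cong refl) (simp_all only: s)
  then show "distr M (cgauss_vec ?X) (\<lambda>\<omega>. \<lambda>p\<in>?X. W \<omega> $$ p) = cgauss_vec ?X"
    by (simp only: *)
  show "(\<lambda>\<omega>. \<lambda>p\<in>?X. W \<omega> $$ p) \<in> M \<rightarrow>\<^sub>M cgauss_vec ?X"
    using rv by (intro measurable_restrict) (simp cong: measurable_cong_sets)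
qed

theorem theorem2:
  fixes N\<^sub>T N\<^sub>R N :: nat
    and K \<Gamma>\<^sub>s \<Gamma>\<^sub>1 x\<^sub>1 x\<^sub>2 :: real
    and R\<^sub>T R Rsqrt H\<^sub>d :: "complex mat"
    and a b :: "complex vec"
    and M :: "'w measure"
    and H\<^sub>w H\<^sub>r H :: "'w \<Rightarrow> complex mat"
    and \<gamma>\<^sub>1 :: "'w \<Rightarrow> real"
    and s :: complex
  assumes "2 \<le> N\<^sub>T" and "N\<^sub>T \<le> N\<^sub>R" and "K > 0" and "\<Gamma>\<^sub>s > 0"
    and "hermitian_pos_def N\<^sub>T R\<^sub>T" and "(\<Sum>i<N\<^sub>T. R\<^sub>T $$ (i, i)) = of_nat N\<^sub>T"
    and "a \<in> carrier_vec N\<^sub>R" and "euclid_norm a = 1"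
    and "b \<in> carrier_vec N\<^sub>T" and "\<forall>i<N\<^sub>T. b $ i \<noteq> 0"
    and "(euclid_norm b)\<^sup>2 = K / (K + 1) * real N\<^sub>R * real N\<^sub>T"
    and "prob_space M" and "iid_std_cgauss_mat M N\<^sub>R N\<^sub>T H\<^sub>w"
  defines "N \<equiv> N\<^sub>R - N\<^sub>T + 1"
    and "R \<equiv> complex_of_real (1 / (K + 1)) \<cdot>\<^sub>m R\<^sub>T"
  assumes "is_hermitian_sqrt N\<^sub>T Rsqrt R"
  defines "H\<^sub>d \<equiv> outer_prod a b"
    and "H\<^sub>r \<equiv> (\<lambda>\<omega>. H\<^sub>w \<omega> * Rsqrt)"
    and "H \<equiv> (\<lambda>\<omega>. H\<^sub>d + H\<^sub>r \<omega>)"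
    and "\<gamma>\<^sub>1 \<equiv> (\<lambda>\<omega>. zf_snr \<Gamma>\<^sub>s (H \<omega>))"
    and "\<Gamma>\<^sub>1 \<equiv> Gamma1 \<Gamma>\<^sub>s R"
    and "x\<^sub>1 \<equiv> x1_param R b"
    and "x\<^sub>2 \<equiv> x2_param R b"
  assumes "Re s < 1 / \<Gamma>\<^sub>1"
  shows "integrable M (\<lambda>\<omega>. exp (s * complex_of_real (\<gamma>\<^sub>1 \<omega>))) \<and>
    summable (\<lambda>n\<^sub>2. exp (- complex_of_real x\<^sub>2) * complex_of_real x\<^sub>2 ^ n\<^sub>2 / fact n\<^sub>2 *
        hyp1F1 (of_nat N) (of_nat (n\<^sub>2 + N\<^sub>R)) (\<Gamma>\<^sub>1 * s / (1 - \<Gamma>\<^sub>1 * s) * x\<^sub>1)) \<and>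
    mgf M \<gamma>\<^sub>1 s = 1 / (1 - \<Gamma>\<^sub>1 * s) ^ N *
      (\<Sum>n\<^sub>2. exp (- complex_of_real x\<^sub>2) * complex_of_real x\<^sub>2 ^ n\<^sub>2 / fact n\<^sub>2 *
        hyp1F1 (of_nat N) (of_nat (n\<^sub>2 + N\<^sub>R)) (\<Gamma>\<^sub>1 * s / (1 - \<Gamma>\<^sub>1 * s) * x\<^sub>1))"
proof -
  have pdR: "hermitian_pos_def N\<^sub>T R"
    unfolding R_def using assms(3,5) by (intro hermitian_pos_def_smult) auto
  have Sc: "Rsqrt \<in> carrier_mat N\<^sub>T N\<^sub>T"
    using assms(16) by (simp add: is_hermitian_sqrt_def hermitian_pos_semidef_def hermitian_mat_def)
  obtain u w t where wh: "whitening N\<^sub>T (\<lambda>i j. Rsqrt $$ (i, j)) (\<lambda>i j. R $$ (i, j)) u w (\<lambda>i. b $ i) t"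
    and t: "Re (minv R $$ (0, 0)) = 1 / t"
    and mu: "(\<Sum>j<N\<^sub>T. u j * cnj (b $ j)) = mu1 R b"
    and x2: "Re (\<Sum>j<N\<^sub>T. w j * cnj (b $ j)) = x2_param R b + (cmod (mu1 R b))\<^sup>2 / t"
    by (rule pos_def_whitening[OF pdR assms(16,1,9)])
  interpret W: whitening N\<^sub>T "\<lambda>i j. Rsqrt $$ (i, j)" "\<lambda>i j. R $$ (i, j)" u w "\<lambda>i. b $ i" t by (rule wh)
  interpret P: prob_space M by (rule assms(12))
  let ?I = "{..<N\<^sub>R}" and ?J = "{..<N\<^sub>T}" and ?js = "[1..<N\<^sub>T]"
  let ?X = "?I \<times> ?J"
  \<comment> \<open>The rotated mean row: the squared modulus of its first entry is
    \<open>x\<^sub>1\<close>, those of the remaining entries add up to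
    \<open>x\<^sub>2\<close>.\<close>
  define c where "c = W.T W.y"
  define D where "D z = dist2 ?I (\<lambda>j i. z (i, j) + a $ i * c j) ?js (\<lambda>i. z (i, 0) + a $ i * c 0)" for z
  have pos: "0 < N\<^sub>R" "0 < N\<^sub>T" using assms(1,2) by auto
  have set_js: "set (0 # ?js) = ?J" using pos by auto
  have dist_js: "distinct (0 # ?js)" by simp
  have ne_js: "?js \<noteq> []" using assms(1) by simp
  have len: "length ?js < card ?I" using assms(1,2) by simp
  have N: "card ?I - length ?js = N" using assms(1,2) by (simp add: N_def)
  have a1: "(\<Sum>i\<in>?I. (cmod (a $ i))\<^sup>2) = 1"
    using assms(7,8) by (auto simp: euclid_norm_def L2_set_def)
  have x1: "(cmod (c 0))\<^sup>2 = x\<^sub>1"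
    unfolding c_def W.T_y_first mu x\<^sub>1_def x1_param_def t by simp
  have x2': "(\<Sum>j\<in>set ?js. (cmod (c j))\<^sup>2) = x\<^sub>2"
    unfolding c_def x\<^sub>2_def using W.T_y_rest mu x2 by simp
  have \<Gamma>1: "\<Gamma>\<^sub>1 = \<Gamma>\<^sub>s * t" by (simp add: \<Gamma>\<^sub>1_def Gamma1_def t)
  have \<Gamma>1_pos: "0 < \<Gamma>\<^sub>1" unfolding \<Gamma>1 using assms(4) W.t by simp
  define \<tau> where "\<tau> = \<Gamma>\<^sub>1 * s"
  have \<tau>: "Re \<tau> < 1"
    using assms(24) \<Gamma>1_pos by (simp add: \<tau>_def field_simps)
  \<comment> \<open>Right multiplication of the white matrix by a unitary factor, written as one
    rotation of all its entries.\<close>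
  obtain T' where T': "rot ?X T'" "\<And>z r k. r \<in> ?I \<Longrightarrow> k \<in> ?J \<Longrightarrow> T' z (r, k) = W.T (\<lambda>k. z (r, k)) k"
    by (rule rot_lift[OF W.T(1), of ?I Pair ?X]) auto
  define Z where "Z \<omega> = (\<lambda>p\<in>?X. H\<^sub>w \<omega> $$ p)" for \<omega>
  have Zm: "Z \<in> M \<rightarrow>\<^sub>M cgauss_vec ?X" and Zd: "distr M (cgauss_vec ?X) Z = cgauss_vec ?X"
    using distr_iid_std_cgauss_mat[OF assms(12,13) pos] by (simp_all only: Z_def[abs_def])
  define Y where "Y \<omega> = T' (Z \<omega>)" for \<omega>
  have Ym: "Y \<in> M \<rightarrow>\<^sub>M cgauss_vec ?X"
    unfolding Y_def using Zm measurable_rot[OF T'(1)] by (rule measurable_compose)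
  have "distr M (cgauss_vec ?X) Y = distr (distr M (cgauss_vec ?X) Z) (cgauss_vec ?X) T'"
    unfolding Y_def by (subst distr_distr[OF measurable_rot[OF T'(1)] Zm]) (simp add: comp_def)
  also have "\<dots> = cgauss_vec ?X" unfolding Zd by (rule distr_rot[OF T'(1)]) simp
  finally have Yd: "distr M (cgauss_vec ?X) Y = cgauss_vec ?X" .
  have Hw: "H\<^sub>w \<omega> \<in> carrier_mat N\<^sub>R N\<^sub>T" if "\<omega> \<in> space M" for \<omega>
    using assms(13) that by (simp add: iid_std_cgauss_mat_def)
  have Hc: "H \<omega> \<in> carrier_mat N\<^sub>R N\<^sub>T" if "\<omega> \<in> space M" for \<omega>
    using Hw[OF that] Sc assms(7,9) by (auto simp: H_def H\<^sub>d_def H\<^sub>r_def outer_prod_def)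
  \<comment> \<open>The white matrix with the mean moved in front of the colouring, so that the
    channel is \<open>X\<close> times the square root of \<open>R\<close>.\<close>
  define X where "X \<omega> i l = a $ i * W.y l + Z \<omega> (i, l)" for \<omega> i l
  have H_entry: "H \<omega> $$ (i, j) = (\<Sum>l<N\<^sub>T. X \<omega> i l * Rsqrt $$ (l, j))"
    if \<omega>: "\<omega> \<in> space M" and ij: "i < N\<^sub>R" "j < N\<^sub>T" for \<omega> i j
  proof -
    have "H \<omega> $$ (i, j) = a $ i * cnj (b $ j) + (H\<^sub>w \<omega> * Rsqrt) $$ (i, j)"
      using Hw[OF \<omega>] Sc assms(7,9) ij by (simp add: H_def H\<^sub>d_def H\<^sub>r_def outer_prod_def del: index_mult_mat(1))
    also have "\<dots> = a $ i * (\<Sum>l<N\<^sub>T. W.y l * Rsqrt $$ (l, j)) + (\<Sum>l<N\<^sub>T. Z \<omega> (i, l) * Rsqrt $$ (l, j))"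
      unfolding index_mult_mat_sum[OF Hw[OF \<omega>] Sc ij] W.y_S[OF ij(2)] using ij by (simp add: Z_def)
    also have "\<dots> = (\<Sum>l<N\<^sub>T. X \<omega> i l * Rsqrt $$ (l, j))"
      by (simp add: X_def distrib_right sum.distrib sum_distrib_left mult.assoc)
    finally show ?thesis .
  qed
  have g_entry: "W.T (X \<omega> i) k = Y \<omega> (i, k) + a $ i * c k" if "i < N\<^sub>R" "k < N\<^sub>T" for \<omega> i k
  proof -
    have "W.T (X \<omega> i) k = a $ i * W.T W.y k + W.T (\<lambda>l. Z \<omega> (i, l)) k"
      unfolding X_def by (simp only: rot_lincomb[OF W.T(1)])
    then show ?thesis using T'(2) that by (simp add: Y_def c_def)
  qed
  have D_meas: "D \<in> borel_measurable (cgauss_vec ?X)"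
    unfolding D_def by (rule measurable_dist2) (use pos in \<open>auto intro!: borel_measurable_add\<close>)
  have \<gamma>_meas: "\<gamma>\<^sub>1 \<in> borel_measurable M"
    unfolding \<gamma>\<^sub>1_def
  proof (rule zf_snr_measurable[OF Hc pos(2)])
    fix i j assume ij: "i < N\<^sub>R" "j < N\<^sub>T"
    have "(\<lambda>\<omega>. Z \<omega> (i, l)) \<in> borel_measurable M" if "l < N\<^sub>T" for l
      using ij that by (intro measurable_compose[OF Zm] measurable_cgauss_vec_component) auto
    then have "(\<lambda>\<omega>. \<Sum>l<N\<^sub>T. X \<omega> i l * Rsqrt $$ (l, j)) \<in> borel_measurable M"
      unfolding X_def by (intro borel_measurable_sum borel_measurable_times borel_measurable_add measurable_const) auto
    then show "(\<lambda>\<omega>. H \<omega> $$ (i, j)) \<in> borel_measurable M"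
      by (subst measurable_cong[OF H_entry[OF _ ij]])
  qed
  have "AE z in cgauss_vec (?I \<times> set (0 # ?js)). pivots ?I (\<lambda>j i. z (i, j) + a $ i * c j) (0 # ?js)"
    using len by (intro AE_pivots[where C = "\<lambda>i j. a $ i * c j"] dist_js) auto
  then have "AE z in distr M (cgauss_vec ?X) Y. pivots ?I (\<lambda>j i. z (i, j) + a $ i * c j) (0 # ?js)"
    unfolding Yd set_js .
  then have "AE \<omega> in M. pivots ?I (\<lambda>j i. Y \<omega> (i, j) + a $ i * c j) (0 # ?js)"
    by (rule AE_distrD[OF Ym])
  \<comment> \<open>For dependent columns \<open>minv\<close> returns its default value and the
    identity may fail, so it is claimed almost surely only.\<close>
  then have \<gamma>_eq: "AE \<omega> in M. \<gamma>\<^sub>1 \<omega> = \<Gamma>\<^sub>1 * D (Y \<omega>)"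
  proof (rule AE_mp, intro AE_I2 impI)
    fix \<omega> assume \<omega>: "\<omega> \<in> space M" and piv: "pivots ?I (\<lambda>j i. Y \<omega> (i, j) + a $ i * c j) (0 # ?js)"
    have "indep_cols ?I (\<lambda>k i. Y \<omega> (i, k) + a $ i * c k) ?J"
      using indep_cols_pivots[OF _ dist_js piv] by (simp only: set_js finite_lessThan)
    also have "?this \<longleftrightarrow> indep_cols ?I (\<lambda>k i. W.T (X \<omega> i) k) ?J"
      by (intro indep_cols_cong) (simp add: g_entry)
    finally have "indep_cols ?I (\<lambda>j i. \<Sum>l<N\<^sub>T. X \<omega> i l * Rsqrt $$ (l, j)) ?J"
      by (rule W.indep_cols_colour)
    also have "?this \<longleftrightarrow> indep_cols ?I (\<lambda>j i. H \<omega> $$ (i, j)) ?J"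
      using H_entry[OF \<omega>] by (intro indep_cols_cong) simp
    finally have "\<gamma>\<^sub>1 \<omega> = \<Gamma>\<^sub>s * dist2 ?I (\<lambda>j i. H \<omega> $$ (i, j)) ?js (\<lambda>i. H \<omega> $$ (i, 0))"
      unfolding \<gamma>\<^sub>1_def by (rule zf_snr_dist2[OF Hc[OF \<omega>] pos(2)])
    also have "dist2 ?I (\<lambda>j i. H \<omega> $$ (i, j)) ?js (\<lambda>i. H \<omega> $$ (i, 0)) =
        dist2 ?I (\<lambda>j i. \<Sum>l<N\<^sub>T. X \<omega> i l * Rsqrt $$ (l, j)) ?js (\<lambda>i. \<Sum>l<N\<^sub>T. X \<omega> i l * Rsqrt $$ (l, 0))"
      by (rule dist2_cong) (use H_entry[OF \<omega>] pos in auto)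
    also have "\<dots> = t * dist2 ?I (\<lambda>k i. W.T (X \<omega> i) k) ?js (\<lambda>i. W.T (X \<omega> i) 0)"
      by (rule W.dist2_colour) simp
    also have "dist2 ?I (\<lambda>k i. W.T (X \<omega> i) k) ?js (\<lambda>i. W.T (X \<omega> i) 0) = D (Y \<omega>)"
      unfolding D_def by (rule dist2_cong) (use g_entry pos in auto)
    finally show "\<gamma>\<^sub>1 \<omega> = \<Gamma>\<^sub>1 * D (Y \<omega>)" by (simp add: \<Gamma>1)
  qed
  let ?e = "\<lambda>z. exp (\<tau> * complex_of_real (D z))"
  have em: "?e \<in> borel_measurable (cgauss_vec ?X)" using D_meas by measurable
  have AEe: "AE \<omega> in M. exp (s * complex_of_real (\<gamma>\<^sub>1 \<omega>)) = ?e (Y \<omega>)"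
    using \<gamma>_eq by eventually_elim (simp add: \<tau>_def mult_ac)
  have lm: "(\<lambda>\<omega>. exp (s * complex_of_real (\<gamma>\<^sub>1 \<omega>))) \<in> borel_measurable M" using \<gamma>_meas by measurable
  have rm: "(\<lambda>\<omega>. ?e (Y \<omega>)) \<in> borel_measurable M" by (rule measurable_compose[OF Ym em])
  note core = dist2_mgf[of ?I 0 ?js "\<lambda>i. a $ i" \<tau> c, OF _ dist_js ne_js len a1 \<tau>, folded D_def, unfolded set_js N x2' x1]
  have "integrable (distr M (cgauss_vec ?X) Y) ?e" unfolding Yd by (rule core(1)) simp
  then have "integrable M (\<lambda>\<omega>. ?e (Y \<omega>))" by (rule integrable_distr[OF Ym])
  then have int: "integrable M (\<lambda>\<omega>. exp (s * complex_of_real (\<gamma>\<^sub>1 \<omega>)))"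
    using integrable_cong_AE[OF lm rm AEe] by simp
  have "mgf M \<gamma>\<^sub>1 s = (\<integral>\<omega>. ?e (Y \<omega>) \<partial>M)"
    unfolding mgf_def by (rule integral_cong_AE[OF lm rm AEe])
  also have "\<dots> = (\<integral>z. ?e z \<partial>distr M (cgauss_vec ?X) Y)" by (rule integral_distr[symmetric, OF Ym em])
  finally have mgf: "mgf M \<gamma>\<^sub>1 s = (\<integral>z. ?e z \<partial>cgauss_vec ?X)" unfolding Yd .
  let ?f = "\<lambda>n. exp (- complex_of_real x\<^sub>2) * complex_of_real x\<^sub>2 ^ n / fact n *
        hyp1F1 (of_nat N) (of_nat (n + N\<^sub>R)) (\<Gamma>\<^sub>1 * s / (1 - \<Gamma>\<^sub>1 * s) * x\<^sub>1)"
  have "(\<lambda>n. complex_of_real (poisson_weight x\<^sub>2 n) * hyp1F1 (of_nat N) (of_nat (n + card ?I)) (\<tau> / (1 - \<tau>) * complex_of_real x\<^sub>1)) sums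
      ((1 - \<tau>) ^ N * mgf M \<gamma>\<^sub>1 s)"
    unfolding mgf by (rule core(2)) simp
  also have "(\<lambda>n. complex_of_real (poisson_weight x\<^sub>2 n) * hyp1F1 (of_nat N) (of_nat (n + card ?I)) (\<tau> / (1 - \<tau>) * complex_of_real x\<^sub>1)) = ?f"
    by (simp add: \<tau>_def poisson_weight_def flip: exp_of_real)
  finally have sums: "?f sums ((1 - \<tau>) ^ N * mgf M \<gamma>\<^sub>1 s)" .
  have "1 - \<tau> \<noteq> 0" using \<tau> by auto
  then have "mgf M \<gamma>\<^sub>1 s = 1 / (1 - \<tau>) ^ N * suminf ?f"
    unfolding sums_unique[OF sums, symmetric] by simp
  then show ?thesis
    using int sums_summable[OF sums] unfolding \<tau>_def by blast
qed

end
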